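(* Let $t\in\mathbb R\setminus\{0\}$, and let $R$ be an $\mathbb H_t^{n\times n}$-valued rational function with minimal realization $R(x)=I_{\mathbb H_t^n}+xC(I_{\mathbb H_t^N}-xA)^{-1}B$ (so $R(0)=D=I_{\mathbb H_t^n}$). There is a one-to-one correspondence between minimal factorizations $R=R_1R_2$ with $R_1(0)=R_2(0)=I_{\mathbb H_t^n}$ and supporting projections $\pi$ for the given realization. More precisely, given a supporting projection $\pi$, the factorization $R=R_1R_2$ with $$R_1(x)=I_{\mathbb H_t^n}+xC(I_{\mathbb H_t^N}-xA)^{-1}(I_{\mathbb H_t^N}-\pi)B,\qquad R_2(x)=I_{\mathbb H_t^n}+xC\pi(I_{\mathbb H_t^N}-xA)^{-1}B$$ is minimal, and every minimal factorization of $R$ whose factors take the value $I_{\mathbb H_t^n}$ at the origin is of this form.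
   Context: For real $t\neq 0$, $\mathbb H_t$ is the real associative algebra of elements $q=a+bj_t$ with $a,b\in\mathbb C$, where $\mathbb C\subset\mathbb H_t$, $j_t^2=t$ and $j_t a=\overline a\, j_t$ for $a\in\mathbb C$. $I_{\mathbb H_t^N}$ is the identity matrix in $\mathbb H_t^{N\times N}$. The variable $x$ is real. An $\mathbb H_t^{n\times n}$-valued function $R$ of the real variable $x$, defined at $x=0$, is rational if it can be written as $R(x)=D+xC(I_{\mathbb H_t^N}-xA)^{-1}B$ with $D=R(0)$ and $(C,A,B)\in\mathbb H_t^{n\times N}\times\mathbb H_t^{N\times N}\times\mathbb H_t^{N\times n}$ (a realization). The pair $(C,A)$ is observable if for $h\in\mathbb H_t^N$: $C(I_{\mathbb H_t^N}-xA)^{-1}h=0$ for all $x$ in some interval $(-\varepsilon,\varepsilon)$ if and only if $h=0$. The pair $(A,B)$ is controllable if for $h\in\mathbb H_t^{1\times N}$: $hA^kB=0$ for all $k=0,1,2,\ldots$ if and only if $h=0$. The realization is minimal if $(C,A)$ is observable and $(A,B)$ is controllable; the degree of $R$ is then $N$. A factorization $R=R_1R_2$ into two $\mathbb H_t^{n\times n}$-valued rational functions of degrees $N_1$ and $N_2$ is minimal if $N=N_1+N_2$. A projection is a matrix $\pi\in\mathbb H_t^{N\times N}$ with $\pi^2=\pi$. With $A^\times=A-BD^{-1}C$ (here $D=I_{\mathbb H_t^n}$), the projection $\pi$ is a supporting projection for the realization if $A(\ker\pi)\subset\ker\pi$ and $A^\times(\operatorname{ran}\pi)\subset\operatorname{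ran}\pi$.
   Formalization: For t>0 a factor may have no minimal realization (e.g. 1+xe, e=(1+j_t/√t)/2, in 1+x=(1+x(1−e))(1+xe)), so its degree is undefined; it is then taken as half the degree of diag(R,R), possibly a half-integer. Where a minimal realization exists the degree is unchanged. *)

theory Defs
  imports "Jordan_Normal_Form.Matrix" "HOL-Analysis.Product_Vector"
begin

section \<open>The algebra $H_t$\<close>

text \<open>The pair \<open>(a, b)\<close> stands for $a + b j_t$; addition, zero and real scaling are the componentwise
  ones of the product type.  The product is
  $(a + b j_t)(c + d j_t) = (ac + t b \bar d) + (ad + b \bar c) j_t$.\<close>

type_synonym quat = "complex \<times> complex"

definition qmult :: "real \<Rightarrow> quat \<Rightarrow> quat \<Rightarrow> quat" where
  "qmult t p q =
     (fst p * fst q + of_real t * snd p * cnj (snd q), fst p * snd q + snd p * cnj (fst q))"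

definition of_cplx :: "complex \<Rightarrow> quat" where
  "of_cplx a = (a, 0)"

definition qj :: quat where
  "qj = (0, 1)"

lemma quat_eq: "(a, b) = of_cplx a + qmult t (of_cplx b) qj"
  by (simp add: qmult_def of_cplx_def qj_def)

lemma qj_square: "qmult t qj qj = of_cplx (of_real t)"
  by (simp add: qmult_def of_cplx_def qj_def)

lemma qj_commute: "qmult t qj (of_cplx a) = qmult t (of_cplx (cnj a)) qj"
  by (simp add: qmult_def of_cplx_def qj_def)

lemma qmult_of_cplx: "qmult t (of_cplx a) (of_cplx b) = of_cplx (a * b)"
  by (simp add: qmult_def of_cplx_def)

lemma qmult_assoc: "qmult t (qmult t p q) r = qmult t p (qmult t q r)"
  by (simp add: qmult_def algebra_simps)

lemma qmult_one: "qmult t (of_cplx 1) p = p" "qmult t p (of_cplx 1) = p"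
  by (simp_all add: qmult_def of_cplx_def)

lemma qmult_distrib:
  "qmult t (p + q) r = qmult t p r + qmult t q r"
  "qmult t p (q + r) = qmult t p q + qmult t p r"
  by (simp_all add: qmult_def algebra_simps)

lemma qmult_scaleR:
  "qmult t (c *\<^sub>R p) q = c *\<^sub>R qmult t p q"
  "qmult t p (c *\<^sub>R q) = c *\<^sub>R qmult t p q"
  by (simp_all add: qmult_def scaleR_conv_of_real algebra_simps)


section \<open>Matrices over $H_t$\<close>

text \<open>The coefficient type carries no multiplication of its own (the product depends on \<open>t\<close>), so
  only the additive part of the library's matrix algebra applies, and products, identity matrices
  and inverses are defined here.  Columns in $H_t^N$ are \<open>N\<close> by \<open>1\<close> matrices, rows are \<open>1\<close> by \<open>N\<close>
  matrices.\<close>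

definition qmat_mult :: "quat mat \<Rightarrow> real \<Rightarrow> quat mat \<Rightarrow> quat mat"
    (\<open>(_ \<star>\<^bsub>_\<^esub> _)\<close> [70, 0, 71] 70) where
  "X \<star>\<^bsub>t\<^esub> Y =
     mat (dim_row X) (dim_col Y) (\<lambda>(i, j). \<Sum>k<dim_col X. qmult t (X $$ (i, k)) (Y $$ (k, j)))"

definition qid :: "nat \<Rightarrow> quat mat" where
  "qid N = mat N N (\<lambda>(i, j). if i = j then of_cplx 1 else 0)"

definition qscale :: "real \<Rightarrow> quat mat \<Rightarrow> quat mat" where
  "qscale x X = map_mat (\<lambda>q. x *\<^sub>R q) X"

text \<open>Meaningful only for an invertible square matrix; in the sequel only applied, for \<open>x\<close> near
  \<open>0\<close>, to $I - xA$ and to the value at the origin.\<close>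

definition qinv :: "real \<Rightarrow> quat mat \<Rightarrow> quat mat" where
  "qinv t X = (THE Y. Y \<in> carrier_mat (dim_row X) (dim_row X) \<and>
     X \<star>\<^bsub>t\<^esub> Y = qid (dim_row X) \<and> Y \<star>\<^bsub>t\<^esub> X = qid (dim_row X))"

fun qpow :: "real \<Rightarrow> quat mat \<Rightarrow> nat \<Rightarrow> quat mat" where
  "qpow t X 0 = qid (dim_row X)"
| "qpow t X (Suc k) = qpow t X k \<star>\<^bsub>t\<^esub> X"


section \<open>Rational functions and realizations\<close>

text \<open>A matrix-valued function of the real variable is a total function whose values matter only
  near the origin: rational functions defined at \<open>0\<close> are identified when they agree on a
  neighbourhood of \<open>0\<close> (equivalently, at every point where both are defined).\<close>

definition same_near_0 :: "(real \<Rightarrow> quat mat) \<Rightarrow> (real \<Rightarrow> quat mat) \<Rightarrow> bool"  (infix \<open>\<simeq>\<close> 50) where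
  "R \<simeq> S \<longleftrightarrow> eventually (\<lambda>x. R x = S x) (nhds 0)"

definition resolvent :: "real \<Rightarrow> quat mat \<Rightarrow> real \<Rightarrow> quat mat" where
  "resolvent t A x = qinv t (qid (dim_row A) - qscale x A)"

definition transfer_fun ::
    "real \<Rightarrow> quat mat \<Rightarrow> quat mat \<Rightarrow> quat mat \<Rightarrow> quat mat \<Rightarrow> real \<Rightarrow> quat mat" where
  "transfer_fun t D C A B x = D + qscale x (C \<star>\<^bsub>t\<^esub> resolvent t A x \<star>\<^bsub>t\<^esub> B)"

definition realization ::
    "real \<Rightarrow> nat \<Rightarrow> nat \<Rightarrow> quat mat \<Rightarrow> quat mat \<Rightarrow> quat mat \<Rightarrow> (real \<Rightarrow> quat mat) \<Rightarrow> bool" where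
  "realization t n N C A B R \<longleftrightarrow>
     R 0 \<in> carrier_mat n n \<and>
     C \<in> carrier_mat n N \<and> A \<in> carrier_mat N N \<and> B \<in> carrier_mat N n \<and>
     R \<simeq> transfer_fun t (R 0) C A B"

definition rational_fun :: "real \<Rightarrow> nat \<Rightarrow> (real \<Rightarrow> quat mat) \<Rightarrow> bool" where
  "rational_fun t n R \<longleftrightarrow> (\<exists>N C A B. realization t n N C A B R)"

definition observable :: "real \<Rightarrow> quat mat \<Rightarrow> quat mat \<Rightarrow> bool" where
  "observable t C A \<longleftrightarrow>
     (\<forall>h \<in> carrier_mat (dim_row A) 1.
        (\<exists>\<epsilon>>0. \<forall>x \<in> {-\<epsilon><..<\<epsilon>}. C \<star>\<^bsub>t\<^esub> resolvent t A x \<star>\<^bsub>t\<^esub> h = 0\<^sub>m (dim_row C) 1)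
        \<longleftrightarrow> h = 0\<^sub>m (dim_row A) 1)"

definition controllable :: "real \<Rightarrow> quat mat \<Rightarrow> quat mat \<Rightarrow> bool" where
  "controllable t A B \<longleftrightarrow>
     (\<forall>h \<in> carrier_mat 1 (dim_row A).
        (\<forall>k. h \<star>\<^bsub>t\<^esub> qpow t A k \<star>\<^bsub>t\<^esub> B = 0\<^sub>m 1 (dim_col B)) \<longleftrightarrow> h = 0\<^sub>m 1 (dim_row A))"

definition minimal_realization ::
    "real \<Rightarrow> nat \<Rightarrow> nat \<Rightarrow> quat mat \<Rightarrow> quat mat \<Rightarrow> quat mat \<Rightarrow> (real \<Rightarrow> quat mat) \<Rightarrow> bool" where
  "minimal_realization t n N C A B R \<longleftrightarrow>
     realization t n N C A B R \<and> observable t C A \<and> controllable t A B"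


section \<open>Degree and minimal factorizations\<close>

definition has_minimal_size :: "real \<Rightarrow> nat \<Rightarrow> (real \<Rightarrow> quat mat) \<Rightarrow> nat \<Rightarrow> bool" where
  "has_minimal_size t n R N \<longleftrightarrow> (\<exists>C A B. minimal_realization t n N C A B R)"

definition double_fun :: "nat \<Rightarrow> (real \<Rightarrow> quat mat) \<Rightarrow> real \<Rightarrow> quat mat" where
  "double_fun n R x = four_block_mat (R x) (0\<^sub>m n n) (0\<^sub>m n n) (R x)"

text \<open>The degree is the size of a minimal realization, whenever there is one; this is always the
  case for \<open>t < 0\<close>.  For \<open>t > 0\<close> the algebra is isomorphic to the real \<open>2\<close> by \<open>2\<close> matrices, a
  rational function corresponds to a real \<open>2n\<close> by \<open>2n\<close> one, and a realization of size \<open>N\<close> to a real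
  realization of size \<open>2N\<close>.  A function whose real McMillan degree is odd then has no minimal
  realization over $H_t$: an example is $1 + xe$ with $e = (1 + j_t/\sqrt t)/2$ an idempotent.  Such
  functions occur as factors in minimal factorizations: $1 + x = (1 + x(1-e))(1 + xe)$, where
  \<open>1 + x\<close> has degree \<open>1\<close>.  For them the degree is taken to be half that of \<open>diag(R, R)\<close>, which always
  has a minimal realization; the same formula gives back \<open>N\<close> if \<open>R\<close> has a minimal realization of
  size \<open>N\<close>.  Degrees are thus in general half-integers.\<close>

definition has_degree :: "real \<Rightarrow> nat \<Rightarrow> (real \<Rightarrow> quat mat) \<Rightarrow> real \<Rightarrow> bool" where
  "has_degree t n R d \<longleftrightarrow>
     (if \<exists>N. has_minimal_size t n R N
      then \<exists>N. has_minimal_size t n R N \<and> d = real N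
      else \<exists>M. has_minimal_size t (2 * n) (double_fun n R) M \<and> d = real M / 2)"

definition minimal_factorization ::
    "real \<Rightarrow> nat \<Rightarrow> (real \<Rightarrow> quat mat) \<Rightarrow> (real \<Rightarrow> quat mat) \<Rightarrow> (real \<Rightarrow> quat mat) \<Rightarrow> bool" where
  "minimal_factorization t n R R1 R2 \<longleftrightarrow>
     rational_fun t n R1 \<and> rational_fun t n R2 \<and> R \<simeq> (\<lambda>x. R1 x \<star>\<^bsub>t\<^esub> R2 x) \<and>
     (\<exists>d d1 d2. has_degree t n R d \<and> has_degree t n R1 d1 \<and> has_degree t n R2 d2 \<and> d = d1 + d2)"


section \<open>Supporting projections\<close>

definition qker :: "real \<Rightarrow> nat \<Rightarrow> quat mat \<Rightarrow> quat mat set" where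
  "qker t N P = {h \<in> carrier_mat N 1. P \<star>\<^bsub>t\<^esub> h = 0\<^sub>m N 1}"

definition qran :: "real \<Rightarrow> nat \<Rightarrow> quat mat \<Rightarrow> quat mat set" where
  "qran t N P = (\<lambda>h. P \<star>\<^bsub>t\<^esub> h) ` carrier_mat N 1"

definition A_cross :: "real \<Rightarrow> quat mat \<Rightarrow> quat mat \<Rightarrow> quat mat \<Rightarrow> quat mat \<Rightarrow> quat mat" where
  "A_cross t D C A B = A - B \<star>\<^bsub>t\<^esub> qinv t D \<star>\<^bsub>t\<^esub> C"

definition supporting_projection ::
    "real \<Rightarrow> nat \<Rightarrow> quat mat \<Rightarrow> quat mat \<Rightarrow> quat mat \<Rightarrow> quat mat \<Rightarrow> quat mat \<Rightarrow> bool" where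
  "supporting_projection t N D C A B P \<longleftrightarrow>
     P \<in> carrier_mat N N \<and> P \<star>\<^bsub>t\<^esub> P = P \<and>
     (\<lambda>h. A \<star>\<^bsub>t\<^esub> h) ` qker t N P \<subseteq> qker t N P \<and>
     (\<lambda>h. A_cross t D C A B \<star>\<^bsub>t\<^esub> h) ` qran t N P \<subseteq> qran t N P"

definition left_factor ::
    "real \<Rightarrow> nat \<Rightarrow> nat \<Rightarrow> quat mat \<Rightarrow> quat mat \<Rightarrow> quat mat \<Rightarrow> quat mat \<Rightarrow> real \<Rightarrow> quat mat" where
  "left_factor t n N C A B P = transfer_fun t (qid n) C A ((qid N - P) \<star>\<^bsub>t\<^esub> B)"

definition right_factor ::
    "real \<Rightarrow> nat \<Rightarrow> quat mat \<Rightarrow> quat mat \<Rightarrow> quat mat \<Rightarrow> quat mat \<Rightarrow> real \<Rightarrow> quat mat" where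
  "right_factor t n C A B P = transfer_fun t (qid n) (C \<star>\<^bsub>t\<^esub> P) A B"

end

theory Submission imports Defs begin

text \<open>
  The correspondence holds for a linear system over any field, by three facts: two minimal
  realizations of the same function are similar by a unique change of coordinates; every
  realization reduces to a minimal one; and a product $R_1 R_2$ is realized by the cascade of
  realizations of its factors.  A supporting projection $\pi$ splits the state space as
  $\ker\pi \oplus \operatorname{ran}\pi$, and the state matrix is block triangular in exactly the way
  that makes the system the cascade of its restrictions.  Hence the two factors have realizations whose
  sizes add up to $N$, and since no realization of $R$ has size below $N$ both are minimal
  (\<open>supporting_imp_minimal\<close>).  Conversely, the cascade of minimal realizations of the factors
  of a minimal factorization has size $N$, so it is minimal, and the similarity with the given
  realization carries the obvious projection of the cascade to a supporting projection
  (\<open>minimal_imp_supporting\<close>).  Finally $\pi$ is determined by the factors: they give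
  $C\pi$ and $\pi B$ by observability and controllability, hence the commutator
  $A\pi - \pi A = (1 - \pi) B C \pi$, so the difference of two candidates commutes with $A$, kills $B$
  and vanishes by controllability (\<open>supporting_unique\<close>).

  For $t > 0$ the algebra $H_t$ has zero divisors, and a submodule of $H_t^N$ may fail to be free, so
  this argument is carried out over the complex numbers.  The map
  $a + b j_t \mapsto (a, t b; \bar b, \bar a)$ embeds $H_t^{r \times s}$ into the complex
  $2r \times 2s$ matrices (\<open>chi\<close>), and its image consists of the \<open>Z\<close> with
  $J \bar Z = Z J$ for a fixed matrix $J$ with $J^2 = t$.  Three things have to be transported.
  Observability and controllability over $H_t$ and over the complex numbers agree, because a complex
  vector $w$ can be recovered from the quaternionic vector with the two complex columns $w$ and
  $J \bar w$ (up to a scalar).  The projection found over the complex numbers is quaternionic, because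
  its conjugate $J \bar\pi J^{-1}$ belongs to the same factors and these determine the projection
  (\<open>projection_quaternionic\<close>).  The degree of $R$ is half the complex degree of its image
  (\<open>has_degree_iff\<close>): if $R$ has no minimal realization over $H_t$, then a minimal complex
  realization of its image of size $m$, read as a system over $H_t$, becomes after a change of
  coordinates at input and output a minimal realization of $\operatorname{diag}(R, R)$ of size $m$.

  All complex matrices live in one ring, that of the infinite matrices with finitely many nonzero
  entries in each row and column; sizes are recorded by multiplying with finite identity matrices.
  The linear algebra comes from a single lemma, \<open>right_ideal_kernel\<close>.  Since right ideals play
  the role of subspaces, its conclusion gives bases, complements and quotients by formulas
  between matrices.
\<close>

section \<open>The ring of locally finite matrices\<close>

typedef lfmat = "{f :: nat \<Rightarrow> nat \<Rightarrow> complex. (\<forall>i. finite {j. f i j \<noteq> 0}) \<and> (\<forall>j. finite {i. f i j \<noteq> 0})}"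
  morphisms ent Abs_lfmat
  by (rule exI[of _ "\<lambda>_ _. 0"]) simp

setup_lifting type_definition_lfmat

lemma lfmat_eqI: "(\<And>i j. ent X i j = ent Y i j) \<Longrightarrow> X = Y"
  by (metis ent_inject ext)

lemma finite_row: "finite {j. ent X i j \<noteq> 0}" and finite_col: "finite {i. ent X i j \<noteq> 0}"
  using ent[of X] by auto

definition mult_entry :: "(nat \<Rightarrow> nat \<Rightarrow> complex) \<Rightarrow> (nat \<Rightarrow> nat \<Rightarrow> complex) \<Rightarrow> nat \<Rightarrow> nat \<Rightarrow> complex" where
  "mult_entry f g i k = (\<Sum>j | f i j \<noteq> 0. f i j * g j k)"

instantiation lfmat :: real_algebra_1
begin

lift_definition zero_lfmat :: lfmat is "\<lambda>_ _. 0" by simp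

lift_definition one_lfmat :: lfmat is "\<lambda>i j. if i = j then 1 else 0" by simp

lift_definition plus_lfmat :: "lfmat \<Rightarrow> lfmat \<Rightarrow> lfmat" is "\<lambda>f g i j. f i j + g i j"
proof (intro conjI allI)
  fix f g :: "nat \<Rightarrow> nat \<Rightarrow> complex" and i
  assume f: "(\<forall>i. finite {j. f i j \<noteq> 0}) \<and> (\<forall>j. finite {i. f i j \<noteq> 0})"
    and g: "(\<forall>i. finite {j. g i j \<noteq> 0}) \<and> (\<forall>j. finite {i. g i j \<noteq> 0})"
  show "finite {j. f i j + g i j \<noteq> 0}"
    by (rule finite_subset[of _ "{j. f i j \<noteq> 0} \<union> {j. g i j \<noteq> 0}"]) (use f g in auto)
  show "finite {j. f j i + g j i \<noteq> 0}"
    by (rule finite_subset[of _ "{j. f j i \<noteq> 0} \<union> {j. g j i \<noteq> 0}"]) (use f g in auto)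
qed

lift_definition uminus_lfmat :: "lfmat \<Rightarrow> lfmat" is "\<lambda>f i j. - f i j" by simp

definition minus_lfmat :: "lfmat \<Rightarrow> lfmat \<Rightarrow> lfmat" where "minus_lfmat X Y = X + - Y"

lift_definition scaleR_lfmat :: "real \<Rightarrow> lfmat \<Rightarrow> lfmat" is "\<lambda>c f i j. c *\<^sub>R f i j"
  by (auto intro: finite_subset[rotated])

lift_definition times_lfmat :: "lfmat \<Rightarrow> lfmat \<Rightarrow> lfmat" is mult_entry
proof (intro conjI allI)
  fix f g :: "nat \<Rightarrow> nat \<Rightarrow> complex" and i
  assume f: "(\<forall>i. finite {j. f i j \<noteq> 0}) \<and> (\<forall>j. finite {i. f i j \<noteq> 0})"
    and g: "(\<forall>i. finite {j. g i j \<noteq> 0}) \<and> (\<forall>j. finite {i. g i j \<noteq> 0})"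
  have *: "mult_entry f g i k \<noteq> 0 \<Longrightarrow> \<exists>j. f i j \<noteq> 0 \<and> g j k \<noteq> 0" for i k
    unfolding mult_entry_def by (force elim: sum.not_neutral_contains_not_neutral)
  show "finite {k. mult_entry f g i k \<noteq> 0}"
    by (rule finite_subset[of _ "\<Union>j\<in>{j. f i j \<noteq> 0}. {k. g j k \<noteq> 0}"]) (use f g in \<open>auto dest!: *\<close>)
  show "finite {k. mult_entry f g k i \<noteq> 0}"
    by (rule finite_subset[of _ "\<Union>j\<in>{j. g j i \<noteq> 0}. {k. f k j \<noteq> 0}"]) (use f g in \<open>auto dest!: *\<close>)
qed

lemma ent_times_row:
  assumes "finite S" "\<And>j. j \<notin> S \<Longrightarrow> ent X i j = 0 \<or> ent Y j k = 0"
  shows "ent (X * Y) i k = (\<Sum>j\<in>S. ent X i j * ent Y j k)"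
proof -
  have "ent (X * Y) i k = (\<Sum>j | ent X i j \<noteq> 0. ent X i j * ent Y j k)"
    by (simp add: times_lfmat.rep_eq mult_entry_def)
  also have "\<dots> = (\<Sum>j\<in>S. ent X i j * ent Y j k)"
    by (rule sum.mono_neutral_cong) (use assms finite_row[of X i] in auto)
  finally show ?thesis .
qed

lemma ent_times_rows: "ent (X * Y) i k = (\<Sum>j | ent X i j \<noteq> 0. ent X i j * ent Y j k)"
  by (rule ent_times_row) (auto simp: finite_row)

lemma ent_times_cols: "ent (X * Y) i k = (\<Sum>j | ent Y j k \<noteq> 0. ent X i j * ent Y j k)"
  by (rule ent_times_row) (auto simp: finite_col)

lemma lfmat_assoc: "(X * Y) * Z = X * (Y * (Z::lfmat))"
proof (rule lfmat_eqI)
  fix i l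
  let ?S = "{j. ent X i j \<noteq> 0}" and ?T = "{k. ent Z k l \<noteq> 0}"
  have "ent ((X * Y) * Z) i l = (\<Sum>k\<in>?T. ent (X * Y) i k * ent Z k l)"
    by (rule ent_times_row) (auto simp: finite_col)
  also have "\<dots> = (\<Sum>k\<in>?T. \<Sum>j\<in>?S. ent X i j * ent Y j k * ent Z k l)"
    by (subst ent_times_row[of ?S]) (auto simp: finite_row sum_distrib_right)
  also have "\<dots> = (\<Sum>j\<in>?S. \<Sum>k\<in>?T. ent X i j * (ent Y j k * ent Z k l))"
    by (subst sum.swap) (simp add: mult.assoc)
  also have "\<dots> = (\<Sum>j\<in>?S. ent X i j * ent (Y * Z) j l)"
    by (subst ent_times_row[of ?T Y _ Z]) (auto simp: finite_col sum_distrib_left)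
  also have "\<dots> = ent (X * (Y * Z)) i l"
    by (rule ent_times_row[symmetric]) (auto simp: finite_row)
  finally show "ent ((X * Y) * Z) i l = ent (X * (Y * Z)) i l" .
qed

instance
proof
  fix X Y Z :: lfmat and a b :: real
  show "X + Y + Z = X + (Y + Z)" by transfer (simp add: add.assoc)
  show "X + Y = Y + X" by transfer (simp add: add.commute)
  show "0 + X = X" by transfer simp
  show "- X + X = 0" by transfer simp
  show "X - Y = X + - Y" by (rule minus_lfmat_def)
  show "X * Y * Z = X * (Y * Z)" by (rule lfmat_assoc)
  show "1 * X = X"
  proof (rule lfmat_eqI)
    fix i j
    show "ent (1 * X) i j = ent X i j"
      by (subst ent_times_row[of "{i}"]) (auto simp: one_lfmat.rep_eq)
  qed
  show "X * 1 = X"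
  proof (rule lfmat_eqI)
    fix i j
    show "ent (X * 1) i j = ent X i j"
      by (subst ent_times_row[of "{j}"]) (auto simp: one_lfmat.rep_eq)
  qed
  show "(X + Y) * Z = X * Z + Y * Z"
    by (rule lfmat_eqI) (simp add: plus_lfmat.rep_eq ent_times_cols[where Y=Z] algebra_simps sum.distrib)
  show "X * (Y + Z) = X * Y + X * Z"
    by (rule lfmat_eqI) (simp add: plus_lfmat.rep_eq ent_times_rows[where X=X] algebra_simps sum.distrib)
  show "(0::lfmat) \<noteq> 1" by transfer (auto simp: fun_eq_iff)
  show "a *\<^sub>R (X + Y) = a *\<^sub>R X + a *\<^sub>R Y" by transfer (simp add: algebra_simps)
  show "(a + b) *\<^sub>R X = a *\<^sub>R X + b *\<^sub>R X" by transfer (simp add: algebra_simps)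
  show "a *\<^sub>R b *\<^sub>R X = (a * b) *\<^sub>R X" by transfer simp
  show "1 *\<^sub>R X = X" by transfer simp
  show "a *\<^sub>R X * Y = a *\<^sub>R (X * Y)"
    by (rule lfmat_eqI) (simp add: scaleR_lfmat.rep_eq ent_times_cols[where Y=Y] scaleR_sum_right)
  show "X * a *\<^sub>R Y = a *\<^sub>R (X * Y)"
    by (rule lfmat_eqI) (simp add: scaleR_lfmat.rep_eq ent_times_rows[where X=X] scaleR_sum_right)
qed

end

lemma ent_minus: "ent (X - Y) i j = ent X i j - ent Y i j"
  by (simp only: diff_conv_add_uminus plus_lfmat.rep_eq uminus_lfmat.rep_eq)

lemmas ent_simps [simp] = zero_lfmat.rep_eq one_lfmat.rep_eq plus_lfmat.rep_eq uminus_lfmat.rep_eq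
  ent_minus scaleR_lfmat.rep_eq

lift_definition transp :: "lfmat \<Rightarrow> lfmat" is "\<lambda>f i j. f j i" by simp

lift_definition conjm :: "lfmat \<Rightarrow> lfmat" is "\<lambda>f i j. cnj (f i j)" by simp

text \<open>The scalar \<open>\<i>\<close>.  It is an element of the ring because the ring is only made a real algebra,
  so that entrywise conjugation is compatible with the scalars.\<close>

lift_definition iunit :: lfmat is "\<lambda>i j. if i = j then \<i> else 0" by simp

text \<open>The identity matrix of size \<open>n\<close>, padded by zeros: \<open>idm n * X = X\<close> says that \<open>X\<close> vanishes
  outside the first \<open>n\<close> rows.\<close>

lift_definition idm :: "nat \<Rightarrow> lfmat" is "\<lambda>n i j. if i = j \<and> i < n then 1 else 0"
  by (auto intro: finite_subset[of _ "{n}" for n])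

lift_definition unit_mat :: "complex \<Rightarrow> nat \<Rightarrow> nat \<Rightarrow> lfmat" is
  "\<lambda>z k l i j. if i = k \<and> j = l then z else 0"
  by (auto intro: finite_subset[of _ "{n}" for n])

lemmas ent_simps2 [simp] = transp.rep_eq conjm.rep_eq iunit.rep_eq idm.rep_eq unit_mat.rep_eq

lemma transp_mult: "transp (X * Y) = transp Y * transp X"
  by (rule lfmat_eqI) (simp add: ent_times_rows[where X=X] ent_times_cols[where Y="transp X"] mult.commute)

lemma transp_simps [simp]:
  "transp (transp X) = X" "transp 0 = 0" "transp 1 = 1" "transp (X + Y) = transp X + transp Y" "transp (X - Y) = transp X - transp Y"
  "transp (x *\<^sub>R X) = x *\<^sub>R transp X" "transp (idm n) = idm n"
  by (rule lfmat_eqI; auto)+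

lemma transp_power: "transp (X ^ k) = transp X ^ k"
  by (induction k) (simp_all add: transp_mult power_commutes)

lemma transp_inject [simp]: "transp X = transp Y \<longleftrightarrow> X = Y"
  by (metis transp_simps(1))

lemma conjm_mult: "conjm (X * Y) = conjm X * conjm Y"
  by (rule lfmat_eqI) (simp add: ent_times_rows[where X=X] ent_times_rows[where X="conjm X"])

lemma conjm_simps [simp]:
  "conjm (conjm X) = X" "conjm 0 = 0" "conjm 1 = 1" "conjm (X + Y) = conjm X + conjm Y" "conjm (X - Y) = conjm X - conjm Y"
  "conjm (x *\<^sub>R X) = x *\<^sub>R conjm X" "conjm (idm n) = idm n" "conjm iunit = - iunit" "conjm (- X) = - conjm X"
  by (rule lfmat_eqI; auto)+

lemma iunit_central: "iunit * X = X * iunit"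
proof (rule lfmat_eqI)
  fix i j
  have "ent (iunit * X) i j = \<i> * ent X i j"
    by (subst ent_times_row[of "{i}"]) auto
  also have "\<dots> = ent (X * iunit) i j"
    by (subst ent_times_row[of "{j}"]) auto
  finally show "ent (iunit * X) i j = ent (X * iunit) i j" .
qed

lemma iunit_square: "iunit * iunit = - 1"
proof (rule lfmat_eqI)
  fix i j
  show "ent (iunit * iunit) i j = ent (- 1) i j"
    by (subst ent_times_row[of "{i}"]) auto
qed

lemma ent_idm_mult: "ent (idm n * X) i j = (if i < n then ent X i j else 0)"
  by (subst ent_times_row[of "{i}"]) auto

lemma ent_mult_idm: "ent (X * idm n) i j = (if j < n then ent X i j else 0)"
  by (subst ent_times_row[of "{j}"]) auto

lemma ent_unit_mult: "ent (unit_mat z k l * X) i j = (if i = k then z * ent X l j else 0)"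
  by (subst ent_times_row[of "{l}"]) auto

lemma ent_mult_unit: "ent (X * unit_mat z k l) i j = (if j = l then ent X i k * z else 0)"
  by (subst ent_times_row[of "{k}"]) auto

lemma idm_mult: "idm m * idm n = idm (min m n)"
  by (rule lfmat_eqI) (auto simp: ent_idm_mult)

lemma idm_idem [simp]: "idm n * idm n = idm n" "idm n * (idm n * X) = idm n * X"
  by (simp_all add: idm_mult flip: mult.assoc)

lemma idm_0 [simp]: "idm 0 = 0"
  by (rule lfmat_eqI) auto

lemma idm_left_iff: "idm n * X = X \<longleftrightarrow> (\<forall>i j. n \<le> i \<longrightarrow> ent X i j = 0)"
  by (metis ent_idm_mult lfmat_eqI not_less)

lemma idm_right_iff: "X * idm n = X \<longleftrightarrow> (\<forall>i j. n \<le> j \<longrightarrow> ent X i j = 0)"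
  by (metis ent_mult_idm lfmat_eqI not_less)

lemma ent_mult_mid:
  assumes "X * idm n = X \<or> idm n * Y = Y"
  shows "ent (X * Y) i j = (\<Sum>k<n. ent X i k * ent Y k j)"
  by (rule ent_times_row) (use assms in \<open>auto simp: idm_left_iff idm_right_iff\<close>)

text \<open>The monomial matrix that sends the basis vector \<open>j\<close> to the basis vector \<open>f j\<close>.  Injectivity of
  \<open>f\<close> keeps the rows finite; otherwise the value is zero.\<close>

lift_definition reindex :: "(nat \<Rightarrow> nat) \<Rightarrow> lfmat" is "\<lambda>f i j. if inj f \<and> i = f j then 1 else 0"
proof (intro conjI allI)
  fix f :: "nat \<Rightarrow> nat" and i
  show "finite {j. (if inj f \<and> i = f j then 1 else 0) \<noteq> (0::complex)}"
    by (cases "inj f") (auto intro: finite_subset[of _ "f -` {i}"] finite_vimageI)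
  show "finite {j. (if inj f \<and> j = f i then 1 else 0) \<noteq> (0::complex)}"
    by (auto intro: finite_subset[of _ "{f i}"])
qed

lemma ent_mult_reindex: "inj f \<Longrightarrow> ent (X * reindex f) i j = ent X i (f j)"
  by (subst ent_times_row[of "{f j}"]) (auto simp: reindex.rep_eq)

lemma ent_transp_reindex_mult: "inj f \<Longrightarrow> ent (transp (reindex f) * X) i j = ent X (f i) j"
  by (subst ent_times_row[of "{f i}"]) (auto simp: reindex.rep_eq)

lemma transp_reindex_reindex: "inj f \<Longrightarrow> transp (reindex f) * reindex f = 1"
  by (rule lfmat_eqI) (auto simp: ent_mult_reindex reindex.rep_eq inj_eq)

lemma conjm_reindex [simp]: "conjm (reindex f) = reindex f" "conjm (transp (reindex f)) = transp (reindex f)"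
  by (rule lfmat_eqI; simp add: reindex.rep_eq)+

lemma ent_reindex_mult: "inj f \<Longrightarrow> ent (reindex f * X) i j = (if i \<in> range f then ent X (inv_into UNIV f i) j else 0)"
  by (subst ent_times_row[of "{inv_into UNIV f i}"]) (auto simp: reindex.rep_eq f_inv_into_f)

section \<open>Right ideals and their kernels\<close>

text \<open>Dividing out one vector: if the entry \<open>w j k\<close> is nonzero, subtract from \<open>v\<close> the multiple of column \<open>k\<close>
  of \<open>w\<close> that makes row \<open>j\<close> vanish, then drop that row.  The kernel of this map consists of multiples
  of \<open>w\<close>, which is the step that lowers the dimension in the next lemma.\<close>

lemma delete_coordinate:
  assumes w: "idm r * w = w" "w \<noteq> 0"
  obtains s L M y where "r = Suc s" "L * M = idm s" "idm s * L = L" "L * idm r = L"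
    "idm r * M = M" "M * idm s = M" "\<And>v. idm r * v = v \<Longrightarrow> L * v = 0 \<Longrightarrow> v = w * (y * v)"
proof -
  from \<open>w \<noteq> 0\<close> obtain j k where jk: "ent w j k \<noteq> 0"
    by (metis lfmat_eqI zero_lfmat.rep_eq)
  with w(1) have "j < r" by (metis idm_left_iff not_less)
  then obtain s where r: "r = Suc s" by (cases r) auto
  define skip where "skip i = (if i < j then i else Suc i)" for i
  have inj: "inj skip"
    unfolding skip_def by (rule injI) (auto split: if_splits)
  define D where "D = reindex skip * idm s"
  define E where "E = unit_mat 1 j j"
  \<comment> \<open>\<open>w * y\<close> is the idempotent projecting onto column \<open>k\<close> of \<open>w\<close> along
    the vectors whose coordinate \<open>j\<close> vanishes.\<close>
  define y where "y = unit_mat (1 / ent w j k) k j"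
  have entD: "ent D i l = (if l < s \<and> i = skip l then 1 else 0)" for i l
    by (simp add: D_def ent_mult_idm reindex.rep_eq inj)
  have DD: "transp D * D = idm s"
    by (simp add: D_def transp_mult mult.assoc) (simp add: transp_reindex_reindex[OF inj] flip: mult.assoc)
  have rD: "idm r * D = D"
    by (rule lfmat_eqI) (auto simp: ent_idm_mult entD r skip_def)
  have Ds: "D * idm s = D" by (simp add: D_def mult.assoc)
  have yD: "y * D = 0"
    by (rule lfmat_eqI) (auto simp: y_def ent_unit_mult entD skip_def)
  have wyr: "y * idm r = y"
    by (rule lfmat_eqI) (use \<open>j < r\<close> in \<open>auto simp: y_def ent_mult_idm\<close>)
  have EE: "E * (idm r - w * y) = 0"
    by (rule lfmat_eqI)
      (use \<open>j < r\<close> jk in \<open>auto simp: E_def y_def ent_unit_mult ent_mult_unit\<close>)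
  have DtD: "D * transp D = idm r - E"
  proof (rule lfmat_eqI)
    fix a b
    have "ent (D * transp D) a b = (\<Sum>l<s. ent D a l * ent D b l)"
      by (subst ent_mult_mid[where n=s]) (auto simp: Ds)
    also have "\<dots> = (\<Sum>l<s. if a = skip l \<and> b = a then 1 else 0)"
      by (intro sum.cong) (auto simp: entD)
    also have "\<dots> = (if b = a \<and> a < r \<and> a \<noteq> j then 1 else 0)"
    proof (cases "b = a \<and> a < r \<and> a \<noteq> j")
      case True
      define l0 where "l0 = (if a < j then a else a - 1)"
      have l0: "l0 < s" "a = skip l0" using True \<open>j < r\<close> by (auto simp: l0_def skip_def r)
      have "(\<Sum>l<s. if a = skip l \<and> b = a then 1 else 0) = (\<Sum>l<s. if l = l0 then (1::complex) else 0)"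
        by (intro sum.cong) (use True l0 injD[OF inj] in auto)
      then show ?thesis using True l0 by simp
    next
      case False
      have "a \<noteq> skip l" if "l < s" "b = a" for l
        using False that \<open>j < r\<close> by (auto simp: skip_def r)
      then have "(\<Sum>l<s. if a = skip l \<and> b = a then 1 else 0) = (0::complex)"
        by (intro sum.neutral) auto
      then show ?thesis by (simp only: False if_False)
    qed
    also have "\<dots> = ent (idm r - E) a b"
      using \<open>j < r\<close> by (auto simp: E_def)
    finally show "ent (D * transp D) a b = ent (idm r - E) a b" .
  qed
  define L where "L = transp D * (idm r - w * y)"
  show thesis
  proof
    show "r = Suc s" by fact
    show "L * D = idm s"
      by (simp add: L_def algebra_simps rD yD DD)
    show "idm s * L = L"
      using arg_cong[OF Ds, of transp] by (simp add: L_def transp_mult flip: mult.assoc)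
    show "L * idm r = L"
      by (simp add: L_def algebra_simps wyr)
    show "idm r * D = D" "D * idm s = D" by fact+
    fix v assume v: "idm r * v = v" "L * v = 0"
    have "idm r * (idm r - w * y) = idm r - w * y"
      by (simp add: right_diff_distrib w(1) flip: mult.assoc)
    then have "(idm r - w * y) * v = (idm r * (idm r - w * y)) * v - (E * (idm r - w * y)) * v"
      by (simp add: EE)
    also have "\<dots> = (idm r - E) * ((idm r - w * y) * v)"
      by (simp only: left_diff_distrib[of "idm r" E] mult.assoc)
    also have "\<dots> = D * (L * v)"
      by (simp add: L_def flip: DtD mult.assoc)
    finally show "v = w * (y * v)"
      using v by (simp add: algebra_simps)
  qed
qed

text \<open>A set of matrices with \<open>m\<close> rows closed under sums and right multiplication stands for the subspace
  spanned by all their columns.  It is the kernel of a matrix \<open>L\<close> with a right inverse: start with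
  \<open>L = idm m\<close>, and as long as some \<open>u\<close> in the ideal has \<open>L * u \<noteq> 0\<close> divide out \<open>L * u\<close>.  The rows of \<open>L\<close>
  are coordinates on the quotient by the subspace.\<close>

lemma right_ideal_kernel:
  assumes sub: "\<And>h. h \<in> U \<Longrightarrow> idm m * h = h" and zero: "0 \<in> U"
    and add: "\<And>g h. g \<in> U \<Longrightarrow> h \<in> U \<Longrightarrow> g + h \<in> U"
    and mul: "\<And>g h. h \<in> U \<Longrightarrow> h * g \<in> U"
  obtains r L M where "r \<le> m" "L * M = idm r" "idm r * L = L" "L * idm m = L"
    "idm m * M = M" "M * idm r = M" "\<And>h. idm m * h = h \<Longrightarrow> h \<in> U \<longleftrightarrow> L * h = 0"
    "r < m \<or> U = {0}"
proof -
  define G where "G r L M \<longleftrightarrow> L * M = idm r \<and> idm r * L = L \<and> L * idm m = L \<and>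
    idm m * M = M \<and> M * idm r = M \<and> (\<forall>h. idm m * h = h \<longrightarrow> L * h = 0 \<longrightarrow> h \<in> U)" for r L M
  have start: "G m (idm m) (idm m)"
    using zero by (auto simp: G_def)
  have step: "\<exists>s L' M'. r = Suc s \<and> G s L' M'" if G: "G r L M" and u: "u \<in> U" "L * u \<noteq> 0" for r L M u
  proof -
    have "idm r * (L * u) = L * u"
      using G by (simp add: G_def flip: mult.assoc)
    then obtain s L2 M2 y where s: "r = Suc s" "L2 * M2 = idm s" "idm s * L2 = L2" "L2 * idm r = L2"
      "idm r * M2 = M2" "M2 * idm s = M2"
      "\<And>v. idm r * v = v \<Longrightarrow> L2 * v = 0 \<Longrightarrow> v = L * u * (y * v)"
      using u(2) by (rule delete_coordinate) blast
    have "G s (L2 * L) (M * M2)"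
      unfolding G_def
    proof (intro conjI allI impI)
      have "L2 * L * (M * M2) = L2 * ((L * M) * M2)" by (simp only: mult.assoc)
      also have "\<dots> = idm s" using G s by (simp add: G_def)
      finally show "L2 * L * (M * M2) = idm s" .
      show "idm s * (L2 * L) = L2 * L" using s by (simp flip: mult.assoc)
      show "L2 * L * idm m = L2 * L" using G by (simp add: G_def mult.assoc)
      show "idm m * (M * M2) = M * M2" using G by (simp add: G_def flip: mult.assoc)
      show "M * M2 * idm s = M * M2" using s by (simp add: mult.assoc)
      fix h assume h: "idm m * h = h" "L2 * L * h = 0"
      have "L * h = L * u * (y * (L * h))"
        by (rule s(7)) (use h G in \<open>simp_all add: G_def flip: mult.assoc\<close>)
      then have "L * (h - u * (y * (L * h))) = 0"
        by (simp add: algebra_simps)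
      moreover have "idm m * (h - u * (y * (L * h))) = h - u * (y * (L * h))"
        using h sub[OF u(1)] by (simp add: right_diff_distrib flip: mult.assoc)
      ultimately have "h - u * (y * (L * h)) \<in> U" using G by (simp add: G_def)
      from add[OF this mul[OF u(1), of "y * (L * h)"]] show "h \<in> U" by simp
    qed
    with s(1) show ?thesis by blast
  qed
  \<comment> \<open>The kernel of \<open>L\<close> is always inside \<open>U\<close>; it fills \<open>U\<close> once the number of rows cannot be lowered.\<close>
  define r where "r = (LEAST r. \<exists>L M. G r L M)"
  from start have ex: "\<exists>r L M. G r L M" by blast
  from LeastI_ex[OF this] obtain L M where G: "G r L M"
    unfolding r_def by blast
  have least: "r \<le> s" if "G s L' M'" for s L' M'
    unfolding r_def by (rule Least_le) (use that in blast)
  have "L * u = 0" if "u \<in> U" for u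
    using step[OF G that] least by (metis not_less_eq_eq order_refl)
  moreover have "r < m \<or> U = {0}"
  proof (cases "U = {0}")
    case False
    then obtain u where "u \<in> U" "u \<noteq> 0" using zero by blast
    then have "\<exists>s L' M'. m = Suc s \<and> G s L' M'"
      by (intro step[OF start]) (auto simp: sub)
    then show ?thesis using least by (metis less_Suc_eq_le)
  qed simp
  ultimately show thesis
    using G least[OF start] by (intro that[of r L M]) (auto simp: G_def)
qed

lemma trace_commute:
  assumes "X * idm b = X" "idm a * X = X"
  shows "(\<Sum>i<a. ent (X * Y) i i) = (\<Sum>j<b. ent (Y * X) j j)"
proof -
  have "(\<Sum>i<a. ent (X * Y) i i) = (\<Sum>i<a. \<Sum>j<b. ent X i j * ent Y j i)"
    by (subst ent_mult_mid[where n=b]) (use assms in auto)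
  also have "\<dots> = (\<Sum>j<b. \<Sum>i<a. ent Y j i * ent X i j)"
    by (subst sum.swap) (simp add: mult.commute)
  also have "\<dots> = (\<Sum>j<b. ent (Y * X) j j)"
    by (subst ent_mult_mid[where n=a]) (use assms in auto)
  finally show ?thesis .
qed

lemma trace_idm: "(\<Sum>i<n. ent (idm n) i i) = of_nat n"
  by simp

text \<open>Invariance of dimension, by comparing traces of the two identity matrices.\<close>

lemma size_unique:
  assumes "X * idm b = X" "idm a * X = X" "X * Y = idm a" "Y * X = idm b"
  shows "a = b"
  using trace_commute[OF assms(1,2), of Y] unfolding assms(3,4) trace_idm by simp

section \<open>Resolvents near the origin\<close>

definition fits :: "nat \<Rightarrow> lfmat \<Rightarrow> bool" where
  "fits n X \<longleftrightarrow> idm n * X = X \<and> X * idm n = X"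

lemma fits_mult: "fits n X \<Longrightarrow> fits n Y \<Longrightarrow> fits n (X * Y)"
  by (metis fits_def mult.assoc)

lemma fits_diff: "fits n X \<Longrightarrow> fits n Y \<Longrightarrow> fits n (X - Y)"
  by (simp add: fits_def algebra_simps)

lemma fits_mono:
  assumes "idm a * X = X" "X * idm b = X" "a \<le> n" "b \<le> n"
  shows "fits n X"
  using assms unfolding fits_def idm_left_iff idm_right_iff by (meson order_trans)

definition nrm :: "nat \<Rightarrow> lfmat \<Rightarrow> real" where
  "nrm n X = (\<Sum>i<n. \<Sum>j<n. cmod (ent X i j))"

lemma nrm_nonneg [simp]: "nrm n X \<ge> 0"
  by (auto simp: nrm_def intro!: sum_nonneg)

lemma nrm_add: "nrm n (X + Y) \<le> nrm n X + nrm n Y"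
  by (simp add: nrm_def norm_triangle_ineq sum_mono flip: sum.distrib)

lemma nrm_diff: "nrm n (X - Y) \<le> nrm n X + nrm n Y"
  by (simp add: nrm_def norm_triangle_ineq4 sum_mono flip: sum.distrib)

lemma nrm_scale: "nrm n (x *\<^sub>R X) = \<bar>x\<bar> * nrm n X"
  by (simp add: nrm_def norm_mult sum_distrib_left)

lemma nrm_idm: "nrm n (idm n) = n"
proof -
  have "nrm n (idm n) = (\<Sum>i<n. \<Sum>j<n. if i = j then 1 else 0)"
    unfolding nrm_def by (intro sum.cong) auto
  then show ?thesis by simp
qed

lemma nrm_eq_0:
  assumes "fits n X" "nrm n X \<le> 0"
  shows "X = 0"
proof (rule lfmat_eqI)
  fix i j
  have "nrm n X = 0" using assms(2) nrm_nonneg[of n X] by linarith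
  then have "ent X i j = 0" if "i < n" "j < n"
    using that unfolding nrm_def by (subst (asm) sum_nonneg_eq_0_iff, simp, force intro: sum_nonneg)
      (auto simp: sum_nonneg_eq_0_iff)
  moreover have "ent X i j = 0" if "\<not> i < n \<or> \<not> j < n"
    using that assms(1) by (auto simp: fits_def idm_left_iff idm_right_iff)
  ultimately show "ent X i j = ent 0 i j" by auto
qed

lemma nrm_mult:
  assumes "X * idm n = X \<or> idm n * Y = Y"
  shows "nrm n (X * Y) \<le> nrm n X * nrm n Y"
proof -
  let ?x = "\<lambda>i j. cmod (ent X i j)" and ?y = "\<lambda>i j. cmod (ent Y i j)"
  have row: "(\<Sum>j<n. ?y k j) \<le> nrm n Y" if "k < n" for k
    unfolding nrm_def by (rule member_le_sum) (use that in \<open>auto intro: sum_nonneg\<close>)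
  have "nrm n (X * Y) \<le> (\<Sum>i<n. \<Sum>j<n. \<Sum>k<n. ?x i k * ?y k j)"
    unfolding nrm_def
    by (intro sum_mono, subst ent_mult_mid[OF assms], rule order_trans[OF norm_sum])
      (simp add: norm_mult)
  also have "\<dots> = (\<Sum>i<n. \<Sum>k<n. ?x i k * (\<Sum>j<n. ?y k j))"
    by (rule sum.cong[OF refl], subst sum.swap) (simp add: sum_distrib_left)
  also have "\<dots> \<le> (\<Sum>i<n. \<Sum>k<n. ?x i k * nrm n Y)"
    by (intro sum_mono mult_left_mono row) auto
  also have "\<dots> = nrm n X * nrm n Y"
    by (simp add: nrm_def sum_distrib_right)
  finally show ?thesis .
qed

text \<open>In the ring with unit the resolvent of a finite matrix \<open>a\<close> is the identity outside the block of \<open>a\<close>,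
  so no size has to be mentioned.\<close>

definition two_sided_inverse :: "lfmat \<Rightarrow> lfmat" where
  "two_sided_inverse X = (THE Y. X * Y = 1 \<and> Y * X = 1)"

lemma two_sided_inverse_eqI: "X * Y = 1 \<Longrightarrow> Y * X = 1 \<Longrightarrow> two_sided_inverse X = Y"
  unfolding two_sided_inverse_def by (rule the_equality) (simp, metis mult.assoc mult_1_left mult_1_right)

definition res :: "lfmat \<Rightarrow> real \<Rightarrow> lfmat" where
  "res a x = two_sided_inverse (1 - x *\<^sub>R a)"

definition regular :: "lfmat \<Rightarrow> real \<Rightarrow> bool" where
  "regular a x \<longleftrightarrow> (1 - x *\<^sub>R a) * res a x = 1 \<and> res a x * (1 - x *\<^sub>R a) = 1"

lemma res_eqI: "(1 - x *\<^sub>R a) * Y = 1 \<Longrightarrow> Y * (1 - x *\<^sub>R a) = 1 \<Longrightarrow> res a x = Y"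
  unfolding res_def by (rule two_sided_inverse_eqI)

lemma regularI: "(1 - x *\<^sub>R a) * Y = 1 \<Longrightarrow> Y * (1 - x *\<^sub>R a) = 1 \<Longrightarrow> regular a x"
  unfolding regular_def using res_eqI[of x a Y] by simp

lemma regular_left: "regular a x \<Longrightarrow> res a x = 1 + x *\<^sub>R (a * res a x)"
  unfolding regular_def by (simp add: algebra_simps)

lemma res_commute:
  assumes "regular a x" "a * g = g * a"
  shows "res a x * g = g * res a x"
proof -
  let ?d = "1 - x *\<^sub>R a"
  have "?d * g = g * ?d" using assms(2) by (simp add: algebra_simps)
  then have "res a x * (?d * g) * res a x = res a x * (g * ?d) * res a x" by simp
  then have "(res a x * ?d) * (g * res a x) = (res a x * g) * (?d * res a x)"
    by (simp only: mult.assoc)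
  with assms(1) show ?thesis by (simp add: regular_def)
qed

text \<open>The source of every comparison of transfer functions below: maps between state spaces that commute
  with the dynamics commute with the resolvents.\<close>

lemma res_intertwine:
  assumes "regular a x" "regular a' x" "g * a = a' * g"
  shows "g * res a x = res a' x * g"
proof -
  have "g * (1 - x *\<^sub>R a) = (1 - x *\<^sub>R a') * g" using assms(3) by (simp add: algebra_simps)
  then have "res a' x * (g * (1 - x *\<^sub>R a)) * res a x = res a' x * ((1 - x *\<^sub>R a') * g) * res a x"
    by simp
  then have "(res a' x * g) * ((1 - x *\<^sub>R a) * res a x) = (res a' x * (1 - x *\<^sub>R a')) * (g * res a x)"
    by (simp only: mult.assoc)
  with assms(1,2) show ?thesis by (simp add: regular_def)
qed

lemma small_solution_zero:
  assumes fits: "fits n a" and small: "\<bar>x\<bar> * nrm n a < 1"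
    and h: "h * idm n = h" "h = x *\<^sub>R (h * a)"
  shows "h = 0"
proof (rule lfmat_eqI)
  fix i j
  have h_a: "unit_mat 1 0 i * h = x *\<^sub>R (unit_mat 1 0 i * h * a)"
    using h(2) by (metis mult.assoc mult_scaleR_right)
  let ?g = "unit_mat 1 0 i * h"
  show "ent h i j = ent 0 i j"
  proof (cases "n = 0")
    case True
    then show ?thesis using h by (metis idm_0 mult_zero_right)
  next
    case False
    have g: "fits n ?g"
      unfolding fits_def
    proof
      show "idm n * ?g = ?g"
        by (rule lfmat_eqI) (use False in \<open>auto simp: ent_idm_mult ent_unit_mult\<close>)
      show "?g * idm n = ?g" by (simp add: mult.assoc h(1))
    qed
    have "nrm n ?g \<le> \<bar>x\<bar> * (nrm n ?g * nrm n a)"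
      using nrm_mult[of ?g n a] g
      by (subst h_a) (simp add: nrm_scale fits_def mult_left_mono)
    then have "nrm n ?g * (1 - \<bar>x\<bar> * nrm n a) \<le> 0" by (simp add: algebra_simps)
    then have "nrm n ?g \<le> 0" using small by (simp add: mult_le_0_iff)
    then have "?g = 0" using nrm_eq_0[OF g] by blast
    then show ?thesis using ent_unit_mult[of 1 0 i h 0 j] by simp
  qed
qed

text \<open>The column space of \<open>1 - x a\<close> is a right ideal, so it is cut out by some \<open>L\<close>; and \<open>L = x L a\<close>
  forces \<open>L = 0\<close> for small \<open>x\<close>.\<close>

lemma right_inverse_small:
  assumes fits: "fits n a" and small: "\<bar>x\<bar> * nrm n a < 1"
  obtains r where "(1 - x *\<^sub>R a) * r = 1"
proof -
  define U where "U = {(1 - x *\<^sub>R a) * g | g. idm n * g = g}"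
  have a: "idm n * a = a" "a * idm n = a" using fits by (auto simp: fits_def)
  obtain r L M where L: "L * idm n = L" "\<And>h. idm n * h = h \<Longrightarrow> h \<in> U \<longleftrightarrow> L * h = 0"
  proof (rule right_ideal_kernel[of U n])
    fix h assume "h \<in> U"
    then obtain g where g: "idm n * g = g" "h = (1 - x *\<^sub>R a) * g" by (auto simp: U_def)
    have "idm n * ((1 - x *\<^sub>R a) * g) = (1 - x *\<^sub>R a) * g"
      using g(1) a by (simp add: algebra_simps flip: mult.assoc)
    with g(2) show "idm n * h = h" by simp
    show "h * k \<in> U" for k
      unfolding U_def g(2) by (rule CollectI, rule exI[of _ "g * k"]) (simp add: g(1) mult.assoc flip: mult.assoc[of "idm n"])
  next
    show "0 \<in> U" unfolding U_def by (rule CollectI, rule exI[of _ 0]) simp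
  next
    fix g h assume "g \<in> U" "h \<in> U"
    then obtain g' h' where "idm n * g' = g'" "g = (1 - x *\<^sub>R a) * g'" "idm n * h' = h'" "h = (1 - x *\<^sub>R a) * h'"
      by (auto simp: U_def)
    then show "g + h \<in> U"
      unfolding U_def by (intro CollectI exI[of _ "g' + h'"]) (simp add: distrib_left)
  qed (rule that)
  have im: "(1 - x *\<^sub>R a) * idm n \<in> U"
    unfolding U_def by auto
  have "idm n * ((1 - x *\<^sub>R a) * idm n) = (1 - x *\<^sub>R a) * idm n"
    by (simp add: algebra_simps a flip: mult.assoc)
  then have "L * ((1 - x *\<^sub>R a) * idm n) = 0" using L(2) im by blast
  then have "L = x *\<^sub>R (L * a)" by (simp add: algebra_simps L(1) a)
  then have "L = 0" by (rule small_solution_zero[OF fits small L(1)])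
  then have "idm n \<in> U" using L(2)[of "idm n"] by simp
  then obtain g where g: "idm n * g = g" "(1 - x *\<^sub>R a) * g = idm n" by (auto simp: U_def)
  have "a * (1 - idm n) = 0" using a by (simp add: algebra_simps)
  then have "(1 - x *\<^sub>R a) * (g + (1 - idm n)) = 1"
    using g(2) by (simp add: algebra_simps)
  then show thesis by (rule that)
qed

lemma fits_transp: "fits n a \<Longrightarrow> fits n (transp a)"
  by (metis fits_def transp_mult transp_simps(7))

lemma nrm_transp: "nrm n (transp a) = nrm n a"
  unfolding nrm_def by (subst sum.swap) simp

lemma regular_small:
  assumes fits: "fits n a" and small: "\<bar>x\<bar> * nrm n a < 1"
  shows "regular a x"
proof -
  obtain r where r: "(1 - x *\<^sub>R a) * r = 1" by (rule right_inverse_small[OF assms])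
  obtain s where s: "(1 - x *\<^sub>R transp a) * s = 1"
    by (rule right_inverse_small[of n "transp a" x]) (use assms in \<open>auto simp: fits_transp nrm_transp\<close>)
  have s': "transp s * (1 - x *\<^sub>R a) = 1"
    using arg_cong[OF s, of transp] by (simp add: transp_mult)
  have "transp s = r" using r s' by (metis mult.assoc mult_1_left mult_1_right)
  with r s' show ?thesis by (intro regularI[of _ _ r]) auto
qed

lemma nrm_res_bound:
  assumes fits: "fits n a" and small: "\<bar>x\<bar> * nrm n a \<le> 1 / 2"
  shows "nrm n (idm n * res a x) \<le> 2 * n"
proof -
  have "regular a x" using regular_small[OF fits, of x] small by simp
  then have "res a x = 1 + x *\<^sub>R (a * res a x)" by (rule regular_left)
  moreover have a: "idm n * a = a" "a * idm n = a" using fits by (auto simp: fits_def)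
  ultimately have eq: "idm n * res a x = idm n + x *\<^sub>R (a * (idm n * res a x))"
    by (metis (no_types, opaque_lifting) distrib_left mult.assoc mult.right_neutral mult_scaleR_right)
  have "nrm n (idm n * res a x) \<le> nrm n (idm n) + nrm n (x *\<^sub>R (a * (idm n * res a x)))"
    by (subst eq) (rule nrm_add)
  also have "\<dots> \<le> n + \<bar>x\<bar> * (nrm n a * nrm n (idm n * res a x))"
    by (simp add: nrm_idm nrm_scale mult_left_mono nrm_mult a)
  also have "\<dots> = n + (\<bar>x\<bar> * nrm n a) * nrm n (idm n * res a x)" by simp
  also have "\<dots> \<le> n + 1/2 * nrm n (idm n * res a x)"
    using small by (intro add_left_mono mult_right_mono) auto
  finally show ?thesis by simp
qed

lemma eventually_small: "\<forall>\<^sub>F x in nhds (0::real). \<bar>x\<bar> * K \<le> 1/2"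
proof -
  have "((\<lambda>x::real. \<bar>x\<bar> * K) \<longlongrightarrow> \<bar>0\<bar> * K) (nhds 0)"
    by (intro tendsto_intros filterlim_ident)
  then have "\<forall>\<^sub>F x in nhds (0::real). \<bar>x\<bar> * K < 1/2"
    by (rule order_tendstoD) simp
  then show ?thesis by eventually_elim simp
qed

lemma eventually_regular:
  assumes "fits n a"
  shows "\<forall>\<^sub>F x in nhds 0. regular a x"
  using eventually_small[of "nrm n a"] by eventually_elim (rule regular_small[OF assms], simp)

lemma nhds_imp_at: "eventually P (nhds x) \<Longrightarrow> eventually P (at x)"
  by (auto simp: eventually_at_filter elim: eventually_mono)

text \<open>Equal functions have equal Taylor coefficients, without power series: the resolvent is
  \<open>1 + x a (1 - x a)\<^sup>-\<^sup>1\<close> and bounded near the origin, so the limit \<open>x \<longlonglongrightarrow> 0\<close> gives the equality of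
  the constant terms, and after division by \<open>x\<close> the hypothesis holds with \<open>c * a\<close> in place of \<open>c\<close>.\<close>

lemma coefficients_eq:
  assumes a: "fits n a" "fits n a'" and h: "fits n h" "fits n h'"
    and c: "fits n c" "fits n c'"
    and ev: "\<forall>\<^sub>F x in at 0. c * res a x * h = c' * res a' x * h'"
  shows "c * a ^ k * h = c' * a' ^ k * h'"
proof -
  have *: "c * h = c' * h' \<and> (\<forall>\<^sub>F x in at 0. c * a * res a x * h = c' * a' * res a' x * h')"
    if c: "fits n c" "fits n c'" and ev: "\<forall>\<^sub>F x in at 0. c * res a x * h = c' * res a' x * h'" for c c'
  proof -
    define K where "K = nrm n (c * a) * (2 * n) * nrm n h + nrm n (c' * a') * (2 * n) * nrm n h'"
    have reg: "\<forall>\<^sub>F x in at (0::real). regular a x \<and> regular a' x \<and> \<bar>x\<bar> * nrm n a \<le> 1/2 \<and> \<bar>x\<bar> * nrm n a' \<le> 1/2"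
      using eventually_regular[OF a(1)] eventually_regular[OF a(2)] eventually_small[of "nrm n a"] eventually_small[of "nrm n a'"]
      by (simp add: eventually_conj_iff nhds_imp_at)
    have key: "\<forall>\<^sub>F x in at 0. c * h - c' * h' = x *\<^sub>R (c' * a' * res a' x * h' - c * a * res a x * h)"
      using ev reg
    proof eventually_elim
      case (elim x)
      then have 1: "res a x = 1 + x *\<^sub>R (a * res a x)" "res a' x = 1 + x *\<^sub>R (a' * res a' x)"
        using regular_left by blast+
      have "c * res a x * h = c * h + x *\<^sub>R (c * a * res a x * h)"
        by (subst 1(1)) (simp add: algebra_simps)
      moreover have "c' * res a' x * h' = c' * h' + x *\<^sub>R (c' * a' * res a' x * h')"
        by (subst 1(2)) (simp add: algebra_simps)
      ultimately show ?case using elim by (simp add: algebra_simps)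
    qed
    have bound: "nrm n (c * a * res a x * h) \<le> nrm n (c * a) * (2 * n) * nrm n h"
      if "fits n a" "fits n c" "fits n h" "\<bar>x\<bar> * nrm n a \<le> 1/2" for c a h and x :: real
    proof -
      have ca: "c * a * idm n = c * a" using that by (simp add: fits_def mult.assoc)
      then have "c * a * res a x * h = c * a * idm n * res a x * h" by simp
      also have "\<dots> = (c * a) * (idm n * res a x) * h" by (simp only: mult.assoc)
      also have "nrm n \<dots> \<le> nrm n ((c * a) * (idm n * res a x)) * nrm n h"
        by (rule nrm_mult) (use that in \<open>simp add: fits_def\<close>)
      also have "\<dots> \<le> nrm n (c * a) * nrm n (idm n * res a x) * nrm n h"
        by (intro mult_right_mono nrm_mult) (use ca in auto)
      also have "\<dots> \<le> nrm n (c * a) * (2 * n) * nrm n h"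
        by (intro mult_right_mono mult_left_mono nrm_res_bound) (use that in auto)
      finally show ?thesis .
    qed
    have "\<forall>\<^sub>F x in at 0. nrm n (c * h - c' * h') \<le> \<bar>x\<bar> * K"
      using key reg
    proof eventually_elim
      case (elim x)
      have "nrm n (c * h - c' * h') \<le> \<bar>x\<bar> * (nrm n (c' * a' * res a' x * h') + nrm n (c * a * res a x * h))"
        by (subst elim(1)) (simp add: nrm_scale mult_left_mono nrm_diff)
      also have "\<dots> \<le> \<bar>x\<bar> * K"
        unfolding K_def using bound[of a c h x] bound[of a' c' h' x] a h c elim(2)
        by (intro mult_left_mono) auto
      finally show ?case .
    qed
    moreover have "((\<lambda>x::real. \<bar>x\<bar> * K) \<longlongrightarrow> \<bar>0\<bar> * K) (at 0)"
      by (intro tendsto_intros)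
    ultimately have "nrm n (c * h - c' * h') \<le> \<bar>0\<bar> * K"
      by (intro tendsto_lowerbound) auto
    then have zero: "c * h - c' * h' = 0"
      by (intro nrm_eq_0[of n]) (auto intro!: fits_diff fits_mult c h)
    have "\<forall>\<^sub>F x in at 0. c * a * res a x * h = c' * a' * res a' x * h'"
      using key eventually_neq_at_within[of 0 0 UNIV] by eventually_elim (use zero in auto)
    with zero show ?thesis by simp
  qed
  show ?thesis
    using c ev
  proof (induction k arbitrary: c c')
    case (0 c c')
    show ?case using *[OF 0] by simp
  next
    case (Suc k c c')
    have "c * a * a ^ k * h = c' * a' * a' ^ k * h'"
      using *[OF Suc.prems] by (intro Suc.IH fits_mult Suc.prems a) auto
    then show ?case by (simp add: mult.assoc)
  qed
qed

text \<open>Expanding \<open>k\<close> times gives \<open>c (1 - x a)\<^sup>-\<^sup>1 h = x\<^sup>k c a\<^sup>k (1 - x a)\<^sup>-\<^sup>1 h\<close>, and the right-hand side tends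
  to \<open>0\<close> as \<open>k\<close> grows.\<close>

lemma vanishing_resolvent:
  assumes a: "fits n a" and c: "fits n c" and h: "fits n h"
    and x: "\<bar>x\<bar> * nrm n a < 1"
    and vanish: "\<And>k. c * a ^ k * h = 0"
  shows "c * res a x * h = 0"
proof -
  have reg: "regular a x" by (rule regular_small[OF a x])
  have expand: "c * res a x * h = x ^ k *\<^sub>R (c * a ^ k * res a x * h)" for k
  proof (induction k)
    case (Suc k)
    have "c * a ^ k * res a x * h = c * a ^ k * h + x *\<^sub>R (c * a ^ Suc k * res a x * h)"
      by (subst regular_left[OF reg]) (simp add: algebra_simps power_Suc2 del: power_Suc)
    with Suc vanish show ?case by (simp add: mult.commute)
  qed simp
  have ca: "fits n (c * a ^ k) \<and> nrm n (c * a ^ k) \<le> nrm n c * nrm n a ^ k" for k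
  proof (induction k)
    case (Suc k)
    have "nrm n (c * a ^ k * a) \<le> nrm n (c * a ^ k) * nrm n a"
      by (rule nrm_mult) (use a in \<open>simp add: fits_def\<close>)
    also have "\<dots> \<le> nrm n c * nrm n a ^ k * nrm n a"
      using Suc by (simp add: mult_right_mono)
    finally show ?case
      using Suc fits_mult[of n "c * a ^ k" a] a by (simp add: power_Suc2 mult.assoc del: power_Suc)
  qed (use c in simp)
  let ?q = "\<bar>x\<bar> * nrm n a" and ?B = "nrm n c * nrm n (res a x * h)"
  have "nrm n (c * res a x * h) \<le> ?q ^ k * ?B" for k
  proof -
    have "nrm n (c * res a x * h) = \<bar>x\<bar> ^ k * nrm n (c * a ^ k * (res a x * h))"
      by (subst expand[of k]) (simp add: nrm_scale power_abs mult.assoc)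
    also have "\<dots> \<le> \<bar>x\<bar> ^ k * (nrm n (c * a ^ k) * nrm n (res a x * h))"
      by (intro mult_left_mono nrm_mult) (use ca[of k] in \<open>auto simp: fits_def\<close>)
    also have "\<dots> \<le> \<bar>x\<bar> ^ k * (nrm n c * nrm n a ^ k * nrm n (res a x * h))"
      by (intro mult_left_mono mult_right_mono) (use ca[of k] in auto)
    also have "\<dots> = ?q ^ k * ?B" by (simp add: power_mult_distrib)
    finally show ?thesis .
  qed
  moreover have "(\<lambda>k. ?q ^ k * ?B) \<longlonglongrightarrow> 0 * ?B"
    by (intro tendsto_mult_right LIMSEQ_power_zero) (use x in \<open>simp add: abs_mult\<close>)
  ultimately have "nrm n (c * res a x * h) \<le> 0 * ?B"
    by (intro LIMSEQ_le_const) auto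
  moreover have "fits n (c * res a x * h)"
    using c h by (simp add: fits_def flip: mult.assoc) (simp add: mult.assoc)
  ultimately show ?thesis using nrm_eq_0 by simp
qed

section \<open>Minimal realizations over the complex numbers\<close>

definition system :: "nat \<Rightarrow> nat \<Rightarrow> lfmat \<Rightarrow> lfmat \<Rightarrow> lfmat \<Rightarrow> bool" where
  "system p m c a b \<longleftrightarrow> idm p * c = c \<and> c * idm m = c \<and> idm m * a = a \<and> a * idm m = a \<and>
     idm m * b = b \<and> b * idm p = b"

text \<open>The value \<open>F 0\<close> is the feedthrough term.  Observability and controllability are stated with powers of
  \<open>a\<close> and test matrices \<open>h\<close> of any width, which is the same as testing vectors.\<close>

definition realizes :: "nat \<Rightarrow> nat \<Rightarrow> lfmat \<Rightarrow> lfmat \<Rightarrow> lfmat \<Rightarrow> (real \<Rightarrow> lfmat) \<Rightarrow> bool" where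
  "realizes p m c a b F \<longleftrightarrow> system p m c a b \<and>
     (\<forall>\<^sub>F x in nhds 0. F x = F 0 + x *\<^sub>R (c * res a x * b))"

definition cplx_observable :: "nat \<Rightarrow> lfmat \<Rightarrow> lfmat \<Rightarrow> bool" where
  "cplx_observable m c a \<longleftrightarrow> (\<forall>h. idm m * h = h \<longrightarrow> (\<forall>k. c * a ^ k * h = 0) \<longrightarrow> h = 0)"

definition cplx_controllable :: "nat \<Rightarrow> lfmat \<Rightarrow> lfmat \<Rightarrow> bool" where
  "cplx_controllable m a b \<longleftrightarrow> (\<forall>h. h * idm m = h \<longrightarrow> (\<forall>k. h * a ^ k * b = 0) \<longrightarrow> h = 0)"

definition cplx_minimal :: "nat \<Rightarrow> nat \<Rightarrow> lfmat \<Rightarrow> lfmat \<Rightarrow> lfmat \<Rightarrow> (real \<Rightarrow> lfmat) \<Rightarrow> bool" where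
  "cplx_minimal p m c a b F \<longleftrightarrow> realizes p m c a b F \<and> cplx_observable m c a \<and> cplx_controllable m a b"

definition cplx_degree :: "nat \<Rightarrow> (real \<Rightarrow> lfmat) \<Rightarrow> nat \<Rightarrow> bool" where
  "cplx_degree p F m \<longleftrightarrow> (\<exists>c a b. cplx_minimal p m c a b F)"

lemma cplx_observableD: "cplx_observable m c a \<Longrightarrow> idm m * h = h \<Longrightarrow> (\<And>k. c * a ^ k * h = 0) \<Longrightarrow> h = 0"
  by (auto simp: cplx_observable_def)

lemma cplx_controllableD: "cplx_controllable m a b \<Longrightarrow> h * idm m = h \<Longrightarrow> (\<And>k. h * a ^ k * b = 0) \<Longrightarrow> h = 0"
  by (auto simp: cplx_controllable_def)

lemma system_fits:
  assumes "system p m c a b" "p \<le> n" "m \<le> n"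
  shows "fits n a" "fits n b" "fits n c"
  using assms fits_mono unfolding system_def by metis+

lemma system_regular: "system p m c a b \<Longrightarrow> \<forall>\<^sub>F x in nhds 0. regular a x"
  by (rule eventually_regular) (rule system_fits(1)[of p m c a b "max p m"], auto)

lemma realizes_system: "realizes p m c a b F \<Longrightarrow> system p m c a b"
  by (simp add: realizes_def)

lemma realizes_cong:
  assumes "realizes p m c a b F" "\<forall>\<^sub>F x in nhds 0. F x = G x"
  shows "realizes p m c a b G"
proof -
  have F0: "F 0 = G 0" using eventually_nhds_x_imp_x[OF assms(2)] .
  have "\<forall>\<^sub>F x in nhds 0. F x = F 0 + x *\<^sub>R (c * res a x * b)"
    using assms(1) by (simp add: realizes_def)
  with assms(2) have "\<forall>\<^sub>F x in nhds 0. G x = G 0 + x *\<^sub>R (c * res a x * b)"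
    by eventually_elim (simp add: F0)
  with assms(1) show ?thesis by (simp add: realizes_def)
qed

lemma cplx_degree_cong: "cplx_degree p F m \<Longrightarrow> \<forall>\<^sub>F x in nhds 0. F x = G x \<Longrightarrow> cplx_degree p G m"
  unfolding cplx_degree_def cplx_minimal_def using realizes_cong by blast

lemma intertwine_power: "g * a = a' * g \<Longrightarrow> g * a ^ k = a' ^ k * (g :: 'a :: monoid_mult)"
proof (induction k)
  case (Suc k)
  have "g * a ^ Suc k = (a' * g) * a ^ k" using Suc.prems by (simp flip: mult.assoc)
  also have "\<dots> = a' ^ Suc k * g" using Suc by (simp add: mult.assoc)
  finally show ?case .
qed simp

lemma markov:
  assumes F: "realizes p m c a b F" and F': "realizes p m' c' a' b' F"
  shows "c * a ^ k * b = c' * a' ^ k * b'"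
proof -
  let ?n = "max p (max m m')"
  have ev: "\<forall>\<^sub>F x in at 0. F x = F 0 + x *\<^sub>R (c * res a x * b)"
    "\<forall>\<^sub>F x in at 0. F x = F 0 + x *\<^sub>R (c' * res a' x * b')"
    using assms by (auto simp: realizes_def intro: nhds_imp_at)
  have "\<forall>\<^sub>F x in at 0. c * res a x * b = c' * res a' x * b'"
    using ev eventually_neq_at_within[of 0 0 UNIV] by eventually_elim auto
  then show ?thesis
    using system_fits[OF realizes_system[OF F], of ?n] system_fits[OF realizes_system[OF F'], of ?n]
    by (intro coefficients_eq[of ?n]) auto
qed

text \<open>Transposition exchanges observability and controllability, so the reduction to minimal
  realizations need only treat one of them.\<close>

lemma system_transp: "system p m c a b \<Longrightarrow> system p m (transp b) (transp a) (transp c)"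
  unfolding system_def by (metis transp_mult transp_simps(7))

lemma res_transp:
  assumes "regular a x"
  shows "res (transp a) x = transp (res a x)"
proof (rule res_eqI)
  have eq: "1 - x *\<^sub>R transp a = transp (1 - x *\<^sub>R a)" by simp
  show "(1 - x *\<^sub>R transp a) * transp (res a x) = 1" "transp (res a x) * (1 - x *\<^sub>R transp a) = 1"
    using assms unfolding eq transp_mult[symmetric] regular_def by simp_all
qed

lemma realizes_transp:
  assumes "realizes p m c a b F"
  shows "realizes p m (transp b) (transp a) (transp c) (\<lambda>x. transp (F x))"
proof -
  have "\<forall>\<^sub>F x in nhds 0. F x = F 0 + x *\<^sub>R (c * res a x * b)" "\<forall>\<^sub>F x in nhds 0. regular a x"
    using assms system_regular by (auto simp: realizes_def)
  then have "\<forall>\<^sub>F x in nhds 0. transp (F x) = transp (F 0) + x *\<^sub>R (transp b * res (transp a) x * transp c)"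
  proof eventually_elim
    case (elim x)
    show ?case by (subst elim(1)) (simp add: res_transp[OF elim(2)] transp_mult mult.assoc)
  qed
  with assms show ?thesis by (simp add: realizes_def system_transp)
qed

lemma cplx_observable_transp: "cplx_observable m (transp b) (transp a) \<longleftrightarrow> cplx_controllable m a b"
proof -
  have 1: "(\<forall>k. transp b * transp a ^ k * h = 0) \<longleftrightarrow> (\<forall>k. transp h * a ^ k * b = 0)" for h
  proof -
    have "transp (transp h * a ^ k * b) = transp b * transp a ^ k * h" for k
      by (simp add: transp_mult transp_power mult.assoc)
    then show ?thesis by (metis transp_inject transp_simps(2))
  qed
  have 2: "idm m * h = h \<longleftrightarrow> transp h * idm m = transp h" for h
    by (metis transp_inject transp_mult transp_simps(7))
  show ?thesis
    unfolding cplx_observable_def cplx_controllable_def 1 2 by (metis transp_simps(1,2))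
qed

lemma cplx_controllable_transp: "cplx_controllable m (transp a) (transp c) \<longleftrightarrow> cplx_observable m c a"
  using cplx_observable_transp[of m "transp c" "transp a"] by simp

lemma cplx_minimal_transp: "cplx_minimal p m c a b F \<Longrightarrow> cplx_minimal p m (transp b) (transp a) (transp c) (\<lambda>x. transp (F x))"
  by (simp add: cplx_minimal_def realizes_transp cplx_observable_transp cplx_controllable_transp)

text \<open>A state \<open>h\<close> of the first system and a state \<open>h'\<close> of the second are matched when they produce the same
  outputs.  The states that have a match form a right ideal \<open>V\<close>, which contains all reachable states and
  hence everything; the match of the identity matrix is \<open>S\<close>.\<close>

lemma half_similarity:
  assumes system: "system p m c a b" and system': "system p m' c' a' b'"
    and markov: "\<And>k. c * a ^ k * b = c' * a' ^ k * b'"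
    and obs: "cplx_observable m c a" and ctr: "cplx_controllable m' a' b'"
  obtains S where "idm m * S = S" "S * idm m' = S" "c * S = c'" "a * S = S * a'" "S * b' = b"
proof -
  note s = system[unfolded system_def] and s' = system'[unfolded system_def]
  define V where "V = {h'. idm m' * h' = h' \<and> (\<exists>h. idm m * h = h \<and> (\<forall>k. c * a ^ k * h = c' * a' ^ k * h'))}"
  obtain r L M where L: "L * idm m' = L" "\<And>h. idm m' * h = h \<Longrightarrow> h \<in> V \<longleftrightarrow> L * h = 0"
  proof (rule right_ideal_kernel[of V m'])
    show "0 \<in> V" unfolding V_def by (auto intro: exI[of _ 0])
    show "idm m' * h = h" if "h \<in> V" for h using that by (simp add: V_def)
    show "g + h \<in> V" if gh: "g \<in> V" "h \<in> V" for g h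
    proof -
      from gh obtain g1 h1 where "idm m * g1 = g1" "\<forall>k. c * a ^ k * g1 = c' * a' ^ k * g"
        "idm m * h1 = h1" "\<forall>k. c * a ^ k * h1 = c' * a' ^ k * h"
        by (auto simp: V_def)
      then show ?thesis
        using gh unfolding V_def by (auto intro!: exI[of _ "g1 + h1"] simp: distrib_left)
    qed
    show "h * g \<in> V" if h: "h \<in> V" for g h
    proof -
      from h obtain h1 where "idm m * h1 = h1" "\<forall>k. c * a ^ k * h1 = c' * a' ^ k * h"
        by (auto simp: V_def)
      then show ?thesis
        using h unfolding V_def by (auto intro!: exI[of _ "h1 * g"] simp flip: mult.assoc)
    qed
  qed (rule that)
  have id_power: "idm m * (a ^ k * h) = a ^ k * h" if "idm m * a = a" "idm m * h = h" for m a h k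
    by (cases k) (use that in \<open>simp_all flip: mult.assoc\<close>)
  have "L = 0"
  proof (rule cplx_controllableD[OF ctr L(1)])
    fix j
    have id: "idm m' * (a' ^ j * b') = a' ^ j * b'" "idm m * (a ^ j * b) = a ^ j * b"
      using s s' by (auto intro: id_power)
    have "a' ^ j * b' \<in> V"
      unfolding V_def
    proof (intro CollectI conjI exI[of _ "a ^ j * b"] allI)
      show "idm m' * (a' ^ j * b') = a' ^ j * b'" "idm m * (a ^ j * b) = a ^ j * b"
        by (fact id)+
      show "c * a ^ k * (a ^ j * b) = c' * a' ^ k * (a' ^ j * b')" for k
        using markov[of "k + j"] by (simp add: power_add mult.assoc)
    qed
    then show "L * a' ^ j * b' = 0" using L(2)[OF id(1)] by (simp add: mult.assoc)
  qed
  \<comment> \<open>A right ideal that contains the identity gives the whole map \<open>S\<close> at once, with no choice of a basis.\<close>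
  then have "idm m' \<in> V" using L(2) by simp
  then obtain h where h: "idm m * h = h" "\<And>k. c * a ^ k * h = c' * a' ^ k * idm m'"
    by (auto simp: V_def)
  have pow_id: "c' * a' ^ k * idm m' = c' * a' ^ k" for k
  proof (cases k)
    case (Suc j)
    have "c' * a' ^ k * idm m' = c' * a' ^ j * (a' * idm m')"
      unfolding Suc power_Suc2 by (simp only: mult.assoc)
    also have "\<dots> = c' * a' ^ k" using s' unfolding Suc power_Suc2 by (simp add: mult.assoc)
    finally show ?thesis .
  qed (use s' in simp)
  define S where "S = h * idm m'"
  have cS: "c * a ^ k * S = c' * a' ^ k" for k
  proof -
    have "c * a ^ k * S = (c * a ^ k * h) * idm m'" by (simp only: S_def mult.assoc)
    also have "\<dots> = c' * a' ^ k" by (simp add: h(2) pow_id)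
    finally show ?thesis .
  qed
  have S: "idm m * S = S" "S * idm m' = S"
    unfolding S_def using h(1) by (simp flip: mult.assoc, simp add: mult.assoc)
  show thesis
  proof
    show "idm m * S = S" "S * idm m' = S" by fact+
    show "c * S = c'" using cS[of 0] by simp
    have "a * S - S * a' = 0"
    proof (rule cplx_observableD[OF obs])
      show "idm m * (a * S - S * a') = a * S - S * a'"
        using s S by (simp add: right_diff_distrib flip: mult.assoc)
      fix k
      have "c * a ^ k * (a * S - S * a') = c * a ^ Suc k * S - c * a ^ k * S * a'"
        by (simp only: right_diff_distrib power_Suc2 mult.assoc)
      also have "\<dots> = 0" unfolding cS by (simp only: power_Suc2 mult.assoc diff_self)
      finally show "c * a ^ k * (a * S - S * a') = 0" .
    qed
    then show "a * S = S * a'" by simp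
    have "S * b' - b = 0"
    proof (rule cplx_observableD[OF obs])
      show "idm m * (S * b' - b) = S * b' - b"
        using s S by (simp add: right_diff_distrib flip: mult.assoc)
      show "c * a ^ k * (S * b' - b) = 0" for k
        using markov[of k] cS[of k] by (simp add: right_diff_distrib flip: mult.assoc)
    qed
    then show "S * b' = b" by simp
  qed
qed

lemma similarity:
  assumes F: "cplx_minimal p m c a b F" and F': "cplx_minimal p m' c' a' b' F"
  obtains S T where "idm m * S = S" "S * idm m' = S" "idm m' * T = T" "T * idm m = T"
    "S * T = idm m" "T * S = idm m'" "c * S = c'" "a * S = S * a'" "S * b' = b"
    "c' * T = c" "a' * T = T * a" "T * b = b'"
proof -
  have system: "system p m c a b" "system p m' c' a' b'" and obs: "cplx_observable m c a" "cplx_observable m' c' a'"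
    and ctr: "cplx_controllable m a b" "cplx_controllable m' a' b'"
    using assms by (auto simp: cplx_minimal_def realizes_def)
  have markov: "c * a ^ k * b = c' * a' ^ k * b'" for k
    by (rule markov) (use assms in \<open>auto simp: cplx_minimal_def\<close>)
  obtain S where S: "idm m * S = S" "S * idm m' = S" "c * S = c'" "a * S = S * a'" "S * b' = b"
    using half_similarity[OF system markov obs(1) ctr(2)] .
  obtain T where T: "idm m' * T = T" "T * idm m = T" "c' * T = c" "a' * T = T * a" "T * b = b'"
    using half_similarity[OF system(2,1) markov[symmetric] obs(2) ctr(1)] .
  have inverse: "S * T = idm m"
    if "cplx_observable m c a" "c * idm m = c" and S: "idm m * S = S" "c * S = c'" "a * S = S * a'"
      and T: "T * idm m = T" "c' * T = c" "a' * T = T * a" for m c a c' a' S T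
  proof -
    have "S * T - idm m = 0"
    proof (rule cplx_observableD[OF that(1)])
      show "idm m * (S * T - idm m) = S * T - idm m"
        by (simp add: right_diff_distrib S flip: mult.assoc)
      fix k
      have "(S * T) * a = a * (S * T)" using S T by (metis mult.assoc)
      then have "a ^ k * (S * T) = (S * T) * a ^ k" by (rule intertwine_power[symmetric])
      moreover have "c * (S * T) = c" using S T by (metis mult.assoc)
      ultimately have 1: "c * a ^ k * (S * T) = c * a ^ k" by (metis mult.assoc)
      have "c * a ^ k * idm m = c * a ^ k * (S * T) * idm m" using 1 by simp
      also have "\<dots> = c * a ^ k * (S * T)" using T by (simp add: mult.assoc)
      finally show "c * a ^ k * (S * T - idm m) = 0" by (simp add: right_diff_distrib)
    qed
    then show ?thesis by simp
  qed
  have "S * T = idm m" "T * S = idm m'"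
    using S T system obs by (auto intro!: inverse[of m c a _ c' a'] inverse[of m' c' a' _ c a] simp: system_def)
  with S T show thesis by (intro that) auto
qed

lemma cplx_degree_unique:
  assumes "cplx_degree p F m" "cplx_degree p F m'"
  shows "m = m'"
proof -
  obtain c a b c' a' b' where "cplx_minimal p m c a b F" "cplx_minimal p m' c' a' b' F"
    using assms by (auto simp: cplx_degree_def)
  then obtain S T where "idm m * S = S" "S * idm m' = S" "S * T = idm m" "T * S = idm m'"
    by (rule similarity)
  then show ?thesis by (intro size_unique)
qed

text \<open>Division by the unobservable states \<open>U\<close>: with \<open>U\<close> the kernel of \<open>L\<close> and \<open>M\<close> a right inverse, the
  quotient system is \<open>(c M, L a M, L b)\<close>, and \<open>L\<close> commutes with the dynamics since \<open>U\<close> is invariant.\<close>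

lemma reduce_observable:
  assumes F: "realizes p m c a b F"
  obtains r c' a' b' where "realizes p r c' a' b' F" "cplx_observable r c' a'" "r \<le> m"
    "r < m \<or> cplx_observable m c a" "cplx_controllable m a b \<Longrightarrow> cplx_controllable r a' b'"
proof -
  note s = realizes_system[OF F, unfolded system_def]
  define U where "U = {h. idm m * h = h \<and> (\<forall>k. c * a ^ k * h = 0)}"
  obtain r L M where r: "r \<le> m" and L: "L * M = idm r" "idm r * L = L" "L * idm m = L"
    "idm m * M = M" "M * idm r = M" "\<And>h. idm m * h = h \<Longrightarrow> h \<in> U \<longleftrightarrow> L * h = 0"
    "r < m \<or> U = {0}"
  proof (rule right_ideal_kernel[of U m])
    show "h * g \<in> U" if "h \<in> U" for g h
      using that unfolding U_def by (simp flip: mult.assoc)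
  qed (auto simp: U_def distrib_left)
  \<comment> \<open>The columns of \<open>h0\<close> span the unobservable states.\<close>
  define h0 where "h0 = idm m - M * L"
  have h0: "idm m * h0 = h0"
    unfolding h0_def using L by (simp add: right_diff_distrib flip: mult.assoc)
  have "L * h0 = 0"
    unfolding h0_def using L by (simp add: right_diff_distrib flip: mult.assoc)
  then have h0U: "h0 \<in> U" using L(6)[OF h0] by simp
  then have "c * h0 = 0" unfolding U_def using power_0 by (metis (mono_tags, lifting) mem_Collect_eq mult.right_neutral)
  then have cML: "c * M * L = c" using s by (simp add: h0_def right_diff_distrib mult.assoc)
  have "a * h0 \<in> U"
  proof -
    have "c * a ^ k * (a * h0) = c * a ^ Suc k * h0" for k
      by (simp only: power_Suc2 mult.assoc)
    moreover have "c * a ^ Suc k * h0 = 0" for k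
      using h0U unfolding U_def by blast
    moreover have "idm m * (a * h0) = a * h0" using s by (simp flip: mult.assoc)
    ultimately show ?thesis unfolding U_def by simp
  qed
  then have "L * (a * h0) = 0" using L(6)[of "a * h0"] by (simp add: U_def)
  moreover have "L * (a * h0) = L * a - L * a * M * L"
    using s by (simp add: h0_def right_diff_distrib mult.assoc)
  ultimately have La: "L * a = L * a * M * L" by simp
  define c' a' b' where "c' = c * M" and "a' = L * a * M" and "b' = L * b"
  have La': "L * a = a' * L" using La by (simp add: a'_def)
  have system: "system p r c' a' b'"
    unfolding system_def c'_def a'_def b'_def using s L
    by (simp add: mult.assoc) (metis mult.assoc)
  have real: "realizes p r c' a' b' F"
  proof -
    have "\<forall>\<^sub>F x in nhds 0. F x = F 0 + x *\<^sub>R (c * res a x * b)" "\<forall>\<^sub>F x in nhds 0. regular a x"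
      "\<forall>\<^sub>F x in nhds 0. regular a' x"
      using F system_regular realizes_system system by (auto simp: realizes_def)
    then have "\<forall>\<^sub>F x in nhds 0. F x = F 0 + x *\<^sub>R (c' * res a' x * b')"
    proof eventually_elim
      case (elim x)
      have "c * res a x * b = c * M * (L * res a x) * b" using cML by (metis mult.assoc)
      also have "\<dots> = c' * res a' x * b'"
        unfolding res_intertwine[OF elim(2,3) La'] by (simp add: c'_def b'_def mult.assoc)
      finally show ?case using elim(1) by simp
    qed
    with system show ?thesis by (simp add: realizes_def)
  qed
  have obs: "cplx_observable r c' a'"
    unfolding cplx_observable_def
  proof (intro allI impI)
    fix h assume h: "idm r * h = h" "\<forall>k. c' * a' ^ k * h = 0"
    have LMh: "L * (M * h) = h" using L(1) h(1) by (metis mult.assoc)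
    have "c * a ^ k * (M * h) = 0" for k
    proof -
      have "c * a ^ k * (M * h) = c * M * (L * a ^ k) * (M * h)" using cML by (metis mult.assoc)
      also have "\<dots> = c' * a' ^ k * (L * (M * h))"
        unfolding intertwine_power[OF La'] by (simp add: c'_def mult.assoc)
      also have "\<dots> = 0" using h LMh by simp
      finally show ?thesis .
    qed
    moreover have Mh: "idm m * (M * h) = M * h" using L by (simp flip: mult.assoc)
    ultimately have "M * h \<in> U" by (simp add: U_def)
    then show "h = 0" using L(6)[OF Mh] LMh by simp
  qed
  have ctr: "cplx_controllable r a' b'" if "cplx_controllable m a b"
    unfolding cplx_controllable_def
  proof (intro allI impI)
    fix h assume h: "h * idm r = h" "\<forall>k. h * a' ^ k * b' = 0"
    have "h * L = 0"
    proof (rule cplx_controllableD[OF that])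
      show "h * L * idm m = h * L" using L by (simp add: mult.assoc)
      have "h * L * a ^ k * b = h * (L * a ^ k) * b" for k by (simp add: mult.assoc)
      then show "h * L * a ^ k * b = 0" for k
        using h(2) unfolding intertwine_power[OF La'] by (simp add: b'_def mult.assoc)
    qed
    then have "h * (L * M) = 0" by (metis mult.assoc mult_zero_left)
    then show "h = 0" using L(1) h(1) by simp
  qed
  have "r < m \<or> cplx_observable m c a"
    using L(7) unfolding U_def cplx_observable_def by auto
  with real obs r ctr show thesis by (intro that)
qed

text \<open>Pass to the observable quotient, then do the same for the transposed system; the second step keeps the
  observability reached in the first.\<close>

lemma minimal_exists:
  assumes F: "realizes p m c a b F"
  obtains r where "cplx_degree p F r" "r \<le> m" "r < m \<or> cplx_observable m c a"
proof -
  obtain r1 c1 a1 b1 where 1: "realizes p r1 c1 a1 b1 F" "cplx_observable r1 c1 a1" "r1 \<le> m" "r1 < m \<or> cplx_observable m c a"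
    using reduce_observable[OF F] by metis
  obtain r2 c2 a2 b2 where 2: "realizes p r2 c2 a2 b2 (\<lambda>x. transp (F x))" "cplx_observable r2 c2 a2" "r2 \<le> r1"
    "cplx_controllable r1 (transp a1) (transp c1) \<Longrightarrow> cplx_controllable r2 a2 b2"
    using reduce_observable[OF realizes_transp[OF 1(1)]] by metis
  then have "cplx_minimal p r2 c2 a2 b2 (\<lambda>x. transp (F x))"
    using 1(2) by (simp add: cplx_minimal_def cplx_controllable_transp)
  from cplx_minimal_transp[OF this] have "cplx_degree p F r2" by (auto simp: cplx_degree_def)
  with 1 2 show thesis by (intro that[of r2]) auto
qed

lemma cplx_degree_le: "cplx_degree p F m \<Longrightarrow> realizes p n c a b F \<Longrightarrow> m \<le> n"
  by (metis cplx_degree_unique minimal_exists)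

text \<open>If \<open>(c, a)\<close> were not observable, the reduction would give a realization smaller than the minimal size;
  the other half is dual.\<close>

lemma minimal_of_size:
  assumes F: "realizes p m c a b F" and size: "cplx_degree p F m"
  shows "cplx_minimal p m c a b F"
proof -
  have "cplx_observable m c a"
    using minimal_exists[OF F] size cplx_degree_unique by (metis less_irrefl)
  moreover have "cplx_degree p (\<lambda>x. transp (F x)) m"
    using size cplx_minimal_transp unfolding cplx_degree_def by blast
  then have "cplx_observable m (transp b) (transp a)"
    using minimal_exists[OF realizes_transp[OF F]] cplx_degree_unique by (metis less_irrefl)
  ultimately show ?thesis using F by (simp add: cplx_minimal_def cplx_observable_transp)
qed

section \<open>Factorizations over the complex numbers\<close>

text \<open>The last two equations say that \<open>a\<close> preserves the kernel and \<open>a - b c\<close> preserves the range of \<open>q\<close>.\<close>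

definition supporting :: "nat \<Rightarrow> lfmat \<Rightarrow> lfmat \<Rightarrow> lfmat \<Rightarrow> lfmat \<Rightarrow> bool" where
  "supporting m c a b q \<longleftrightarrow> idm m * q = q \<and> q * idm m = q \<and> q * q = q \<and>
     q * a * q = q * a \<and> q * (a - b * c) * q = (a - b * c) * q"

definition lfactor :: "nat \<Rightarrow> nat \<Rightarrow> lfmat \<Rightarrow> lfmat \<Rightarrow> lfmat \<Rightarrow> lfmat \<Rightarrow> real \<Rightarrow> lfmat" where
  "lfactor p m c a b q x = idm p + x *\<^sub>R (c * res a x * ((idm m - q) * b))"

definition rfactor :: "nat \<Rightarrow> lfmat \<Rightarrow> lfmat \<Rightarrow> lfmat \<Rightarrow> lfmat \<Rightarrow> real \<Rightarrow> lfmat" where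
  "rfactor p c a b q x = idm p + x *\<^sub>R (c * q * res a x * b)"

lemma fact_0 [simp]: "lfactor p m c a b q 0 = idm p" "rfactor p c a b q 0 = idm p"
  by (simp_all add: lfactor_def rfactor_def)

text \<open>The right-hand side depends only on \<open>q b\<close> and \<open>c q\<close>, which is what makes \<open>q\<close> unique; the same formula
  makes the cross term in the product of the factors telescope.\<close>

lemma supporting_commutator:
  assumes "supporting m c a b q"
  shows "a * q - q * a = b * (c * q) - (q * b) * (c * q)"
proof -
  have "q * (a - b * c) * q = q * a * q - (q * b) * (c * q)" "(a - b * c) * q = a * q - b * (c * q)"
    by (simp_all add: algebra_simps)
  with assms have "q * a - (q * b) * (c * q) = a * q - b * (c * q)" unfolding supporting_def by metis
  then show ?thesis by (simp add: algebra_simps)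
qed

lemma fact_product:
  assumes system: "system p m c a b" and supp: "supporting m c a b q" and reg: "regular a x"
  shows "lfactor p m c a b q x * rfactor p c a b q x = idm p + x *\<^sub>R (c * res a x * b)"
proof -
  let ?r = "res a x"
  have s: "idm p * c = c" "b * idm p = b" "idm m * b = b" using system by (auto simp: system_def)
  have "x *\<^sub>R (a * q - q * a) = q * (1 - x *\<^sub>R a) - (1 - x *\<^sub>R a) * q"
    by (simp add: algebra_simps)
  then have "x *\<^sub>R (?r * (a * q - q * a) * ?r) = ?r * (q * (1 - x *\<^sub>R a) - (1 - x *\<^sub>R a) * q) * ?r"
    by (metis mult_scaleR_left mult_scaleR_right)
  also have "\<dots> = ?r * q * ((1 - x *\<^sub>R a) * ?r) - (?r * (1 - x *\<^sub>R a)) * q * ?r"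
    by (simp only: right_diff_distrib left_diff_distrib mult.assoc)
  also have "\<dots> = ?r * q - q * ?r" using reg by (simp add: regular_def)
  finally have comm: "x *\<^sub>R (?r * (a * q - q * a) * ?r) = ?r * q - q * ?r" .
  define u v where "u = c * ?r * ((idm m - q) * b)" and "v = c * q * ?r * b"
  have "u * v = c * ?r * ((idm m - q) * b) * (c * q) * (?r * b)"
    by (simp add: u_def v_def mult.assoc)
  also have "\<dots> = c * (?r * (b * (c * q) - (q * b) * (c * q)) * ?r) * b"
    by (simp only: left_diff_distrib s right_diff_distrib mult.assoc)
  also have "\<dots> = c * (?r * (a * q - q * a) * ?r) * b"
    by (simp only: supporting_commutator[OF supp])
  finally have "x *\<^sub>R (u * v) = c * (x *\<^sub>R (?r * (a * q - q * a) * ?r)) * b" by simp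
  then have uv: "x *\<^sub>R (u * v) = c * (?r * q - q * ?r) * b" by (simp only: comm)
  have u: "u = c * ?r * b - c * ?r * q * b"
    by (simp add: u_def left_diff_distrib right_diff_distrib s mult.assoc)
  have ids: "u * idm p = u" "idm p * v = v"
    unfolding u_def v_def using s by (simp_all add: mult.assoc) (simp flip: mult.assoc)
  have "lfactor p m c a b q x * rfactor p c a b q x = (idm p + x *\<^sub>R u) * (idm p + x *\<^sub>R v)"
    by (simp add: lfactor_def rfactor_def u_def v_def)
  also have "\<dots> = idm p + x *\<^sub>R (u + v + x *\<^sub>R (u * v))"
    using ids by (simp add: distrib_left distrib_right scaleR_add_right)
  also have "u + v + x *\<^sub>R (u * v) = c * ?r * b"
    unfolding uv by (simp add: u v_def algebra_simps)
  finally show ?thesis .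
qed

text \<open>Coordinates on the range of an idempotent: \<open>L\<close> comes from the right ideal of all \<open>h\<close> with
  \<open>q h = 0\<close>, and the rank is the trace.\<close>

lemma idempotent_split:
  assumes q: "idm m * q = q" "q * idm m = q" "q * q = q"
  obtains k X L where "X * L = q" "L * X = idm k" "idm k * L = L" "L * idm m = L"
    "idm m * X = X" "X * idm k = X" "of_nat k = (\<Sum>i<m. ent q i i)"
proof -
  define U where "U = {h. idm m * h = h \<and> q * h = 0}"
  obtain k L M where L: "L * M = idm k" "idm k * L = L" "L * idm m = L"
    "idm m * M = M" "M * idm k = M" "\<And>h. idm m * h = h \<Longrightarrow> h \<in> U \<longleftrightarrow> L * h = 0"
  proof (rule right_ideal_kernel[of U m])
    show "h * g \<in> U" if "h \<in> U" for g h
      using that unfolding U_def by (simp flip: mult.assoc)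
  qed (auto simp: U_def distrib_left)
  have "idm m * (idm m - M * L) = idm m - M * L" "L * (idm m - M * L) = 0"
    using L by (simp_all add: right_diff_distrib flip: mult.assoc)
  then have "q * (idm m - M * L) = 0" using L(6) unfolding U_def by blast
  then have 1: "q * M * L = q" using q by (simp add: right_diff_distrib mult.assoc)
  have "idm m - q \<in> U" using q by (simp add: U_def right_diff_distrib)
  then have "L * (idm m - q) = 0" using L(6)[of "idm m - q"] q by (simp add: right_diff_distrib)
  then have 2: "L * q = L" using L by (simp add: right_diff_distrib)
  have 3: "L * (q * M) = idm k" using 2 L(1) by (simp flip: mult.assoc)
  have "(\<Sum>i<m. ent (q * M * L) i i) = (\<Sum>i<k. ent (L * (q * M)) i i)"
    by (rule trace_commute) (use q L in \<open>simp_all add: mult.assoc, simp_all flip: mult.assoc\<close>)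
  then have 4: "of_nat k = (\<Sum>i<m. ent q i i)" unfolding 1 3 by simp
  show thesis
    by (rule that[OF 1 3]) (use L q 4 in \<open>simp_all add: mult.assoc, simp_all flip: mult.assoc\<close>)
qed

text \<open>A system may be cut down to a quotient of its state space (first alternative, \<open>L\<close> intertwines) or to a
  subspace (second alternative, \<open>X\<close> intertwines).\<close>

lemma realizes_via_intertwiner:
  assumes system: "system p m c a b" and L: "idm k * L = L" "L * idm m = L" and X: "idm m * X = X" "X * idm k = X"
    and c0: "idm p * c0 = c0" "c0 * idm m = c0" and b0: "idm m * b0 = b0" "b0 * idm p = b0"
    and intertwine: "(c0 * X * L = c0 \<and> L * a = L * a * X * L) \<or> (X * L * b0 = b0 \<and> a * X = X * (L * a * X))"
  shows "realizes p k (c0 * X) (L * a * X) (L * b0) (\<lambda>x. idm p + x *\<^sub>R (c0 * res a x * b0))"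
proof -
  have s: "idm m * a = a" "a * idm m = a" using system by (auto simp: system_def)
  have system': "system p k (c0 * X) (L * a * X) (L * b0)"
    unfolding system_def using L X c0 b0 s by (simp_all add: mult.assoc, simp_all flip: mult.assoc)
  have "\<forall>\<^sub>F x in nhds 0. c0 * res a x * b0 = c0 * X * res (L * a * X) x * (L * b0)"
    using system_regular[OF system] system_regular[OF system']
  proof eventually_elim
    case (elim x)
    from intertwine show ?case
    proof
      assume *: "c0 * X * L = c0 \<and> L * a = L * a * X * L"
      then have "L * res a x = res (L * a * X) x * L"
        by (intro res_intertwine elim) simp
      then have "c0 * X * L * res a x * b0 = c0 * X * res (L * a * X) x * (L * b0)"
        by (metis mult.assoc)
      with * show ?thesis by simp
    next
      assume *: "X * L * b0 = b0 \<and> a * X = X * (L * a * X)"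
      then have "X * res (L * a * X) x = res a x * X"
        by (intro res_intertwine elim) simp
      then have "c0 * X * res (L * a * X) x * (L * b0) = c0 * res a x * (X * L * b0)"
        by (metis mult.assoc)
      with * show ?thesis by simp
    qed
  qed
  then have "\<forall>\<^sub>F x in nhds 0. idm p + x *\<^sub>R (c0 * res a x * b0) =
      idm p + 0 *\<^sub>R (c0 * res a 0 * b0) + x *\<^sub>R (c0 * X * res (L * a * X) x * (L * b0))"
    by eventually_elim simp
  with system' show ?thesis by (simp add: realizes_def)
qed

text \<open>The right factor lives on the range of \<open>q\<close>, a quotient of the state space because the kernel is
  invariant; the left factor lives on the kernel.  Their dimensions are the traces of \<open>q\<close> and of its
  complement.\<close>

lemma factor_sizes:
  assumes system: "system p m c a b" and supp: "supporting m c a b q"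
  obtains k1 k2 c1 a1 b1 c2 a2 b2 where "k1 + k2 = m"
    "realizes p k1 c1 a1 b1 (lfactor p m c a b q)" "realizes p k2 c2 a2 b2 (rfactor p c a b q)"
proof -
  note s = system[unfolded system_def]
  have q: "idm m * q = q" "q * idm m = q" "q * q = q" "q * a * q = q * a"
    using supp by (auto simp: supporting_def)
  obtain k2 X2 L2 where 2: "X2 * L2 = q" "L2 * X2 = idm k2" "idm k2 * L2 = L2" "L2 * idm m = L2"
    "idm m * X2 = X2" "X2 * idm k2 = X2" "of_nat k2 = (\<Sum>i<m. ent q i i)"
    by (rule idempotent_split[OF q(1-3)])
  obtain k1 X1 L1 where 1: "X1 * L1 = idm m - q" "L1 * X1 = idm k1" "idm k1 * L1 = L1" "L1 * idm m = L1"
    "idm m * X1 = X1" "X1 * idm k1 = X1" "of_nat k1 = (\<Sum>i<m. ent (idm m - q) i i)"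
    by (rule idempotent_split[of m "idm m - q"]) (use q in \<open>auto simp: algebra_simps\<close>)
  have "of_nat (k1 + k2) = (of_nat m :: complex)"
    using 1(7) 2(7) by (simp add: sum_subtractf)
  then have "k1 + k2 = m" using of_nat_eq_iff by blast
  moreover
  have "realizes p k1 (c * X1) (L1 * a * X1) (L1 * ((idm m - q) * b))
      (\<lambda>x. idm p + x *\<^sub>R (c * res a x * ((idm m - q) * b)))"
  proof (rule realizes_via_intertwiner[OF system 1(3-6)])
    have "a * (idm m - q) = (idm m - q) * a * (idm m - q)"
      using s q by (simp add: algebra_simps)
    then have "a * (X1 * L1) * X1 = (X1 * L1) * a * (X1 * L1) * X1" by (simp only: 1(1))
    then have "a * (X1 * (L1 * X1)) = X1 * (L1 * a * (X1 * (L1 * X1)))" by (simp only: mult.assoc)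
    then have "a * X1 = X1 * (L1 * a * X1)" by (simp only: 1(2,6))
    moreover have "X1 * L1 * ((idm m - q) * b) = (idm m - q) * b"
      using q by (simp add: 1(1) algebra_simps) (metis mult.assoc)
    ultimately show "c * X1 * L1 = c \<and> L1 * a = L1 * a * X1 * L1 \<or>
        X1 * L1 * ((idm m - q) * b) = (idm m - q) * b \<and> a * X1 = X1 * (L1 * a * X1)" by simp
    show "idm m * ((idm m - q) * b) = (idm m - q) * b" "(idm m - q) * b * idm p = (idm m - q) * b"
      using s q by (simp_all add: right_diff_distrib left_diff_distrib mult.assoc flip: mult.assoc[of "idm m" q])
  qed (use s in auto)
  then have "realizes p k1 (c * X1) (L1 * a * X1) (L1 * ((idm m - q) * b)) (lfactor p m c a b q)"
    by (simp add: lfactor_def[abs_def])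
  moreover
  have "realizes p k2 (c * q * X2) (L2 * a * X2) (L2 * b) (\<lambda>x. idm p + x *\<^sub>R (c * q * res a x * b))"
  proof (rule realizes_via_intertwiner[OF system 2(3-6)])
    have "(X2 * L2) * a * (X2 * L2) = (X2 * L2) * a" by (simp only: 2(1) q)
    then have "L2 * ((X2 * L2) * a * (X2 * L2)) = L2 * ((X2 * L2) * a)" by simp
    then have "(L2 * X2) * L2 * a * X2 * L2 = (L2 * X2) * L2 * a" by (simp only: mult.assoc)
    then have "L2 * a = L2 * a * X2 * L2" by (simp only: 2(2,3))
    moreover have "c * q * X2 * L2 = c * q" by (metis 2(1) mult.assoc q(3))
    ultimately show "c * q * X2 * L2 = c * q \<and> L2 * a = L2 * a * X2 * L2 \<or>
        X2 * L2 * b = b \<and> a * X2 = X2 * (L2 * a * X2)" by simp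
    show "idm p * (c * q) = c * q" "c * q * idm m = c * q"
      using s q by (simp_all add: mult.assoc) (simp flip: mult.assoc)
  qed (use s in auto)
  then have "realizes p k2 (c * q * X2) (L2 * a * X2) (L2 * b) (rfactor p c a b q)"
    by (simp add: rfactor_def[abs_def])
  ultimately show thesis by (rule that)
qed

text \<open>The output of the second system is fed into the first.  The first state space occupies the
  coordinates below \<open>m1\<close>, and \<open>E\<close>, with transpose \<open>G\<close>, embeds the second one behind it; the
  projection \<open>q\<close> onto the second state space is supporting, and the two given functions are its factors.\<close>

lemma cascade:
  assumes r1: "realizes p m1 c1 a1 b1 F1" and r2: "realizes p m2 c2 a2 b2 F2"
    and at0: "F1 0 = idm p" "F2 0 = idm p"
  obtains c a b q where "realizes p (m1 + m2) c a b (\<lambda>x. F1 x * F2 x)" "supporting (m1 + m2) c a b q"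
    "\<forall>\<^sub>F x in nhds 0. F1 x = lfactor p (m1 + m2) c a b q x"
    "\<forall>\<^sub>F x in nhds 0. F2 x = rfactor p c a b q x"
proof -
  let ?n = "m1 + m2"
  note s1 = realizes_system[OF r1, unfolded system_def] and s2 = realizes_system[OF r2, unfolded system_def]
  define E where "E = reindex (\<lambda>i. m1 + i) * idm m2"
  define G where "G = transp E"
  have inj: "inj (\<lambda>i. m1 + i)" by (auto intro: injI)
  have entE: "ent E i j = (if j < m2 \<and> i = m1 + j then 1 else 0)" for i j
    by (simp add: E_def ent_mult_idm reindex.rep_eq inj)
  have GE: "G * E = idm m2"
    by (simp add: G_def E_def transp_mult mult.assoc) (simp add: transp_reindex_reindex[OF inj] flip: mult.assoc)
  have oE: "idm m1 * E = 0" by (rule lfmat_eqI) (auto simp: ent_idm_mult entE)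
  have Go: "G * idm m1 = 0" using arg_cong[OF oE, of transp] by (simp add: G_def transp_mult)
  have Em: "E * idm m2 = E" by (simp add: E_def mult.assoc)
  have mG: "idm m2 * G = G" using arg_cong[OF Em, of transp] by (simp add: G_def transp_mult)
  have nE: "idm ?n * E = E" by (rule lfmat_eqI) (auto simp: ent_idm_mult entE)
  have Gn: "G * idm ?n = G" using arg_cong[OF nE, of transp] by (simp add: G_def transp_mult)
  have EG: "E * G = idm ?n - idm m1"
  proof (rule lfmat_eqI)
    fix i j
    have "ent (E * G) i j = (\<Sum>l<m2. ent E i l * ent E j l)"
      by (subst ent_mult_mid[where n=m2]) (auto simp: Em G_def)
    also have "\<dots> = (\<Sum>l<m2. if l = i - m1 then (if m1 \<le> i \<and> i = j then 1 else 0) else 0)"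
      by (intro sum.cong) (auto simp: entE)
    also have "\<dots> = ent (idm ?n - idm m1) i j" by auto
    finally show "ent (E * G) i j = ent (idm ?n - idm m1) i j" .
  qed
  have n1: "idm ?n * idm m1 = idm m1" "idm m1 * idm ?n = idm m1" by (simp_all add: idm_mult)
  have L1: "idm ?n * y = y" if "idm m1 * y = y" for y using that n1 by (metis mult.assoc)
  have R1: "y * idm ?n = y" if "y * idm m1 = y" for y using that n1 by (metis mult.assoc)
  have G1: "G * y = 0" if "idm m1 * y = y" for y using that Go by (metis mult.assoc mult_zero_left)
  have E1: "y * E = 0" if "y * idm m1 = y" for y using that oE by (metis mult.assoc mult_zero_right)
  have E2: "y * (E * z) = 0" if "y * idm m1 = y" for y z using E1[OF that] by (simp flip: mult.assoc)
  have GE2: "G * (E * z) = idm m2 * z" for z by (simp add: GE flip: mult.assoc)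
  have GG: "idm m2 * (G * z) = G * z" for z by (simp add: mG flip: mult.assoc)
  define c a b q where "c = c1 + c2 * G" and "a = a1 + b1 * c2 * G + E * a2 * G"
    and "b = b1 + E * b2" and "q = E * G"
  have system: "system p ?n c a b"
    unfolding system_def c_def a_def b_def using s1 s2
    by (simp add: distrib_left distrib_right L1 R1 nE Gn mult.assoc)
      (simp add: nE L1 flip: mult.assoc)
  have q: "q = idm ?n - idm m1" by (simp add: q_def EG)
  have qn: "idm ?n - q = idm m1" by (simp add: q)
  have aq: "a * q = b1 * c2 * G + E * a2 * G"
    using s1 unfolding a_def q_def
    by (simp add: distrib_right mult.assoc E2 GE2 GG mG)
  have qa: "q * a = E * a2 * G"
    using s1 s2 unfolding a_def q_def
    by (simp add: distrib_left mult.assoc G1 GE2) (simp add: G1 flip: mult.assoc)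
  have cq: "c * q = c2 * G"
    using s1 unfolding c_def q_def by (simp add: distrib_right mult.assoc E2 GE2 GG mG)
  have supp: "supporting ?n c a b q"
    unfolding supporting_def
  proof (intro conjI)
    show "idm ?n * q = q" "q * idm ?n = q" unfolding q by (simp_all add: algebra_simps n1)
    show "q * q = q" unfolding q_def by (simp add: mult.assoc GE2 GG mG)
    show "q * a * q = q * a" unfolding qa by (simp add: q_def mult.assoc GE2 GG mG)
    have d: "(a - b * c) * q = E * (a2 - b2 * c2) * G"
      by (simp add: left_diff_distrib aq mult.assoc cq) (simp add: b_def algebra_simps)
    have "q * (a - b * c) * q = q * ((a - b * c) * q)" by (rule mult.assoc)
    also have "\<dots> = E * (idm m2 * (a2 - b2 * c2)) * G"
      unfolding d by (simp add: q_def mult.assoc GE2)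
    also have "idm m2 * (a2 - b2 * c2) = a2 - b2 * c2"
      using s2 by (simp add: right_diff_distrib flip: mult.assoc)
    finally show "q * (a - b * c) * q = (a - b * c) * q" unfolding d .
  qed
  have am: "idm m1 * a1 = a * idm m1"
    using s1 unfolding a_def by (simp add: distrib_right mult.assoc Go)
  have Ga: "G * a = a2 * G"
    using s1 s2 unfolding a_def by (simp add: distrib_left mult.assoc G1 GE2) (simp add: G1 flip: mult.assoc)
  have reg: "\<forall>\<^sub>F x in nhds 0. regular a x \<and> regular a1 x \<and> regular a2 x"
    using system_regular[OF system] system_regular[OF realizes_system[OF r1]] system_regular[OF realizes_system[OF r2]]
    by (simp add: eventually_conj_iff)
  have f1: "\<forall>\<^sub>F x in nhds 0. F1 x = lfactor p ?n c a b q x"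
  proof -
    have "\<forall>\<^sub>F x in nhds 0. F1 x = F1 0 + x *\<^sub>R (c1 * res a1 x * b1)" using r1 by (simp add: realizes_def)
    then show ?thesis using reg
    proof eventually_elim
      case (elim x)
      have mb: "idm m1 * b = b1" using s1 unfolding b_def by (simp add: distrib_left oE flip: mult.assoc)
      have cm: "c * idm m1 = c1" using s1 unfolding c_def by (simp add: distrib_right mult.assoc Go)
      have i: "idm m1 * res a1 x = res a x * idm m1"
        by (rule res_intertwine) (use elim am in auto)
      have "c * res a x * ((idm ?n - q) * b) = c * (res a x * idm m1) * (idm m1 * b)"
        unfolding qn by (simp add: mult.assoc)
      also have "\<dots> = c1 * res a1 x * b1" unfolding i[symmetric] mb by (simp add: cm flip: mult.assoc)
      finally show ?case using elim(1) by (simp add: lfactor_def at0)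
    qed
  qed
  have f2: "\<forall>\<^sub>F x in nhds 0. F2 x = rfactor p c a b q x"
  proof -
    have "\<forall>\<^sub>F x in nhds 0. F2 x = F2 0 + x *\<^sub>R (c2 * res a2 x * b2)" using r2 by (simp add: realizes_def)
    then show ?thesis using reg
    proof eventually_elim
      case (elim x)
      have Gb: "G * b = b2" using s1 s2 unfolding b_def by (simp add: distrib_left G1 GE2)
      have i: "G * res a x = res a2 x * G"
        by (rule res_intertwine) (use elim Ga in auto)
      have "c * q * res a x * b = c2 * (G * res a x) * b" unfolding cq by (simp add: mult.assoc)
      also have "\<dots> = c2 * res a2 x * b2" unfolding i by (simp add: mult.assoc Gb)
      finally show ?case using elim(1) by (simp add: rfactor_def at0)
    qed
  qed
  have "\<forall>\<^sub>F x in nhds 0. F1 x * F2 x = F1 0 * F2 0 + x *\<^sub>R (c * res a x * b)"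
    using f1 f2 reg
  proof eventually_elim
    case (elim x)
    then show ?case using fact_product[OF system supp, of x] by (simp add: at0)
  qed
  with system have "realizes p ?n c a b (\<lambda>x. F1 x * F2 x)" by (simp add: realizes_def)
  then show thesis using supp f1 f2 by (rule that)
qed

lemma supporting_unique:
  assumes system: "system p m c a b" and ctr: "cplx_controllable m a b"
    and supp: "supporting m c a b q" "supporting m c a b q'" and eq: "q * b = q' * b" "c * q = c * q'"
  shows "q = q'"
proof -
  have "a * q - q * a = a * q' - q' * a"
    using supporting_commutator[OF supp(1)] supporting_commutator[OF supp(2)] by (simp add: eq)
  then have "(q - q') * a = a * (q - q')" by (simp add: algebra_simps)
  then have pow: "(q - q') * a ^ k = a ^ k * (q - q')" for k by (rule intertwine_power)
  have "q - q' = 0"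
  proof (rule cplx_controllableD[OF ctr])
    show "(q - q') * idm m = q - q'" using supp by (simp add: supporting_def left_diff_distrib)
    have "(q - q') * b = 0" using eq by (simp add: left_diff_distrib)
    then show "(q - q') * a ^ k * b = 0" for k unfolding pow by (simp add: mult.assoc)
  qed
  then show ?thesis by simp
qed

text \<open>The Taylor coefficients of the left factor determine \<open>q b\<close> because the system is observable, those of
  the right factor determine \<open>c q\<close> because it is controllable.\<close>

lemma factors_determine_projection:
  assumes min: "cplx_minimal p m c a b F"
    and supp: "supporting m c a b q" "supporting m c a b q'"
    and l: "\<forall>\<^sub>F x in nhds 0. lfactor p m c a b q x = lfactor p m c a b q' x"
    and r: "\<forall>\<^sub>F x in nhds 0. rfactor p c a b q x = rfactor p c a b q' x"
  shows "q = q'"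
proof -
  have system: "system p m c a b" and obs: "cplx_observable m c a" and ctr: "cplx_controllable m a b"
    using min by (auto simp: cplx_minimal_def realizes_def)
  note s = system[unfolded system_def]
  let ?n = "max p m"
  note f = system_fits[OF system, of ?n, simplified]
  have q: "idm m * q = q" "q * idm m = q" "idm m * q' = q'" "q' * idm m = q'"
    using supp by (auto simp: supporting_def)
  then have fq: "fits ?n q" "fits ?n q'" "fits ?n (idm m)"
    by (auto intro!: fits_mono[of m _ m])
  have "\<forall>\<^sub>F x in at 0. c * res a x * ((idm m - q) * b) = c * res a x * ((idm m - q') * b)"
    using nhds_imp_at[OF l] eventually_neq_at_within[of 0 0 UNIV]
    by eventually_elim (simp add: lfactor_def)
  then have eq: "c * a ^ k * ((idm m - q) * b) = c * a ^ k * ((idm m - q') * b)" for k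
    by (rule coefficients_eq[rotated -1]) (use f fq in \<open>auto intro!: fits_mult fits_diff\<close>)
  have "q * b - q' * b = 0"
  proof (rule cplx_observableD[OF obs])
    show "idm m * (q * b - q' * b) = q * b - q' * b"
      using q by (simp add: right_diff_distrib flip: mult.assoc)
    show "c * a ^ k * (q * b - q' * b) = 0" for k
      using eq[of k] by (simp add: right_diff_distrib left_diff_distrib)
  qed
  moreover
  have "\<forall>\<^sub>F x in at 0. (c * q) * res a x * b = (c * q') * res a x * b"
    using nhds_imp_at[OF r] eventually_neq_at_within[of 0 0 UNIV]
    by eventually_elim (simp add: rfactor_def)
  then have eq: "(c * q) * a ^ k * b = (c * q') * a ^ k * b" for k
    by (rule coefficients_eq[rotated -1]) (use f fq in \<open>auto intro!: fits_mult fits_diff\<close>)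
  have "c * q - c * q' = 0"
  proof (rule cplx_controllableD[OF ctr])
    show "(c * q - c * q') * idm m = c * q - c * q'"
      using q by (simp add: left_diff_distrib mult.assoc)
    show "(c * q - c * q') * a ^ k * b = 0" for k
      using eq[of k] by (simp add: left_diff_distrib)
  qed
  ultimately show ?thesis
    by (intro supporting_unique[OF system ctr supp]) simp_all
qed

lemma supporting_transport:
  assumes system: "system p m c a b" and supp: "supporting m' c' a' b' q'"
    and S: "idm m * S = S" "S * idm m' = S" "idm m' * T = T" "T * idm m = T"
      "S * T = idm m" "T * S = idm m'" "c * S = c'" "a * S = S * a'" "S * b' = b"
      "c' * T = c" "a' * T = T * a" "T * b = b'"
  shows "supporting m c a b (S * q' * T)"
    and "regular a x \<Longrightarrow> regular a' x \<Longrightarrow> lfactor p m c a b (S * q' * T) x = lfactor p m' c' a' b' q' x"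
    and "regular a x \<Longrightarrow> regular a' x \<Longrightarrow> rfactor p c a b (S * q' * T) x = rfactor p c' a' b' q' x"
proof -
  let ?q = "S * q' * T"
  have q': "idm m' * q' = q'" "q' * idm m' = q'" "q' * q' = q'" "q' * a' * q' = q' * a'"
    "q' * (a' - b' * c') * q' = (a' - b' * c') * q'"
    using supp by (auto simp: supporting_def)
  have TS: "T * (S * z) = idm m' * z" for z by (simp add: S flip: mult.assoc)
  have idq: "q' * (idm m' * z) = q' * z" "idm m' * (q' * z) = q' * z" for z
    by (simp_all add: q' flip: mult.assoc)
  have mT: "idm m' * (T * z) = T * z" for z by (simp add: S flip: mult.assoc)
  have Ta: "T * (a * z) = a' * (T * z)" for z by (simp add: S flip: mult.assoc)
  have Tb: "T * (b * z) = b' * z" for z by (simp add: S flip: mult.assoc)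
  have aS: "a * (S * z) = S * (a' * z)" for z by (simp add: S flip: mult.assoc)
  have cS: "c * (S * z) = c' * z" for z by (simp add: S flip: mult.assoc)
  show "supporting m c a b ?q"
    unfolding supporting_def
  proof (intro conjI)
    show "idm m * ?q = ?q" "?q * idm m = ?q"
      by (simp_all add: S mult.assoc) (simp add: S flip: mult.assoc)
    show "?q * ?q = ?q"
    proof -
      have "?q * ?q = S * (q' * q') * T" by (simp add: mult.assoc TS idq)
      then show ?thesis by (simp add: q')
    qed
    show "?q * a * ?q = ?q * a"
    proof -
      have "?q * a * ?q = S * (q' * a' * q') * T" by (simp add: mult.assoc Ta TS idq)
      also have "\<dots> = S * q' * (a' * T)" unfolding q'(4) by (simp only: mult.assoc)
      finally show ?thesis by (simp add: S mult.assoc)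
    qed
    show "?q * (a - b * c) * ?q = (a - b * c) * ?q"
    proof -
      have "b * (c * (S * z)) = S * (b' * (c' * z))" for z
        using S(7,9) by (metis mult.assoc)
      then have 1: "(a - b * c) * ?q = S * ((a' - b' * c') * q') * T"
        by (simp add: left_diff_distrib right_diff_distrib mult.assoc aS)
      have "?q * (a - b * c) * ?q = ?q * ((a - b * c) * ?q)" by (rule mult.assoc)
      also have "\<dots> = S * (q' * (a' - b' * c') * q') * T"
        unfolding 1 by (simp add: mult.assoc TS idq)
      finally show ?thesis unfolding 1 q' .
    qed
  qed
  assume reg: "regular a x" "regular a' x"
  have rS: "S * res a' x = res a x * S" by (rule res_intertwine[OF reg(2,1)]) (simp add: S)
  have rT: "T * res a x = res a' x * T" by (rule res_intertwine[OF reg]) (simp add: S)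
  have mb: "(idm m - ?q) * b = S * ((idm m' - q') * b')"
    using system S(9,12) q' unfolding system_def
    by (simp add: left_diff_distrib right_diff_distrib mult.assoc) (metis S(2) mult.assoc)
  have "c * res a x * ((idm m - ?q) * b) = c * (res a x * S) * ((idm m' - q') * b')"
    unfolding mb by (simp add: mult.assoc)
  also have "\<dots> = c' * res a' x * ((idm m' - q') * b')"
    unfolding rS[symmetric] by (simp add: S flip: mult.assoc)
  finally show "lfactor p m c a b ?q x = lfactor p m' c' a' b' q' x" by (simp add: lfactor_def)
  have "c * ?q * res a x * b = (c * S) * q' * (T * res a x) * b" by (simp add: mult.assoc)
  also have "\<dots> = c' * q' * res a' x * b'" unfolding rT S(7) by (simp add: S mult.assoc)
  finally show "rfactor p c a b ?q x = rfactor p c' a' b' q' x" by (simp add: rfactor_def)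
qed

text \<open>The realizations of the factors on the kernel and on the range of \<open>q\<close> have total size \<open>m\<close>.  If one
  of them could be made smaller, the cascade would realize \<open>F\<close> with fewer than \<open>m\<close> states.\<close>

theorem supporting_imp_minimal:
  assumes min: "cplx_minimal p m c a b F" and F0: "F 0 = idm p" and supp: "supporting m c a b q"
  obtains k1 k2 where "k1 + k2 = m" "cplx_degree p (lfactor p m c a b q) k1" "cplx_degree p (rfactor p c a b q) k2"
    "\<forall>\<^sub>F x in nhds 0. F x = lfactor p m c a b q x * rfactor p c a b q x"
proof -
  have real: "realizes p m c a b F" and system: "system p m c a b"
    using min by (auto simp: cplx_minimal_def realizes_def)
  have "\<forall>\<^sub>F x in nhds 0. F x = F 0 + x *\<^sub>R (c * res a x * b)" using real by (simp add: realizes_def)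
  then have prod: "\<forall>\<^sub>F x in nhds 0. F x = lfactor p m c a b q x * rfactor p c a b q x"
    using system_regular[OF system]
    by eventually_elim (simp add: fact_product[OF system supp] F0)
  obtain k1 k2 c1 a1 b1 c2 a2 b2 where k: "k1 + k2 = m"
    "realizes p k1 c1 a1 b1 (lfactor p m c a b q)" "realizes p k2 c2 a2 b2 (rfactor p c a b q)"
    by (rule factor_sizes[OF system supp])
  obtain j1 where j1: "cplx_degree p (lfactor p m c a b q) j1" "j1 \<le> k1" by (rule minimal_exists[OF k(2)])
  obtain j2 where j2: "cplx_degree p (rfactor p c a b q) j2" "j2 \<le> k2" by (rule minimal_exists[OF k(3)])
  obtain c1 a1 b1 c2 a2 b2 where "realizes p j1 c1 a1 b1 (lfactor p m c a b q)" "realizes p j2 c2 a2 b2 (rfactor p c a b q)"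
    using j1 j2 by (auto simp: cplx_degree_def cplx_minimal_def)
  then obtain c' a' b' where "realizes p (j1 + j2) c' a' b' (\<lambda>x. lfactor p m c a b q x * rfactor p c a b q x)"
    by (rule cascade) simp_all
  then have "realizes p (j1 + j2) c' a' b' F"
    by (rule realizes_cong) (use prod in \<open>auto elim: eventually_mono\<close>)
  moreover have "cplx_degree p F m" using min by (auto simp: cplx_degree_def)
  ultimately have "m \<le> j1 + j2" by (intro cplx_degree_le)
  then have "j1 = k1" "j2 = k2" using j1 j2 k(1) by auto
  with j1 j2 k(1) prod show thesis by (intro that[of k1 k2]) auto
qed

text \<open>The cascade of minimal realizations of the factors has the minimal size \<open>m\<close>, so it is minimal
  itself and similar to the given realization; its projection is carried over.\<close>

theorem minimal_imp_supporting:
  assumes min: "cplx_minimal p m c a b F" and F1: "cplx_degree p F1 k1" "F1 0 = idm p"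
    and F2: "cplx_degree p F2 k2" "F2 0 = idm p" and k: "k1 + k2 = m"
    and prod: "\<forall>\<^sub>F x in nhds 0. F x = F1 x * F2 x"
  obtains q where "supporting m c a b q"
    "\<forall>\<^sub>F x in nhds 0. F1 x = lfactor p m c a b q x" "\<forall>\<^sub>F x in nhds 0. F2 x = rfactor p c a b q x"
proof -
  have system: "system p m c a b" using min by (auto simp: cplx_minimal_def realizes_def)
  obtain c1 a1 b1 c2 a2 b2 where "realizes p k1 c1 a1 b1 F1" "realizes p k2 c2 a2 b2 F2"
    using F1 F2 by (auto simp: cplx_degree_def cplx_minimal_def)
  then obtain c' a' b' q' where r: "realizes p m c' a' b' (\<lambda>x. F1 x * F2 x)" and supp: "supporting m c' a' b' q'"
    and f: "\<forall>\<^sub>F x in nhds 0. F1 x = lfactor p m c' a' b' q' x" "\<forall>\<^sub>F x in nhds 0. F2 x = rfactor p c' a' b' q' x"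
    using F1(2) F2(2) unfolding k[symmetric] by (rule cascade)
  have r': "realizes p m c' a' b' F"
    by (rule realizes_cong[OF r]) (use prod in \<open>auto elim: eventually_mono\<close>)
  have "cplx_degree p F m" using min by (auto simp: cplx_degree_def)
  then have "cplx_minimal p m c' a' b' F" by (rule minimal_of_size[OF r'])
  then obtain S T where S: "idm m * S = S" "S * idm m = S" "idm m * T = T" "T * idm m = T"
    "S * T = idm m" "T * S = idm m" "c * S = c'" "a * S = S * a'" "S * b' = b"
    "c' * T = c" "a' * T = T * a" "T * b = b'"
    by (rule similarity[OF min])
  note t = supporting_transport[OF system supp S]
  have reg: "\<forall>\<^sub>F x in nhds 0. regular a x" "\<forall>\<^sub>F x in nhds 0. regular a' x"
    using system_regular[OF system] system_regular[OF realizes_system[OF r']] by auto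
  have "\<forall>\<^sub>F x in nhds 0. F1 x = lfactor p m c a b (S * q' * T) x"
    using f(1) reg by eventually_elim (simp add: t(2))
  moreover have "\<forall>\<^sub>F x in nhds 0. F2 x = rfactor p c a b (S * q' * T) x"
    using f(2) reg by eventually_elim (simp add: t(3))
  ultimately show thesis using t(1) by (intro that)
qed

section \<open>Quaternionic matrices as complex matrices\<close>

text \<open>Every quaternionic coordinate splits into two complex ones, placed at neighbouring even and odd indices;
  \<open>P0\<close> and \<open>P1\<close> embed into the even and into the odd coordinates.\<close>

definition P0 :: lfmat where "P0 = reindex (\<lambda>i. 2 * i)"
definition P1 :: lfmat where "P1 = reindex (\<lambda>i. 2 * i + 1)"

text \<open>A complex matrix, read as a quaternionic one, acts on the two halves as itself and as its conjugate.\<close>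

definition cdiag :: "lfmat \<Rightarrow> lfmat" where
  "cdiag F = P0 * F * transp P0 + P1 * conjm F * transp P1"

text \<open>Left multiplication by \<open>j\<^sub>t\<close>.\<close>

definition J :: "real \<Rightarrow> lfmat" where
  "J t = t *\<^sub>R (P0 * transp P1) + P1 * transp P0"

text \<open>This characterizes the matrices that come from \<open>H\<^sub>t\<close>.  It is multiplicative, since it says that
  \<open>Z\<close> commutes with the conjugate-linear map given by \<open>J t\<close> and conjugation, which is right
  multiplication by \<open>j\<^sub>t\<close>.\<close>

definition quaternionic :: "real \<Rightarrow> lfmat \<Rightarrow> bool" where
  "quaternionic t Z \<longleftrightarrow> J t * conjm Z = Z * J t"

lemma inj_even: "inj (\<lambda>i::nat. 2 * i)" and inj_odd: "inj (\<lambda>i::nat. 2 * i + 1)"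
  by (auto intro: injI)

lemma P_ent: "ent P0 i j = (if i = 2 * j then 1 else 0)" "ent P1 i j = (if i = 2 * j + 1 then 1 else 0)"
  using inj_even inj_odd by (auto simp: P0_def P1_def reindex.rep_eq)

lemma P_orth: "transp P0 * P0 = 1" "transp P1 * P1 = 1" "transp P0 * P1 = 0" "transp P1 * P0 = 0"
proof -
  show "transp P0 * P0 = 1" "transp P1 * P1 = 1"
    unfolding P0_def P1_def by (rule transp_reindex_reindex, rule inj_even inj_odd)+
  show "transp P0 * P1 = 0"
  proof (rule lfmat_eqI)
    fix i j :: nat
    have "2 * i \<noteq> 2 * j + 1" by presburger
    then show "ent (transp P0 * P1) i j = ent 0 i j"
      unfolding P0_def by (simp add: ent_transp_reindex_mult[OF inj_even] P_ent)
  qed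
  then show "transp P1 * P0 = 0" by (metis transp_mult transp_simps(1,2))
qed

lemma P_orth_mult: "transp P0 * (P0 * X) = X" "transp P1 * (P1 * X) = X" "transp P0 * (P1 * X) = 0" "transp P1 * (P0 * X) = 0"
  by (simp_all add: P_orth flip: mult.assoc)

lemma P_complete: "P0 * transp P0 + P1 * transp P1 = 1"
proof (rule lfmat_eqI)
  fix i j :: nat
  have "ent (P0 * transp P0 + P1 * transp P1) i j =
      (\<Sum>k\<in>{i div 2}. ent P0 i k * ent P0 j k) + (\<Sum>k\<in>{i div 2}. ent P1 i k * ent P1 j k)"
    unfolding plus_lfmat.rep_eq
    by (intro arg_cong2[of _ _ _ _ "(+)"]) (subst ent_times_row[of "{i div 2}"], auto simp: P_ent)+
  also have "\<dots> = ent 1 i j" by (auto simp: P_ent)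
  finally show "ent (P0 * transp P0 + P1 * transp P1) i j = ent 1 i j" .
qed

lemma conjm_P [simp]: "conjm P0 = P0" "conjm P1 = P1" "conjm (transp P0) = transp P0" "conjm (transp P1) = transp P1"
  by (simp_all add: P0_def P1_def)

lemma P_idm: "P0 * idm n = idm (2 * n) * P0" "P1 * idm n = idm (2 * n) * P1"
  by (rule lfmat_eqI; auto simp: ent_mult_idm ent_idm_mult P_ent)+

lemma transpP_idm: "idm n * transp P0 = transp P0 * idm (2 * n)" "idm n * transp P1 = transp P1 * idm (2 * n)"
  using arg_cong[OF P_idm(1), of transp n] arg_cong[OF P_idm(2), of transp n] by (simp_all add: transp_mult)

lemma J_P: "J t * P0 = P1" "J t * P1 = t *\<^sub>R P0" "transp P0 * J t = t *\<^sub>R transp P1" "transp P1 * J t = transp P0"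
  by (simp_all add: J_def distrib_left distrib_right mult.assoc P_orth P_orth_mult)

lemma J_square: "J t * J t = t *\<^sub>R 1"
proof -
  have "J t * J t = t *\<^sub>R (J t * P0 * transp P1) + J t * P1 * transp P0"
    by (subst (2) J_def) (simp add: distrib_left mult.assoc)
  also have "\<dots> = t *\<^sub>R (P0 * transp P0 + P1 * transp P1)" by (simp add: J_P algebra_simps)
  finally show ?thesis by (simp add: P_complete)
qed

lemma J_square_mult: "J t * (J t * X) = t *\<^sub>R X"
  by (simp add: J_square flip: mult.assoc)

lemma conjm_J [simp]: "conjm (J t) = J t"
  by (simp add: J_def conjm_mult)

lemma transpP_cdiag: "transp P0 * cdiag F = F * transp P0" "transp P1 * cdiag F = conjm F * transp P1"
  by (simp_all add: cdiag_def distrib_left mult.assoc P_orth_mult)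

lemma cdiag_P: "cdiag F * P0 = P0 * F" "cdiag F * P1 = P1 * conjm F"
  by (simp_all add: cdiag_def distrib_right mult.assoc P_orth)

lemma cdiag_mult: "cdiag (F * G) = cdiag F * cdiag G"
  by (simp add: cdiag_def[of "F * G"] cdiag_def[of F] distrib_right mult.assoc transpP_cdiag conjm_mult)

lemma cdiag_add: "cdiag (F + G) = cdiag F + cdiag G" and cdiag_diff: "cdiag (F - G) = cdiag F - cdiag G"
  and cdiag_scaleR: "cdiag (x *\<^sub>R F) = x *\<^sub>R cdiag F" and cdiag_0 [simp]: "cdiag 0 = 0" and cdiag_1 [simp]: "cdiag 1 = 1"
  by (simp_all add: cdiag_def algebra_simps P_complete)

lemma cdiag_power: "cdiag (F ^ k) = cdiag F ^ k"
  by (induction k) (simp_all add: cdiag_mult)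

lemma cdiag_idm: "cdiag (idm n) = idm (2 * n)"
  by (simp add: cdiag_def P_idm mult.assoc P_complete flip: distrib_left)

lemma J_cdiag: "J t * cdiag F = cdiag (conjm F) * J t"
  by (simp add: cdiag_def J_def distrib_left distrib_right mult.assoc P_orth P_orth_mult)

lemma J_idm: "J t * idm (2 * n) = idm (2 * n) * J t"
  using J_cdiag[of t "idm n"] by (simp add: cdiag_idm)

lemma conjm_cdiag: "J t * conjm (cdiag F) = cdiag F * J t"
  by (simp add: cdiag_def J_def conjm_mult distrib_left distrib_right mult.assoc P_orth P_orth_mult)

lemma quaternionic_intros:
  "quaternionic t X \<Longrightarrow> quaternionic t Y \<Longrightarrow> quaternionic t (X + Y)"
  "quaternionic t X \<Longrightarrow> quaternionic t Y \<Longrightarrow> quaternionic t (X - Y)"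
  "quaternionic t X \<Longrightarrow> quaternionic t Y \<Longrightarrow> quaternionic t (X * Y)"
  "quaternionic t X \<Longrightarrow> quaternionic t (x *\<^sub>R X)"
  "quaternionic t (cdiag F)" "quaternionic t (J t)" "quaternionic t (idm (2 * n))"
proof -
  assume *: "quaternionic t X" "quaternionic t Y"
  have "J t * conjm (X * Y) = (J t * conjm X) * conjm Y" by (simp add: conjm_mult mult.assoc)
  also have "\<dots> = X * (J t * conjm Y)" using * by (simp add: quaternionic_def mult.assoc)
  also have "\<dots> = X * Y * J t" using * by (simp add: quaternionic_def mult.assoc)
  finally show "quaternionic t (X * Y)" by (simp add: quaternionic_def)
qed (auto simp: quaternionic_def distrib_left distrib_right left_diff_distrib right_diff_distrib conjm_cdiag J_idm)

lemma quaternionic_power: "quaternionic t X \<Longrightarrow> quaternionic t (X ^ k)"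
proof (induction k)
  case (Suc k)
  then show ?case unfolding power_Suc by (intro quaternionic_intros)
qed (simp add: quaternionic_def)

lemma res_conjm:
  assumes "regular a x"
  shows "res (conjm a) x = conjm (res a x)" "regular (conjm a) x"
proof -
  have eq: "1 - x *\<^sub>R conjm a = conjm (1 - x *\<^sub>R a)" by simp
  have *: "(1 - x *\<^sub>R conjm a) * conjm (res a x) = 1" "conjm (res a x) * (1 - x *\<^sub>R conjm a) = 1"
    using assms unfolding eq conjm_mult[symmetric] regular_def by simp_all
  then show "res (conjm a) x = conjm (res a x)" "regular (conjm a) x"
    by (rule res_eqI, rule regularI)
qed

lemma quaternionic_res:
  assumes "regular a x" "quaternionic t a"
  shows "quaternionic t (res a x)"
  using res_intertwine[OF res_conjm(2)[OF assms(1)] assms(1), of "J t"] assms(2)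
  by (simp add: quaternionic_def res_conjm[OF assms(1)])

lemma res_cdiag:
  assumes "regular a x"
  shows "res (cdiag a) x = cdiag (res a x)" "regular (cdiag a) x"
proof -
  have eq: "1 - x *\<^sub>R cdiag a = cdiag (1 - x *\<^sub>R a)" by (simp add: cdiag_diff cdiag_scaleR)
  have *: "(1 - x *\<^sub>R cdiag a) * cdiag (res a x) = 1" "cdiag (res a x) * (1 - x *\<^sub>R cdiag a) = 1"
    using assms unfolding eq cdiag_mult[symmetric] regular_def by simp_all
  then show "res (cdiag a) x = cdiag (res a x)" "regular (cdiag a) x"
    by (rule res_eqI, rule regularI)
qed

lift_definition component :: "(quat \<Rightarrow> complex) \<Rightarrow> quat mat \<Rightarrow> lfmat" is
  "\<lambda>f X i j. if i < dim_row X \<and> j < dim_col X then f (X $$ (i, j)) else 0"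
  by (auto intro: finite_subset[of _ "{..<n}" for n])

text \<open>The decomposition \<open>a + b j\<^sub>t\<close> itself, so that multiplicativity of \<open>chi\<close> is the product rule of
  \<open>H\<^sub>t\<close>.\<close>

definition chi :: "real \<Rightarrow> quat mat \<Rightarrow> lfmat" where
  "chi t X = cdiag (component fst X) + cdiag (component snd X) * J t"

lemma component_idm: "X \<in> carrier_mat r s \<Longrightarrow> idm r * component f X = component f X"
  "X \<in> carrier_mat r s \<Longrightarrow> component f X * idm s = component f X"
  by (auto simp: idm_left_iff idm_right_iff component.rep_eq)

lemma qmult_fst_snd:
  "fst (qmult t p q) = fst p * fst q + t *\<^sub>R (snd p * cnj (snd q))"
  "snd (qmult t p q) = fst p * snd q + snd p * cnj (fst q)"
  by (simp_all add: qmult_def scaleR_conv_of_real mult.assoc)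

lemma qmat_mult_carrier [simp, intro]:
  "X \<in> carrier_mat r s \<Longrightarrow> Y \<in> carrier_mat s' u \<Longrightarrow> X \<star>\<^bsub>t\<^esub> Y \<in> carrier_mat r u"
  by (simp add: qmat_mult_def)

lemma qid_carrier [simp, intro]: "qid n \<in> carrier_mat n n"
  by (simp add: qid_def)

lemma qscale_carrier [simp, intro]: "X \<in> carrier_mat r s \<Longrightarrow> qscale x X \<in> carrier_mat r s"
  by (simp add: qscale_def)

lemma qpow_carrier [simp, intro]: "X \<in> carrier_mat n n \<Longrightarrow> qpow t X k \<in> carrier_mat n n"
  by (induction k) auto

lemma component_mult:
  assumes X: "X \<in> carrier_mat r s" and Y: "Y \<in> carrier_mat s u"
  shows "component fst (X \<star>\<^bsub>t\<^esub> Y) = component fst X * component fst Y + t *\<^sub>R (component snd X * conjm (component snd Y))" (is ?fst)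
    and "component snd (X \<star>\<^bsub>t\<^esub> Y) = component fst X * component snd Y + component snd X * conjm (component fst Y)" (is ?snd)
proof -
  have mid: "ent (component f X * Z) i j = (\<Sum>k<s. ent (component f X) i k * ent Z k j)" for f Z i j
    by (rule ent_mult_mid) (use component_idm[OF X] in auto)
  have dims: "dim_row X = r" "dim_col X = s" "dim_row Y = s" "dim_col Y = u" using X Y by auto
  have ent: "(X \<star>\<^bsub>t\<^esub> Y) $$ (i, j) = (\<Sum>k<s. qmult t (X $$ (i, k)) (Y $$ (k, j)))" if "i < r" "j < u" for i j
    using that dims by (simp add: qmat_mult_def)
  have dims': "dim_row (X \<star>\<^bsub>t\<^esub> Y) = r" "dim_col (X \<star>\<^bsub>t\<^esub> Y) = u" using dims by (auto simp: qmat_mult_def)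
  show ?fst
    by (rule lfmat_eqI)
      (auto simp: component.rep_eq mid ent dims dims' fst_sum qmult_fst_snd sum.distrib scaleR_sum_right)
  show ?snd
    by (rule lfmat_eqI)
      (auto simp: component.rep_eq mid ent dims dims' snd_sum qmult_fst_snd sum.distrib)
qed

lemma chi_mult:
  assumes "X \<in> carrier_mat r s" "Y \<in> carrier_mat s u"
  shows "chi t (X \<star>\<^bsub>t\<^esub> Y) = chi t X * chi t Y"
proof -
  have Jd: "J t * (cdiag F * Z) = cdiag (conjm F) * (J t * Z)" for F Z
    by (simp add: J_cdiag flip: mult.assoc)
  show ?thesis
    by (simp add: chi_def component_mult[OF assms] cdiag_add cdiag_mult cdiag_scaleR distrib_left distrib_right
        mult.assoc Jd J_cdiag J_square_mult J_square)
qed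

lemma chi_lin:
  assumes "X \<in> carrier_mat r s" "Y \<in> carrier_mat r s"
  shows "chi t (X + Y) = chi t X + chi t Y" "chi t (X - Y) = chi t X - chi t Y"
proof -
  have eq: "component fst (X + Y) = component fst X + component fst Y" "component snd (X + Y) = component snd X + component snd Y"
    "component fst (X - Y) = component fst X - component fst Y" "component snd (X - Y) = component snd X - component snd Y"
    using assms by (auto intro!: lfmat_eqI simp: component.rep_eq)
  show "chi t (X + Y) = chi t X + chi t Y" "chi t (X - Y) = chi t X - chi t Y"
    unfolding chi_def eq by (simp_all add: cdiag_add cdiag_diff algebra_simps)
qed

lemma chi_qscale: "chi t (qscale x X) = x *\<^sub>R chi t X"
proof -
  have "component fst (qscale x X) = x *\<^sub>R component fst X" "component snd (qscale x X) = x *\<^sub>R component snd X"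
    by (auto intro!: lfmat_eqI simp: component.rep_eq qscale_def)
  then show ?thesis by (simp add: chi_def cdiag_scaleR algebra_simps)
qed

lemma chi_qid: "chi t (qid n) = idm (2 * n)"
proof -
  have "component fst (qid n) = idm n" "component snd (qid n) = 0"
    by (auto intro!: lfmat_eqI simp: component.rep_eq qid_def of_cplx_def)
  then show ?thesis by (simp add: chi_def cdiag_idm)
qed

lemma chi_zero: "chi t (0\<^sub>m r s) = 0"
proof -
  have "component fst (0\<^sub>m r s) = 0" "component snd (0\<^sub>m r s) = 0"
    by (auto intro!: lfmat_eqI simp: component.rep_eq)
  then show ?thesis by (simp add: chi_def)
qed

lemma chi_idm:
  assumes "X \<in> carrier_mat r s"
  shows "idm (2 * r) * chi t X = chi t X" "chi t X * idm (2 * s) = chi t X"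
proof -
  have "idm (2 * r) * cdiag (component f X) = cdiag (component f X)" "cdiag (component f X) * idm (2 * s) = cdiag (component f X)" for f
    using assms by (simp_all add: component_idm flip: cdiag_idm cdiag_mult)
  then show "idm (2 * r) * chi t X = chi t X" "chi t X * idm (2 * s) = chi t X"
    unfolding chi_def
    by (simp_all add: distrib_left distrib_right J_idm mult.assoc) (simp_all flip: mult.assoc)
qed

lemma chi_quaternionic: "quaternionic t (chi t X)"
  unfolding chi_def by (intro quaternionic_intros)

lemma chi_inj:
  assumes "t \<noteq> 0" "X \<in> carrier_mat r s" "Y \<in> carrier_mat r s" "chi t X = chi t Y"
  shows "X = Y"
proof -
  have "transp P0 * chi t Z * P0 = component fst Z" "transp P0 * chi t Z * P1 = t *\<^sub>R component snd Z" for Z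
    by (simp_all add: chi_def distrib_left distrib_right mult.assoc J_P cdiag_P P_orth P_orth_mult)
  then have "component fst X = component fst Y" "component snd X = component snd Y"
    using assms(1,4) by (metis, metis scaleR_cancel_left)
  then have "fst (X $$ (i, j)) = fst (Y $$ (i, j))" "snd (X $$ (i, j)) = snd (Y $$ (i, j))"
    if "i < r" "j < s" for i j
    using that assms(2,3) by (metis (mono_tags) component.rep_eq carrier_matD)+
  then show ?thesis using assms(2,3) by (intro eq_matI) (auto simp: prod_eq_iff)
qed

text \<open>The relation with \<open>J t\<close> expresses the odd block column through the even one, whose two
  blocks determine the components of the preimage.\<close>

lemma quaternionic_imp_chi:
  assumes t: "t \<noteq> 0" and Z: "quaternionic t Z" "idm (2 * r) * Z = Z" "Z * idm (2 * s) = Z"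
  obtains X where "X \<in> carrier_mat r s" "chi t X = Z"
proof -
  define F G where "F = transp P0 * Z * P0" and "G = (1 / t) *\<^sub>R (transp P0 * Z * P1)"
  have J: "J t * conjm Z = Z * J t" using Z(1) by (simp add: quaternionic_def)
  have "conjm F = transp P1 * (J t * conjm Z) * P0"
    by (simp add: F_def conjm_mult J_P flip: mult.assoc)
  then have cF: "conjm F = transp P1 * Z * P1" unfolding J by (simp add: mult.assoc J_P)
  have "conjm G = (1 / t) *\<^sub>R (transp P1 * (J t * conjm Z) * P1)"
    by (simp add: G_def conjm_mult J_P flip: mult.assoc)
  then have cG: "conjm G = transp P1 * Z * P0" unfolding J using t by (simp add: mult.assoc J_P)
  have "cdiag F + cdiag G * J t = P0 * F * transp P0 + P1 * conjm F * transp P1 + P0 * (t *\<^sub>R G) * transp P1 + P1 * conjm G * transp P0"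
    by (simp add: cdiag_def distrib_right mult.assoc J_P)
  also have "\<dots> = (P0 * transp P0 + P1 * transp P1) * Z * (P0 * transp P0 + P1 * transp P1)"
    unfolding cF cG using t by (simp add: F_def G_def algebra_simps)
  finally have decomp: "cdiag F + cdiag G * J t = Z" by (simp add: P_complete)
  have FG: "idm r * F = F" "F * idm s = F" "idm r * G = G" "G * idm s = G"
  proof -
    have 1: "idm r * (transp P0 * Z) = transp P0 * Z"
      using Z(2) by (simp add: transpP_idm mult.assoc flip: mult.assoc[of "idm r"])
    have 2: "(Z * P0) * idm s = Z * P0" "(Z * P1) * idm s = Z * P1"
      using Z(3) by (simp add: mult.assoc P_idm, simp flip: mult.assoc)+
    show "idm r * F = F" "idm r * G = G"
      unfolding F_def G_def using 1 by (simp_all flip: mult.assoc)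
    show "F * idm s = F" "G * idm s = G"
      unfolding F_def G_def using 2 by (simp_all add: mult.assoc)
  qed
  define X where "X = mat r s (\<lambda>(i, j). (ent F i j, ent G i j))"
  have "component fst X = F" "component snd X = G"
    using FG by (auto intro!: lfmat_eqI simp: component.rep_eq X_def idm_left_iff idm_right_iff)
  with decomp show thesis by (intro that[of X]) (auto simp: chi_def X_def)
qed

lemma chi_qpow: "A \<in> carrier_mat N N \<Longrightarrow> chi t (qpow t A k) = idm (2 * N) * chi t A ^ k"
proof (induction k)
  case (Suc k)
  have "chi t (qpow t A (Suc k)) = idm (2 * N) * (chi t A ^ k * chi t A)"
    using Suc by (simp add: chi_mult[of _ N N] mult.assoc)
  then show ?case by (simp only: power_Suc2)
qed (simp add: chi_qid)

lemma qinv_eqI: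
  assumes t: "t \<noteq> 0" and X: "X \<in> carrier_mat n n" "Y \<in> carrier_mat n n"
    and inv: "chi t X * chi t Y = idm (2 * n)" "chi t Y * chi t X = idm (2 * n)"
  shows "qinv t X = Y"
proof -
  have dim: "dim_row X = n" using X by simp
  show ?thesis
    unfolding qinv_def dim
  proof (rule the_equality)
    show "Y \<in> carrier_mat n n \<and> X \<star>\<^bsub>t\<^esub> Y = qid n \<and> Y \<star>\<^bsub>t\<^esub> X = qid n"
      using X inv by (auto intro!: chi_inj[OF t, of _ n n] simp: chi_mult[of _ n n _ n] chi_qid)
    fix Y' assume Y': "Y' \<in> carrier_mat n n \<and> X \<star>\<^bsub>t\<^esub> Y' = qid n \<and> Y' \<star>\<^bsub>t\<^esub> X = qid n"
    then have "chi t Y' * chi t X = idm (2 * n)"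
      using X by (metis chi_mult chi_qid)
    then have "chi t Y' = chi t Y"
      using inv(1) chi_idm[of Y' n n t] chi_idm[of Y n n t] Y' X by (metis mult.assoc)
    then show "Y' = Y" using Y' X by (intro chi_inj[OF t]) auto
  qed
qed

lemma qinv_qid: "t \<noteq> 0 \<Longrightarrow> qinv t (qid n) = qid n"
  by (rule qinv_eqI) (auto simp: chi_qid)

text \<open>The complex resolvent commutes with everything that commutes with \<open>a\<close>, in particular with the
  quaternionic structure; so it comes from a matrix over \<open>H\<^sub>t\<close>, which is the inverse sought.\<close>

lemma resolvent_chi:
  assumes t: "t \<noteq> 0" and A: "A \<in> carrier_mat N N" and reg: "regular (chi t A) x"
  shows "resolvent t A x \<in> carrier_mat N N"
    and "chi t (resolvent t A x) = idm (2 * N) * res (chi t A) x"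
proof -
  let ?a = "chi t A" and ?e = "idm (2 * N)"
  have comm: "res ?a x * ?e = ?e * res ?a x"
    by (rule res_commute[OF reg]) (simp add: chi_idm[OF A])
  obtain Y where Y: "Y \<in> carrier_mat N N" "chi t Y = ?e * res ?a x"
  proof (rule quaternionic_imp_chi[OF t])
    show "quaternionic t (?e * res ?a x)"
      by (intro quaternionic_intros quaternionic_res reg chi_quaternionic)
    show "?e * (?e * res ?a x) = ?e * res ?a x" by simp
    show "?e * res ?a x * ?e = ?e * res ?a x" by (simp add: mult.assoc comm)
  qed
  have X: "qid N - qscale x A \<in> carrier_mat N N" using A by (simp add: minus_carrier_mat)
  have chiX: "chi t (qid N - qscale x A) = ?e * (1 - x *\<^sub>R ?a)" "chi t (qid N - qscale x A) = (1 - x *\<^sub>R ?a) * ?e"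
    using A by (simp_all add: chi_lin[of _ N N] chi_qid chi_qscale right_diff_distrib left_diff_distrib chi_idm[OF A])
  have "resolvent t A x = Y"
    unfolding resolvent_def
  proof (rule qinv_eqI[OF t])
    show "qid (dim_row A) - qscale x A \<in> carrier_mat N N" using X A by simp
    show "chi t (qid (dim_row A) - qscale x A) * chi t Y = ?e"
    proof -
      have "chi t (qid (dim_row A) - qscale x A) * chi t Y = (?e * (1 - x *\<^sub>R ?a)) * (res ?a x * ?e)"
        using A chiX(1) Y(2) comm by simp
      also have "\<dots> = ?e * ((1 - x *\<^sub>R ?a) * res ?a x) * ?e" by (simp only: mult.assoc)
      finally show ?thesis using reg by (simp add: regular_def)
    qed
    show "chi t Y * chi t (qid (dim_row A) - qscale x A) = ?e"
    proof -
      have "chi t Y * chi t (qid (dim_row A) - qscale x A) = (?e * res ?a x) * ((1 - x *\<^sub>R ?a) * ?e)"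
        using A chiX(2) Y(2) by simp
      also have "\<dots> = ?e * (res ?a x * (1 - x *\<^sub>R ?a)) * ?e" by (simp only: mult.assoc)
      finally show ?thesis using reg by (simp add: regular_def)
    qed
  qed (rule Y(1))
  with Y show "resolvent t A x \<in> carrier_mat N N" "chi t (resolvent t A x) = ?e * res ?a x" by simp_all
qed

lemma transfer_chi:
  assumes t: "t \<noteq> 0" and D: "D \<in> carrier_mat n n" and C: "C \<in> carrier_mat n N"
    and A: "A \<in> carrier_mat N N" and B: "B \<in> carrier_mat N n" and reg: "regular (chi t A) x"
  shows "transfer_fun t D C A B x \<in> carrier_mat n n"
    and "chi t (transfer_fun t D C A B x) = chi t D + x *\<^sub>R (chi t C * res (chi t A) x * chi t B)"
proof -
  note r = resolvent_chi[OF t A reg]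
  have c: "C \<star>\<^bsub>t\<^esub> resolvent t A x \<in> carrier_mat n N" "C \<star>\<^bsub>t\<^esub> resolvent t A x \<star>\<^bsub>t\<^esub> B \<in> carrier_mat n n"
    using C B r(1) by (auto intro!: qmat_mult_carrier)
  then show "transfer_fun t D C A B x \<in> carrier_mat n n"
    using D by (simp add: transfer_fun_def)
  have "chi t C * (idm (2 * N) * res (chi t A) x) = chi t C * res (chi t A) x"
    using chi_idm[OF C] by (simp flip: mult.assoc)
  then show "chi t (transfer_fun t D C A B x) = chi t D + x *\<^sub>R (chi t C * res (chi t A) x * chi t B)"
    using D c
    by (simp add: transfer_fun_def chi_lin[of _ n n] chi_qscale chi_mult[OF c(1) B] chi_mult[OF C r(1)] r(2))
qed

section \<open>Realizations, observability and controllability over the algebra\<close>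

lemma system_chi:
  "C \<in> carrier_mat n N \<Longrightarrow> A \<in> carrier_mat N N \<Longrightarrow> B \<in> carrier_mat N n \<Longrightarrow>
   system (2 * n) (2 * N) (chi t C) (chi t A) (chi t B)"
  by (simp add: system_def chi_idm)

lemma realization_iff:
  assumes t: "t \<noteq> 0"
  shows "realization t n N C A B R \<longleftrightarrow>
    C \<in> carrier_mat n N \<and> A \<in> carrier_mat N N \<and> B \<in> carrier_mat N n \<and>
    (\<forall>\<^sub>F x in nhds 0. R x \<in> carrier_mat n n) \<and>
    realizes (2 * n) (2 * N) (chi t C) (chi t A) (chi t B) (\<lambda>x. chi t (R x))" (is "?l \<longleftrightarrow> ?r")
proof
  assume l: ?l
  then have car: "R 0 \<in> carrier_mat n n" "C \<in> carrier_mat n N" "A \<in> carrier_mat N N" "B \<in> carrier_mat N n"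
    and R: "\<forall>\<^sub>F x in nhds 0. R x = transfer_fun t (R 0) C A B x"
    by (auto simp: realization_def same_near_0_def)
  note system = system_chi[OF car(2-4), of t]
  have 1: "\<forall>\<^sub>F x in nhds 0. R x \<in> carrier_mat n n"
    using R system_regular[OF system] by eventually_elim (simp add: transfer_chi[OF t car])
  have "\<forall>\<^sub>F x in nhds 0. chi t (R x) = chi t (R 0) + x *\<^sub>R (chi t C * res (chi t A) x * chi t B)"
    using R system_regular[OF system] by eventually_elim (simp add: transfer_chi[OF t car])
  with system 1 car show ?r by (simp add: realizes_def)
next
  assume r: ?r
  then have car: "C \<in> carrier_mat n N" "A \<in> carrier_mat N N" "B \<in> carrier_mat N n"
    and R: "\<forall>\<^sub>F x in nhds 0. R x \<in> carrier_mat n n"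
    and eq: "\<forall>\<^sub>F x in nhds 0. chi t (R x) = chi t (R 0) + x *\<^sub>R (chi t C * res (chi t A) x * chi t B)"
    by (auto simp: realizes_def)
  have R0: "R 0 \<in> carrier_mat n n" using eventually_nhds_x_imp_x[OF R] .
  have "\<forall>\<^sub>F x in nhds 0. R x = transfer_fun t (R 0) C A B x"
    using R eq system_regular[OF system_chi[OF car, of t]]
  proof eventually_elim
    case (elim x)
    then show ?case
      using transfer_chi[OF t R0 car elim(3)] by (intro chi_inj[OF t, of _ n n]) auto
  qed
  with R0 car show ?l by (simp add: realization_def same_near_0_def)
qed

text \<open>For a single column \<open>w\<close> at index \<open>0\<close> the added term in the next lemma occupies only column \<open>1\<close>, by
  the vanishing of this entry of \<open>J t\<close>; so \<open>w\<close> can be read off from the sum.  The same holds for rows.\<close>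

lemma J_corner: "idm 1 * (J t * idm 1) = 0"
proof -
  have a: "idm 1 * P1 = 0" by (rule lfmat_eqI) (auto simp: ent_idm_mult P_ent)
  have b: "transp P1 * idm 1 = 0" using arg_cong[OF a, of transp] by (simp add: transp_mult)
  have "idm 1 * (P1 * X) = 0" for X using a by (simp flip: mult.assoc)
  then show ?thesis using b by (simp add: J_def distrib_left distrib_right mult.assoc del: One_nat_def)
qed

text \<open>The added term is the conjugate \<open>J (conjm w) J\<^sup>-\<^sup>1\<close> of \<open>w\<close>, and conjugating twice is the identity.\<close>

lemma quaternionic_symmetrize:
  assumes "t \<noteq> 0"
  shows "quaternionic t (w + (1 / t) *\<^sub>R (J t * conjm w * J t))"
  using assms
  by (simp add: quaternionic_def conjm_mult distrib_left distrib_right mult.assoc J_square J_square_mult)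

text \<open>A quaternionic column is in particular a complex matrix of width \<open>2\<close>.  Conversely a column \<open>w\<close> of an
  unobservable complex matrix completes by its conjugate to an unobservable quaternionic column, which
  vanishes only if \<open>w\<close> does.\<close>

lemma observable_iff:
  assumes t: "t \<noteq> 0" and C: "C \<in> carrier_mat n N" and A: "A \<in> carrier_mat N N"
  shows "observable t C A \<longleftrightarrow> cplx_observable (2 * N) (chi t C) (chi t A)"
proof -
  let ?c = "chi t C" and ?a = "chi t A"
  define m where "m = max (2 * n) (max (2 * N) 2)"
  have fa: "fits m ?a" and fc: "fits m ?c"
    by (rule fits_mono[OF chi_idm[OF A]] fits_mono[OF chi_idm[OF C]], simp_all add: m_def)+
  have fh: "fits m (chi t h)" if "h \<in> carrier_mat N 1" for h
    by (rule fits_mono[OF chi_idm[OF that]]) (simp_all add: m_def)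
  have vanish_chi: "C \<star>\<^bsub>t\<^esub> resolvent t A x \<star>\<^bsub>t\<^esub> h = 0\<^sub>m n 1 \<longleftrightarrow> ?c * res ?a x * chi t h = 0"
    if h: "h \<in> carrier_mat N 1" and reg: "regular ?a x" for h x
  proof -
    note r = resolvent_chi[OF t A reg]
    have c: "C \<star>\<^bsub>t\<^esub> resolvent t A x \<in> carrier_mat n N" "C \<star>\<^bsub>t\<^esub> resolvent t A x \<star>\<^bsub>t\<^esub> h \<in> carrier_mat n 1"
      using C h r(1) by auto
    have "?c * (idm (2 * N) * res ?a x) = ?c * res ?a x"
      using chi_idm[OF C] by (simp flip: mult.assoc)
    then have "chi t (C \<star>\<^bsub>t\<^esub> resolvent t A x \<star>\<^bsub>t\<^esub> h) = ?c * res ?a x * chi t h"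
      by (simp add: chi_mult[OF c(1) h] chi_mult[OF C r(1)] r(2))
    then show ?thesis
      using chi_inj[OF t c(2), of "0\<^sub>m n 1"] by (auto simp: chi_zero)
  qed
  have near_iff: "(\<exists>\<epsilon>>0. \<forall>x\<in>{-\<epsilon><..<\<epsilon>}. C \<star>\<^bsub>t\<^esub> resolvent t A x \<star>\<^bsub>t\<^esub> h = 0\<^sub>m (dim_row C) 1) \<longleftrightarrow>
      (\<forall>k. ?c * ?a ^ k * chi t h = 0)" (is "?near \<longleftrightarrow> _") if h: "h \<in> carrier_mat N 1" for h
  proof -
    have ball: "x \<in> {-d<..<d} \<longleftrightarrow> dist x 0 < d" for x d :: real by (auto simp: dist_real_def)
    have reg: "\<forall>\<^sub>F x in nhds 0. regular ?a x" by (rule eventually_regular[OF fa])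
    have "?near \<longleftrightarrow> (\<forall>\<^sub>F x in nhds 0. C \<star>\<^bsub>t\<^esub> resolvent t A x \<star>\<^bsub>t\<^esub> h = 0\<^sub>m n 1)"
      using C unfolding eventually_nhds_metric ball[symmetric] by auto
    also have "\<dots> \<longleftrightarrow> (\<forall>\<^sub>F x in nhds 0. ?c * res ?a x * chi t h = 0)"
      by (rule eventually_cong) (use vanish_chi[OF h] reg in \<open>auto elim: eventually_mono\<close>)
    also have "\<dots> \<longleftrightarrow> (\<forall>k. ?c * ?a ^ k * chi t h = 0)"
    proof
      assume "\<forall>\<^sub>F x in nhds 0. ?c * res ?a x * chi t h = 0"
      then have ev: "\<forall>\<^sub>F x in at 0. ?c * res ?a x * chi t h = 0 * res 0 x * 0"
        by (auto dest: nhds_imp_at)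
      have "?c * ?a ^ k * chi t h = 0 * 0 ^ k * 0" for k
        by (rule coefficients_eq[OF fa _ fh[OF h] _ fc _ ev]) (simp_all add: fits_def)
      then show "\<forall>k. ?c * ?a ^ k * chi t h = 0" by simp
    next
      assume v: "\<forall>k. ?c * ?a ^ k * chi t h = 0"
      show "\<forall>\<^sub>F x in nhds 0. ?c * res ?a x * chi t h = 0"
        using eventually_small[of "nrm m ?a"]
        by eventually_elim (rule vanishing_resolvent[OF fa fc fh[OF h]], use v in auto)
    qed
    finally show ?thesis .
  qed
  have chi_h0: "h = 0\<^sub>m N 1 \<longleftrightarrow> chi t h = 0" if "h \<in> carrier_mat N 1" for h
    using chi_inj[OF t that, of "0\<^sub>m N 1"] by (auto simp: chi_zero)
  have dim: "dim_row A = N" using A by simp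
  have obs: "observable t C A \<longleftrightarrow>
      (\<forall>h\<in>carrier_mat N 1. (\<forall>k. ?c * ?a ^ k * chi t h = 0) \<longrightarrow> chi t h = 0)"
    unfolding observable_def dim using near_iff chi_h0 by (auto simp del: One_nat_def)
  show ?thesis
    unfolding obs cplx_observable_def
  proof (intro iffI ballI allI impI)
    fix h assume o: "\<forall>h. idm (2 * N) * h = h \<longrightarrow> (\<forall>k. ?c * ?a ^ k * h = 0) \<longrightarrow> h = 0"
      and h: "h \<in> carrier_mat N 1" "\<forall>k. ?c * ?a ^ k * chi t h = 0"
    show "chi t h = 0"
      by (rule o[rule_format]) (use h chi_idm in auto)
  next
    fix z assume o: "\<forall>h\<in>carrier_mat N 1. (\<forall>k. ?c * ?a ^ k * chi t h = 0) \<longrightarrow> chi t h = 0"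
      and z: "idm (2 * N) * z = z" "\<forall>k. ?c * ?a ^ k * z = 0"
    show "z = 0"
    proof (rule lfmat_eqI)
      fix i j
      define w where "w = z * unit_mat 1 j 0"
      define v where "v = (1 / t) *\<^sub>R (J t * conjm w * J t)"
      have w: "idm (2 * N) * w = w" using z(1) by (simp add: w_def flip: mult.assoc)
      have w1: "w * idm 1 = w" by (rule lfmat_eqI) (auto simp: w_def ent_mult_idm ent_mult_unit)
      have cw: "idm (2 * N) * conjm w = conjm w" "conjm w * idm 1 = conjm w"
        using w w1 by (metis conjm_mult conjm_simps(7))+
      obtain h where h: "h \<in> carrier_mat N 1" "chi t h = w + v"
      proof (rule quaternionic_imp_chi[OF t])
        show "quaternionic t (w + v)" unfolding v_def by (rule quaternionic_symmetrize[OF t])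
        have "idm (2 * N) * (J t * conjm w * J t) = J t * (idm (2 * N) * conjm w) * J t"
          using J_idm[of t N] by (metis mult.assoc)
        then show "idm (2 * N) * (w + v) = w + v" by (simp add: v_def distrib_left w cw)
        have "w * idm 2 = w" by (rule lfmat_eqI) (auto simp: w_def ent_mult_idm ent_mult_unit)
        moreover have "conjm w * J t * idm 2 = conjm w * J t"
        proof -
          have "conjm w * J t * idm 2 = conjm w * (idm 1 * (J t * idm 2))" using cw by (metis mult.assoc)
          also have "J t * idm 2 = idm 2 * J t" using J_idm[of t 1] by simp
          also have "idm 1 * (idm 2 * J t) = idm 1 * J t" by (simp add: idm_mult flip: mult.assoc)
          finally show ?thesis using cw by (simp flip: mult.assoc)
        qed
        ultimately show "(w + v) * idm (2 * 1) = w + v" by (simp add: v_def distrib_right mult.assoc)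
      qed
      have "?c * ?a ^ k * (w + v) = 0" for k
      proof -
        have 1: "?c * ?a ^ k * w = 0" using z(2) by (simp add: w_def flip: mult.assoc)
        have "quaternionic t (?c * ?a ^ k)"
          by (intro quaternionic_intros quaternionic_power chi_quaternionic)
        then have "?c * ?a ^ k * (J t * conjm w * J t) = J t * (conjm (?c * ?a ^ k) * conjm w) * J t"
          unfolding quaternionic_def by (metis mult.assoc)
        also have "conjm (?c * ?a ^ k) * conjm w = 0" using 1 by (simp flip: conjm_mult)
        finally show ?thesis using 1 by (simp add: distrib_left v_def)
      qed
      then have "w + v = 0" using o h by metis
      then have "(w + v) * idm 1 = 0" by simp
      moreover have "v * idm 1 = 0"
      proof -
        have "conjm w * J t * idm 1 = conjm w * (idm 1 * (J t * idm 1))" using cw by (metis mult.assoc)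
        then show ?thesis by (simp add: v_def mult.assoc J_corner del: One_nat_def)
      qed
      ultimately have "w = 0" using w1 by (simp add: distrib_right del: One_nat_def)
      then show "ent z i j = ent 0 i j"
        using ent_mult_unit[of z 1 j 0 i 0] by (simp add: w_def)
    qed
  qed
qed

lemma controllable_iff:
  assumes t: "t \<noteq> 0" and A: "A \<in> carrier_mat N N" and B: "B \<in> carrier_mat N n"
  shows "controllable t A B \<longleftrightarrow> cplx_controllable (2 * N) (chi t A) (chi t B)"
proof -
  let ?b = "chi t B" and ?a = "chi t A"
  have chi_h0: "h = 0\<^sub>m 1 N \<longleftrightarrow> chi t h = 0" if "h \<in> carrier_mat 1 N" for h
    using chi_inj[OF t that, of "0\<^sub>m 1 N"] by (auto simp: chi_zero)
  have vanish_chi: "h \<star>\<^bsub>t\<^esub> qpow t A k \<star>\<^bsub>t\<^esub> B = 0\<^sub>m 1 n \<longleftrightarrow> chi t h * ?a ^ k * ?b = 0"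
    if h: "h \<in> carrier_mat 1 N" for h k
  proof -
    have p: "qpow t A k \<in> carrier_mat N N" using A by simp
    have c: "h \<star>\<^bsub>t\<^esub> qpow t A k \<in> carrier_mat 1 N" "h \<star>\<^bsub>t\<^esub> qpow t A k \<star>\<^bsub>t\<^esub> B \<in> carrier_mat 1 n"
      using A B h by auto
    have "chi t h * (idm (2 * N) * ?a ^ k) = chi t h * ?a ^ k"
      using chi_idm[OF h] by (simp flip: mult.assoc)
    then have "chi t (h \<star>\<^bsub>t\<^esub> qpow t A k \<star>\<^bsub>t\<^esub> B) = chi t h * ?a ^ k * ?b"
      by (simp add: chi_mult[OF c(1) B] chi_mult[OF h p] chi_qpow[OF A])
    then show ?thesis
      using chi_inj[OF t c(2), of "0\<^sub>m 1 n"] by (auto simp: chi_zero)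
  qed
  have dim: "dim_row A = N" "dim_col B = n" using A B by auto
  have ctr: "controllable t A B \<longleftrightarrow>
      (\<forall>h\<in>carrier_mat 1 N. (\<forall>k. chi t h * ?a ^ k * ?b = 0) \<longrightarrow> chi t h = 0)"
    unfolding controllable_def dim using vanish_chi chi_h0 by (auto simp del: One_nat_def)
  show ?thesis
    unfolding ctr cplx_controllable_def
  proof (intro iffI ballI allI impI)
    fix h assume o: "\<forall>h. h * idm (2 * N) = h \<longrightarrow> (\<forall>k. h * ?a ^ k * ?b = 0) \<longrightarrow> h = 0"
      and h: "h \<in> carrier_mat 1 N" "\<forall>k. chi t h * ?a ^ k * ?b = 0"
    show "chi t h = 0"
      by (rule o[rule_format]) (use h chi_idm in auto)
  next
    fix z assume o: "\<forall>h\<in>carrier_mat 1 N. (\<forall>k. chi t h * ?a ^ k * ?b = 0) \<longrightarrow> chi t h = 0"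
      and z: "z * idm (2 * N) = z" "\<forall>k. z * ?a ^ k * ?b = 0"
    show "z = 0"
    proof (rule lfmat_eqI)
      fix i j
      define w where "w = unit_mat 1 0 i * z"
      define v where "v = (1 / t) *\<^sub>R (J t * conjm w * J t)"
      have w: "w * idm (2 * N) = w" using z(1) by (simp add: w_def mult.assoc)
      have w1: "idm 1 * w = w" by (rule lfmat_eqI) (auto simp: w_def ent_idm_mult ent_unit_mult)
      have cw: "conjm w * idm (2 * N) = conjm w" "idm 1 * conjm w = conjm w"
        using w w1 by (metis conjm_mult conjm_simps(7))+
      obtain h where h: "h \<in> carrier_mat 1 N" "chi t h = w + v"
      proof (rule quaternionic_imp_chi[OF t])
        show "quaternionic t (w + v)" unfolding v_def by (rule quaternionic_symmetrize[OF t])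
        have "J t * conjm w * J t * idm (2 * N) = J t * (conjm w * idm (2 * N)) * J t"
          using J_idm[of t N] by (metis mult.assoc)
        then show "(w + v) * idm (2 * N) = w + v" by (simp add: v_def distrib_right w cw)
        have "idm 2 * w = w" by (rule lfmat_eqI) (auto simp: w_def ent_idm_mult ent_unit_mult)
        moreover have "idm 2 * (J t * conjm w) = J t * conjm w"
        proof -
          have "idm 2 * (J t * conjm w) = idm 2 * J t * idm 1 * conjm w" using cw by (metis mult.assoc)
          also have "idm 2 * J t = J t * idm 2" using J_idm[of t 1] by simp
          also have "J t * idm 2 * idm 1 = J t * idm 1" by (simp add: idm_mult mult.assoc)
          finally show ?thesis using cw by (simp add: mult.assoc)
        qed
        ultimately show "idm (2 * 1) * (w + v) = w + v"
          by (simp add: v_def distrib_left) (simp flip: mult.assoc)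
      qed
      have "(w + v) * ?a ^ k * ?b = 0" for k
      proof -
        have 1: "w * (?a ^ k * ?b) = 0" using z(2) by (simp add: w_def mult.assoc)
        have "quaternionic t (?a ^ k * ?b)"
          by (intro quaternionic_intros quaternionic_power chi_quaternionic)
        then have "J t * conjm w * J t * (?a ^ k * ?b) = J t * (conjm w * (J t * (?a ^ k * ?b)))"
          by (simp add: mult.assoc)
        also have "J t * (?a ^ k * ?b) = conjm (?a ^ k * ?b) * J t"
        proof -
          have "conjm (J t * conjm (?a ^ k * ?b)) = conjm ((?a ^ k * ?b) * J t)"
            using \<open>quaternionic t (?a ^ k * ?b)\<close> by (simp only: quaternionic_def)
          then show ?thesis by (simp add: conjm_mult)
        qed
        also have "conjm w * (conjm (?a ^ k * ?b) * J t) = conjm (w * (?a ^ k * ?b)) * J t"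
          by (simp only: conjm_mult mult.assoc)
        finally show ?thesis using 1 by (simp add: distrib_right v_def mult.assoc)
      qed
      then have "w + v = 0" using o h by metis
      then have "idm 1 * (w + v) = 0" by simp
      moreover have "idm 1 * v = 0"
      proof -
        have "idm 1 * (J t * conjm w * J t) = (idm 1 * (J t * idm 1)) * conjm w * J t" using cw by (metis mult.assoc)
        then show ?thesis by (simp add: v_def J_corner del: One_nat_def)
      qed
      ultimately have "w = 0" using w1 by (simp add: distrib_left del: One_nat_def)
      then show "ent z i j = ent 0 i j"
        using ent_unit_mult[of 1 0 i z 0 j] by (simp add: w_def)
    qed
  qed
qed

lemma minimal_realization_iff:
  assumes t: "t \<noteq> 0"
  shows "minimal_realization t n N C A B R \<longleftrightarrow>
    C \<in> carrier_mat n N \<and> A \<in> carrier_mat N N \<and> B \<in> carrier_mat N n \<and>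
    (\<forall>\<^sub>F x in nhds 0. R x \<in> carrier_mat n n) \<and>
    cplx_minimal (2 * n) (2 * N) (chi t C) (chi t A) (chi t B) (\<lambda>x. chi t (R x))"
  unfolding minimal_realization_def cplx_minimal_def realization_iff[OF t]
  using observable_iff[OF t] controllable_iff[OF t] by metis

lemma has_minimal_size_imp_cplx_degree:
  "t \<noteq> 0 \<Longrightarrow> has_minimal_size t n R N \<Longrightarrow> cplx_degree (2 * n) (\<lambda>x. chi t (R x)) (2 * N)"
  unfolding has_minimal_size_def cplx_degree_def by (auto simp: minimal_realization_iff)

lemma rational_funD:
  assumes "t \<noteq> 0" "rational_fun t n R"
  shows "\<forall>\<^sub>F x in nhds 0. R x \<in> carrier_mat n n" "\<exists>m. cplx_degree (2 * n) (\<lambda>x. chi t (R x)) m"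
  using assms minimal_exists unfolding rational_fun_def by (auto simp: realization_iff) metis

section \<open>Degrees\<close>

text \<open>The shift by \<open>n\<close> maps the first of two blocks of size \<open>n\<close> to the second; it is used to write
  block diagonal matrices.\<close>

lemma shift_props:
  fixes n :: nat
  defines "T \<equiv> reindex (\<lambda>i. n + i)"
  shows "transp T * T = 1" "transp T * idm n = 0" "idm n * T = 0" "idm n + T * idm n * transp T = idm (n + n)"
proof -
  have inj: "inj (\<lambda>i. n + i)" by (auto intro: injI)
  show "transp T * T = 1" unfolding T_def by (rule transp_reindex_reindex[OF inj])
  show 0: "transp T * idm n = 0"
    unfolding T_def by (rule lfmat_eqI) (auto simp: ent_transp_reindex_mult[OF inj])
  show "idm n * T = 0" using arg_cong[OF 0, of transp] by (simp add: transp_mult)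
  have entT: "ent (T * idm n) i j = (if j < n \<and> i = n + j then 1 else 0)" for i j
    by (simp add: T_def ent_mult_idm reindex.rep_eq inj)
  show "idm n + T * idm n * transp T = idm (n + n)"
  proof (rule lfmat_eqI)
    fix i j
    have "ent (T * idm n * transp T) i j = (\<Sum>l<n. ent (T * idm n) i l * ent T j l)"
      by (subst ent_mult_mid[where n=n]) (auto simp: mult.assoc)
    also have "\<dots> = (\<Sum>l<n. if l = i - n then (if n \<le> i \<and> i = j then 1 else 0) else 0)"
      by (intro sum.cong) (auto simp: entT, auto simp: T_def reindex.rep_eq inj)
    finally show "ent (idm n + T * idm n * transp T) i j = ent (idm (n + n)) i j" by auto
  qed
qed

lemma chi_double_fun:
  assumes "R x \<in> carrier_mat n n"
  shows "chi t (double_fun n R x) =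
    chi t (R x) + cdiag (reindex (\<lambda>i. n + i)) * chi t (R x) * cdiag (transp (reindex (\<lambda>i. n + i)))"
proof -
  let ?T = "reindex (\<lambda>i. n + i)"
  have inj: "inj (\<lambda>i. n + i)" by (auto intro: injI)
  have inv: "inv_into UNIV (\<lambda>i. n + i) k = k - n" if "n \<le> k" for k
    using inv_into_f_f[OF inj, of "k - n"] that by simp
  have ran: "i \<in> range (\<lambda>i. n + i) \<longleftrightarrow> n \<le> i" for i by (metis le_add1 le_iff_add rangeE rangeI)
  have transp: "ent (X * transp ?T) i j = (if n \<le> j then ent X i (j - n) else 0)" for X i j
  proof -
    have "ent (X * transp ?T) i j = ent (transp (X * transp ?T)) j i" by simp
    also have "\<dots> = (if n \<le> j then ent X i (j - n) else 0)"
      unfolding transp_mult by (auto simp: ent_reindex_mult[OF inj] ran inv)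
    finally show ?thesis .
  qed
  have T: "ent (?T * X) i j = (if n \<le> i then ent X (i - n) j else 0)" for X i j
    by (auto simp: ent_reindex_mult[OF inj] ran inv)
  have component: "component f (double_fun n R x) = component f (R x) + ?T * component f (R x) * transp ?T" if "f 0 = 0" for f
  proof (rule lfmat_eqI)
    fix i j
    show "ent (component f (double_fun n R x)) i j = ent (component f (R x) + ?T * component f (R x) * transp ?T) i j"
      using assms that by (auto simp: transp T component.rep_eq double_fun_def)
  qed
  have "cdiag (transp ?T) * J t = J t * cdiag (transp ?T)" by (simp add: J_cdiag)
  then show ?thesis
    unfolding chi_def
    by (simp add: component cdiag_add cdiag_mult distrib_left distrib_right mult.assoc)
qed

text \<open>Read the complex system \<open>(c, a, b)\<close> as a system over \<open>H\<^sub>t\<close>.  Over the complex numbers its transfer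
  function is the direct sum of that of \<open>(c, a, b)\<close> and its conjugate, and on quaternionic matrices
  entrywise conjugation is a similarity by \<open>J t\<close>; so this sum is similar to two copies of \<open>R\<close>.  To stay
  over \<open>H\<^sub>t\<close> the change of coordinates must be quaternionic itself: \<open>X1\<close> and \<open>X2\<close> are the real and the
  imaginary part of \<open>transp P0\<close> with respect to the quaternionic structure, and \<open>Y1\<close> and \<open>Y2\<close> are those
  of \<open>P0\<close>, multiplied by \<open>2\<close> and \<open>- 2\<close>.\<close>

lemma double_has_minimal_size:
  assumes t: "t \<noteq> 0" and rat: "rational_fun t n R" and size: "cplx_degree (2 * n) (\<lambda>x. chi t (R x)) m"
  shows "has_minimal_size t (2 * n) (double_fun n R) m"
proof -
  obtain c a b where min: "cplx_minimal (2 * n) m c a b (\<lambda>x. chi t (R x))" using size by (auto simp: cplx_degree_def)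
  then have system: "system (2 * n) m c a b" and obs: "cplx_observable m c a" and ctr: "cplx_controllable m a b"
    and real: "\<forall>\<^sub>F x in nhds 0. chi t (R x) = chi t (R 0) + x *\<^sub>R (c * res a x * b)"
    by (auto simp: cplx_minimal_def realizes_def)
  note s = system[unfolded system_def]
  have car: "\<forall>\<^sub>F x in nhds 0. R x \<in> carrier_mat n n" by (rule rational_funD[OF t rat])
  have car0: "R 0 \<in> carrier_mat n n" using eventually_nhds_x_imp_x[OF car] .
  define e where "e = idm (2 * n)"
  define j where "j = (1 / t) *\<^sub>R J t"
  define T U where "T = cdiag (reindex (\<lambda>i. n + i))" and "U = cdiag (transp (reindex (\<lambda>i. n + i)))"
  define X1 X2 where "X1 = (1 / 2) *\<^sub>R (transp P0 + J t * transp P1)"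
    and "X2 = (- 1 / 2) *\<^sub>R (iunit * (transp P0 - J t * transp P1))"
  define Y1 Y2 where "Y1 = P0 + P1 * j" and "Y2 = iunit * (P0 - P1 * j)"
  have j: "J t * j = 1" "j * J t = 1" using t by (simp_all add: j_def J_square)
  have conjm_j [simp]: "conjm j = j" by (simp add: j_def)
  have iunit_mid: "Y * (iunit * Z) = iunit * (Y * Z)" for Y Z
    by (metis iunit_central mult.assoc)
  have iunit_sq: "iunit * (iunit * Z) = - Z" for Z
    by (simp add: iunit_square flip: mult.assoc)
  note iunit = iunit_sq iunit_mid[of "transp P0"] iunit_mid[of "transp P1"] iunit_mid[of "J t"] iunit_mid[of e] iunit_mid[of T]
  have UT: "U * T = 1" "U * e = 0" "e * T = 0" "e + T * e * U = idm (2 * (2 * n))"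
    using arg_cong[OF shift_props(1)[of n], of cdiag] arg_cong[OF shift_props(2)[of n], of cdiag]
      arg_cong[OF shift_props(3)[of n], of cdiag] arg_cong[OF shift_props(4)[of n], of cdiag]
    by (simp_all add: U_def T_def e_def cdiag_mult cdiag_add cdiag_idm mult_2)
  have UTz: "U * (T * Z) = Z" "U * (e * Z) = 0" "e * (T * Z) = 0" "e * (e * Z) = e * Z" for Z
    using UT by (simp_all add: e_def flip: mult.assoc)
  have Je: "J t * e = e * J t" unfolding e_def by (rule J_idm)
  have je: "j * e = e * j" by (simp add: j_def Je)
  have quat: "quaternionic t e" "quaternionic t T" "quaternionic t U"
    unfolding e_def T_def U_def by (intro quaternionic_intros)+
  have quatX: "quaternionic t X1" "quaternionic t X2"
    unfolding X1_def X2_def quaternionic_def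
    by (simp_all add: conjm_mult distrib_left distrib_right left_diff_distrib right_diff_distrib mult.assoc
        J_P J_square_mult iunit algebra_simps)
  have JPj: "J t * (P1 * j) = P0 * J t"
    by (simp add: J_P j_def t flip: mult.assoc)
  have quatY: "quaternionic t Y1" "quaternionic t Y2"
    unfolding Y1_def Y2_def quaternionic_def
    by (simp_all add: conjm_mult distrib_left distrib_right left_diff_distrib right_diff_distrib mult.assoc
        JPj J_P j iunit algebra_simps)
  have XY: "X1 * Y1 = 1" "X1 * Y2 = 0" "X2 * Y1 = 0" "X2 * Y2 = 1"
  proof -
    let ?p = "transp P0 + J t * transp P1" and ?m = "transp P0 - J t * transp P1"
    have 1: "?p * (P0 + P1 * j) = 2 *\<^sub>R 1" "?m * (P0 - P1 * j) = 2 *\<^sub>R 1"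
      "?p * (P0 - P1 * j) = 0" "?m * (P0 + P1 * j) = 0"
      by (simp_all add: distrib_left distrib_right left_diff_distrib right_diff_distrib mult.assoc
          P_orth P_orth_mult j scaleR_2)
    show "X1 * Y1 = 1" "X1 * Y2 = 0" "X2 * Y1 = 0" "X2 * Y2 = 1"
      unfolding X1_def X2_def Y1_def Y2_def
      by (simp_all add: mult.assoc 1 iunit_mid[of ?p] iunit_mid[of ?m] iunit_sq iunit_square)
  qed
  \<comment> \<open>This is where \<open>F\<close> has to be quaternionic: it turns the conjugate of \<open>F\<close> back into \<open>F\<close>.\<close>
  have XF: "X1 * cdiag F = F * X1" "X2 * cdiag F = F * X2" if "quaternionic t F" for F
  proof -
    have "J t * (transp P1 * cdiag F) = F * (J t * transp P1)"
      using that by (simp add: transpP_cdiag quaternionic_def flip: mult.assoc)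
    then show "X1 * cdiag F = F * X1" "X2 * cdiag F = F * X2"
      unfolding X1_def X2_def
      by (simp_all add: distrib_left distrib_right left_diff_distrib right_diff_distrib mult.assoc transpP_cdiag iunit iunit_mid[of F])
  qed
  \<comment> \<open>Placing the two intertwiners in separate blocks yields both copies of \<open>F\<close>.\<close>
  define X Y where "X = e * X1 + T * (e * X2)" and "Y = Y1 * e + Y2 * (e * U)"
  have double: "X * cdiag F * Y = F + T * F * U" if F: "quaternionic t F" "e * F = F" "F * e = F" for F
  proof -
    have "X * cdiag F = e * F * X1 + T * (e * F * X2)"
      by (simp add: X_def distrib_right mult.assoc XF[OF F(1)])
    also have "\<dots> * Y = F * (X1 * Y1) * e + F * (X1 * Y2) * (e * U) + T * (F * (X2 * Y1) * e)
        + T * (F * (X2 * Y2) * (e * U))"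
      unfolding Y_def F by (simp add: distrib_left distrib_right mult.assoc)
    also have "\<dots> = F + T * F * U" unfolding XY using F(3) by (simp flip: mult.assoc)
    finally show ?thesis .
  qed
  have eP: "idm (2 * (2 * n)) = e + T * e * U" by (simp add: UT)
  have Xl: "idm (2 * (2 * n)) * X = X"
    unfolding eP X_def by (simp add: distrib_left distrib_right mult.assoc UTz)
  have Yr: "Y * idm (2 * (2 * n)) = Y"
  proof -
    have "U * (T * (e * U)) = e * U" by (simp add: UTz)
    moreover have "e * (U * e) = 0" "e * (T * (e * U)) = 0" using UT by (simp_all add: UTz)
    ultimately show ?thesis
      unfolding eP Y_def by (simp add: distrib_left distrib_right mult.assoc UTz UT) (simp add: e_def)
  qed
  have dla: "idm (2 * m) * cdiag a = cdiag a" "cdiag a * idm (2 * m) = cdiag a" "cdiag c * idm (2 * m) = cdiag c"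
    "idm (2 * m) * cdiag b = cdiag b"
    using s by (simp_all flip: cdiag_idm cdiag_mult)
  have quatXY: "quaternionic t X" "quaternionic t Y"
    unfolding X_def Y_def by (intro quaternionic_intros quat quatX quatY)+
  obtain C' where C': "C' \<in> carrier_mat (2 * n) m" "chi t C' = X * cdiag c"
  proof (rule quaternionic_imp_chi[OF t])
    show "quaternionic t (X * cdiag c)" by (intro quaternionic_intros quatXY)
    show "idm (2 * (2 * n)) * (X * cdiag c) = X * cdiag c" by (simp only: Xl mult.assoc[of _ X, symmetric])
    show "X * cdiag c * idm (2 * m) = X * cdiag c" by (simp only: dla mult.assoc)
  qed
  obtain A' where A': "A' \<in> carrier_mat m m" "chi t A' = cdiag a"
    by (rule quaternionic_imp_chi[OF t quaternionic_intros(5) dla(1,2)])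
  obtain B' where B': "B' \<in> carrier_mat m (2 * n)" "chi t B' = cdiag b * Y"
  proof (rule quaternionic_imp_chi[OF t])
    show "quaternionic t (cdiag b * Y)" by (intro quaternionic_intros quatXY)
    show "idm (2 * m) * (cdiag b * Y) = cdiag b * Y" by (simp only: dla flip: mult.assoc)
    show "cdiag b * Y * idm (2 * (2 * n)) = cdiag b * Y" by (simp only: Yr mult.assoc)
  qed
  have real': "realizes (2 * (2 * n)) (2 * m) (chi t C') (chi t A') (chi t B') (\<lambda>x. chi t (double_fun n R x))"
  proof -
    have 0: "chi t (double_fun n R 0) = X * cdiag (chi t (R 0)) * Y"
      using chi_double_fun[of R 0 n t] car0
      by (subst double) (auto simp: chi_quaternionic chi_idm e_def T_def U_def)
    have "\<forall>\<^sub>F x in nhds 0. chi t (double_fun n R x) =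
        chi t (double_fun n R 0) + x *\<^sub>R (chi t C' * res (chi t A') x * chi t B')"
      using car real system_regular[OF system]
    proof eventually_elim
      case (elim x)
      have "chi t (double_fun n R x) = X * cdiag (chi t (R x)) * Y"
        using chi_double_fun[of R x n t] elim(1)
        by (subst double) (auto simp: chi_quaternionic chi_idm e_def T_def U_def)
      also have "\<dots> = X * cdiag (chi t (R 0)) * Y + x *\<^sub>R (X * (cdiag c * cdiag (res a x) * cdiag b) * Y)"
        by (subst elim(2)) (simp add: cdiag_add cdiag_scaleR cdiag_mult distrib_left distrib_right)
      finally show ?case
        unfolding 0 C' A' B' res_cdiag[OF elim(3)] by (simp add: mult.assoc)
    qed
    with system_chi[OF C'(1) A'(1) B'(1)] show ?thesis by (simp add: realizes_def)
  qed
  have obs': "cplx_observable (2 * m) (chi t C') (chi t A')"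
    unfolding cplx_observable_def C' A'
  proof (intro allI impI)
    fix z assume z: "idm (2 * m) * z = z" "\<forall>k. X * cdiag c * cdiag a ^ k * z = 0"
    have Pz: "idm m * (transp P0 * z) = transp P0 * z" "idm m * (transp P1 * z) = transp P1 * z"
      using z(1) by (simp_all add: transpP_idm mult.assoc flip: mult.assoc[of "idm m"])
    have van: "c * a ^ k * (transp P0 * z) = 0" "c * a ^ k * conjm (transp P1 * z) = 0" for k
    proof -
      define W where "W = cdiag (c * a ^ k) * z"
      have XW: "X * W = 0" using z(2) by (simp add: W_def cdiag_mult cdiag_power mult.assoc)
      have "e * (X * W) = e * X1 * W" by (simp add: X_def distrib_left distrib_right mult.assoc UTz)
      then have 1: "e * (transp P0 * W) + e * (J t * (transp P1 * W)) = 0"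
        using XW by (simp add: X1_def distrib_left distrib_right mult.assoc)
      have "U * (X * W) = e * X2 * W" by (simp add: X_def distrib_left distrib_right mult.assoc UTz)
      then have "iunit * (e * (transp P0 * W) - e * (J t * (transp P1 * W))) = 0"
        using XW by (simp add: X2_def left_diff_distrib right_diff_distrib mult.assoc iunit)
      then have "iunit * (iunit * (e * (transp P0 * W) - e * (J t * (transp P1 * W)))) = 0" by simp
      then have 2: "e * (transp P0 * W) - e * (J t * (transp P1 * W)) = 0" unfolding iunit by simp
      have "2 *\<^sub>R (e * (transp P0 * W)) = 0" "2 *\<^sub>R (e * (J t * (transp P1 * W))) = 0"
        using 1 2 by (simp_all add: scaleR_2)
      then have 3: "e * (transp P0 * W) = 0" "e * (J t * (transp P1 * W)) = 0" by simp_all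
      then have "j * (J t * (e * (transp P1 * W))) = 0" using Je by (metis mult.assoc mult_zero_right)
      then have 4: "e * (transp P1 * W) = 0" using j by (simp flip: mult.assoc)
      have ec: "e * (c * y) = c * y" for y using s by (simp add: e_def flip: mult.assoc)
      have "e * (transp P0 * W) = c * a ^ k * (transp P0 * z)"
        unfolding W_def by (simp add: transpP_cdiag ec mult.assoc flip: mult.assoc[of "transp P0"])
      then show "c * a ^ k * (transp P0 * z) = 0" using 3 by simp
      have "conjm (e * (transp P1 * W)) = conjm (e * (conjm (c * a ^ k) * (transp P1 * z)))"
        unfolding W_def by (simp add: transpP_cdiag mult.assoc flip: mult.assoc[of "transp P1"])
      also have "\<dots> = c * a ^ k * conjm (transp P1 * z)"
        by (simp add: conjm_mult e_def mult.assoc) (use ec in \<open>simp add: e_def\<close>)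
      finally show "c * a ^ k * conjm (transp P1 * z) = 0" using 4 by simp
    qed
    have "transp P0 * z = 0" by (rule cplx_observableD[OF obs Pz(1) van(1)])
    moreover have "idm m * conjm (transp P1 * z) = conjm (transp P1 * z)"
      using Pz(2) by (metis conjm_mult conjm_simps(7))
    then have "conjm (transp P1 * z) = 0" by (rule cplx_observableD[OF obs _ van(2)])
    then have "transp P1 * z = 0" by (metis conjm_simps(1,2))
    ultimately have "(P0 * transp P0 + P1 * transp P1) * z = 0" by (simp add: distrib_right mult.assoc)
    then show "z = 0" by (simp add: P_complete)
  qed
  have ctr': "cplx_controllable (2 * m) (chi t A') (chi t B')"
    unfolding cplx_controllable_def B' A'
  proof (intro allI impI)
    fix z assume z: "z * idm (2 * m) = z" "\<forall>k. z * cdiag a ^ k * (cdiag b * Y) = 0"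
    have Pz: "z * P0 * idm m = z * P0" "z * P1 * idm m = z * P1"
      using z(1) by (simp_all add: P_idm mult.assoc) (simp_all flip: mult.assoc)
    have van: "z * P0 * a ^ k * b = 0" "conjm (z * P1) * a ^ k * b = 0" for k
    proof -
      define W where "W = z * cdiag (a ^ k * b)"
      have WY: "W * Y = 0" using z(2) by (simp add: W_def cdiag_mult cdiag_power mult.assoc)
      have eeU: "e * (e * U) = e * U" by (simp add: UTz)
      have "(W * Y) * e = W * Y1 * e"
        by (simp add: Y_def distrib_left distrib_right mult.assoc UT) (simp add: e_def)
      then have 1: "W * P0 * e + W * P1 * j * e = 0"
        using WY by (simp add: Y1_def distrib_left distrib_right mult.assoc)
      have "(W * Y) * T = W * Y2 * e"
        by (simp add: Y_def distrib_left distrib_right mult.assoc UT)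
      then have "iunit * (W * P0 * e - W * P1 * j * e) = 0"
        using WY by (simp add: Y2_def left_diff_distrib right_diff_distrib mult.assoc iunit_mid[of W])
      then have "iunit * (iunit * (W * P0 * e - W * P1 * j * e)) = 0" by simp
      then have 2: "W * P0 * e - W * P1 * j * e = 0" unfolding iunit by simp
      have "2 *\<^sub>R (W * P0 * e) = 0" "2 *\<^sub>R (W * P1 * j * e) = 0"
        using 1 2 by (simp_all add: scaleR_2)
      then have 3: "W * P0 * e = 0" "W * P1 * j * e = 0" by simp_all
      then have "W * P1 * e * j * J t = 0" using je by (metis mult.assoc mult_zero_left)
      then have 4: "W * P1 * e = 0" using j by (simp add: mult.assoc)
      have be: "b * e = b" using s by (simp add: e_def)
      have "W * P0 * e = z * P0 * a ^ k * b"
        unfolding W_def by (simp add: mult.assoc cdiag_P) (simp add: be mult.assoc)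
      then show "z * P0 * a ^ k * b = 0" using 3 by simp
      have "conjm (W * P1 * e) = conjm (z * P1 * conjm (a ^ k * b) * e)"
        unfolding W_def by (simp add: mult.assoc cdiag_P)
      also have "\<dots> = conjm (z * P1) * a ^ k * b"
        by (simp add: conjm_mult e_def mult.assoc) (use be in \<open>simp add: e_def\<close>)
      finally show "conjm (z * P1) * a ^ k * b = 0" using 4 by simp
    qed
    have "z * P0 = 0" by (rule cplx_controllableD[OF ctr Pz(1) van(1)])
    moreover have "conjm (z * P1) * idm m = conjm (z * P1)"
      using Pz(2) by (metis conjm_mult conjm_simps(7))
    then have "conjm (z * P1) = 0" by (rule cplx_controllableD[OF ctr _ van(2)])
    then have "z * P1 = 0" by (metis conjm_simps(1,2))
    ultimately have "z * (P0 * transp P0 + P1 * transp P1) = 0" by (simp add: distrib_left flip: mult.assoc)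
    then show "z = 0" by (simp add: P_complete)
  qed
  have "\<forall>\<^sub>F x in nhds 0. double_fun n R x \<in> carrier_mat (2 * n) (2 * n)"
    using car by eventually_elim (auto simp: double_fun_def mult_2)
  then have "minimal_realization t (2 * n) m C' A' B' (double_fun n R)"
    using C' A' B' real' obs' ctr' by (simp add: minimal_realization_iff[OF t] cplx_minimal_def)
  then show ?thesis by (auto simp: has_minimal_size_def)
qed

text \<open>A minimal realization over \<open>H\<^sub>t\<close> of size \<open>N\<close> gives a complex one of size \<open>2 N\<close>.  In the other case of
  the definition the doubled function has a minimal realization of size \<open>m\<close>, where \<open>m\<close> is the complex
  degree, and the uniqueness of minimal sizes shows that this is the only one.\<close>

theorem has_degree_iff:
  assumes t: "t \<noteq> 0" and rat: "rational_fun t n R"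
  shows "has_degree t n R d \<longleftrightarrow> (\<exists>m. cplx_degree (2 * n) (\<lambda>x. chi t (R x)) m \<and> d = real m / 2)"
proof -
  obtain m where m: "cplx_degree (2 * n) (\<lambda>x. chi t (R x)) m" using rational_funD[OF t rat] by blast
  have uniq: "(\<exists>k. cplx_degree (2 * n) (\<lambda>x. chi t (R x)) k \<and> d = real k / 2) \<longleftrightarrow> d = real m / 2"
    using m cplx_degree_unique by metis
  show ?thesis
  proof (cases "\<exists>N. has_minimal_size t n R N")
    case True
    have "2 * N = m" if "has_minimal_size t n R N" for N
      by (rule cplx_degree_unique[OF has_minimal_size_imp_cplx_degree[OF t that] m])
    then have "has_minimal_size t n R N \<Longrightarrow> real N = real m / 2" for N by fastforce
    with True show ?thesis unfolding has_degree_def uniq by metis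
  next
    case False
    let ?D = "double_fun n R"
    have D: "has_minimal_size t (2 * n) ?D m" by (rule double_has_minimal_size[OF t rat m])
    have "k = m" if "has_minimal_size t (2 * n) ?D k" for k
      using cplx_degree_unique[OF has_minimal_size_imp_cplx_degree[OF t that] has_minimal_size_imp_cplx_degree[OF t D]]
      by simp
    with False D show ?thesis unfolding has_degree_def uniq by metis
  qed
qed

section \<open>Supporting projections and minimal factorizations\<close>

text \<open>Kernels and ranges are sets of columns, whereas the complex theory uses equations between matrices.\<close>

lemma eq_zero_if_kills_columns:
  assumes t: "t \<noteq> 0" and X: "X \<in> carrier_mat r s"
    and kills: "\<And>h. h \<in> carrier_mat s 1 \<Longrightarrow> chi t X * chi t h = 0"
  shows "chi t X = 0"
proof -
  have X': "chi t X * cdiag (unit_mat 1 j 0) = 0" if j: "j < s" for j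
  proof -
    obtain h where "h \<in> carrier_mat s 1" "chi t h = cdiag (unit_mat 1 j 0)"
    proof (rule quaternionic_imp_chi[OF t])
      have "idm s * unit_mat 1 j 0 = unit_mat 1 j 0" "unit_mat 1 j 0 * idm 1 = unit_mat 1 j 0"
        using j by (auto intro!: lfmat_eqI simp: ent_idm_mult ent_mult_idm)
      then show "idm (2 * s) * cdiag (unit_mat 1 j 0) = cdiag (unit_mat 1 j 0)"
        "cdiag (unit_mat 1 j 0) * idm (2 * 1) = cdiag (unit_mat 1 j 0)"
        unfolding cdiag_idm[symmetric] cdiag_mult[symmetric] by simp_all
    qed (rule quaternionic_intros)
    with kills show ?thesis by metis
  qed
  have col: "chi t X * (P0 * unit_mat 1 j 0) = 0" "chi t X * (P1 * unit_mat 1 j 0) = 0" if "j < s" for j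
  proof -
    have "chi t X * cdiag (unit_mat 1 j 0) * P0 = 0" "chi t X * cdiag (unit_mat 1 j 0) * P1 = 0"
      using X'[OF that] by simp_all
    moreover have "conjm (unit_mat 1 j 0) = unit_mat 1 j 0" by (rule lfmat_eqI) simp
    ultimately show "chi t X * (P0 * unit_mat 1 j 0) = 0" "chi t X * (P1 * unit_mat 1 j 0) = 0"
      by (simp_all add: mult.assoc cdiag_P)
  qed
  show ?thesis
  proof (rule lfmat_eqI)
    fix i k :: nat
    have P: "P0 * unit_mat 1 j 0 = unit_mat 1 (2 * j) 0" "P1 * unit_mat 1 j 0 = unit_mat 1 (2 * j + 1) 0" for j
      by (auto intro!: lfmat_eqI simp: ent_mult_unit P_ent)
    show "ent (chi t X) i k = ent 0 i k"
    proof (cases "k < 2 * s")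
      case True
      then have "chi t X * unit_mat 1 k 0 = 0"
        using col[of "k div 2"] unfolding P by (cases "even k") (auto simp: less_mult_imp_div_less)
      then show ?thesis using ent_mult_unit[of "chi t X" 1 k 0 i 0] by simp
    next
      case False
      then show ?thesis using chi_idm(2)[OF X, of t] by (simp add: idm_right_iff)
    qed
  qed
qed

lemma A_cross_chi:
  assumes t: "t \<noteq> 0" and C: "C \<in> carrier_mat n N" and A: "A \<in> carrier_mat N N" and B: "B \<in> carrier_mat N n"
  shows "A_cross t (qid n) C A B \<in> carrier_mat N N"
    and "chi t (A_cross t (qid n) C A B) = chi t A - chi t B * chi t C"
proof -
  have c: "B \<star>\<^bsub>t\<^esub> qid n \<in> carrier_mat N n" "B \<star>\<^bsub>t\<^esub> qid n \<star>\<^bsub>t\<^esub> C \<in> carrier_mat N N"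
    using B C by (auto intro!: qmat_mult_carrier)
  show "A_cross t (qid n) C A B \<in> carrier_mat N N"
    unfolding A_cross_def qinv_qid[OF t] using c(2) by (rule minus_carrier_mat)
  show "chi t (A_cross t (qid n) C A B) = chi t A - chi t B * chi t C"
    unfolding A_cross_def qinv_qid[OF t] chi_lin(2)[OF A c(2)] chi_mult[OF c(1) C]
      chi_mult[OF B qid_carrier] chi_qid by (simp add: chi_idm[OF B])
qed

text \<open>The kernel of an idempotent \<open>p\<close> is the range of \<open>1 - p\<close>, and its range is the set of fixed columns;
  so both invariance conditions become equations tested on all columns.\<close>

lemma supporting_projection_iff:
  assumes t: "t \<noteq> 0" and C: "C \<in> carrier_mat n N" and A: "A \<in> carrier_mat N N" and B: "B \<in> carrier_mat N n"
  shows "supporting_projection t N (qid n) C A B P \<longleftrightarrow>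
    P \<in> carrier_mat N N \<and> supporting (2 * N) (chi t C) (chi t A) (chi t B) (chi t P)"
proof (cases "P \<in> carrier_mat N N")
  case P: True
  let ?p = "chi t P" and ?a = "chi t A" and ?X = "A_cross t (qid n) C A B" and ?e = "idm (2 * N)"
  note X = A_cross_chi[OF t C A B]
  have chi_eq: "Y = Z \<longleftrightarrow> chi t Y = chi t Z" if "Y \<in> carrier_mat r s" "Z \<in> carrier_mat r s" for Y Z r s
    using chi_inj[OF t that] by auto
  have chi0: "Y = 0\<^sub>m r s \<longleftrightarrow> chi t Y = 0" if "Y \<in> carrier_mat r s" for Y r s
    using chi_eq[OF that, of "0\<^sub>m r s"] by (simp add: chi_zero)
  have vec: "chi t (Y \<star>\<^bsub>t\<^esub> h) = chi t Y * chi t h" "Y \<star>\<^bsub>t\<^esub> h \<in> carrier_mat N 1"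
    if "Y \<in> carrier_mat N N" "h \<in> carrier_mat N 1" for Y h
    using that by (auto simp: chi_mult[of _ N N])
  have mat: "chi t (Y \<star>\<^bsub>t\<^esub> Z) = chi t Y * chi t Z" "Y \<star>\<^bsub>t\<^esub> Z \<in> carrier_mat N N"
    if "Y \<in> carrier_mat N N" "Z \<in> carrier_mat N N" for Y Z
    using that by (auto simp: chi_mult[of _ N N])
  have ker: "h \<in> qker t N P \<longleftrightarrow> h \<in> carrier_mat N 1 \<and> ?p * chi t h = 0" for h
    using vec[OF P] chi0 by (auto simp: qker_def)
  have ran: "h \<in> qran t N P \<longleftrightarrow> h \<in> carrier_mat N 1 \<and> ?p * chi t h = chi t h"
    if idem: "?p * ?p = ?p" for h
  proof
    assume "h \<in> qran t N P"
    then obtain g where "g \<in> carrier_mat N 1" "h = P \<star>\<^bsub>t\<^esub> g" by (auto simp: qran_def)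
    then show "h \<in> carrier_mat N 1 \<and> ?p * chi t h = chi t h"
      using vec[OF P] idem by (simp flip: mult.assoc)
  next
    assume "h \<in> carrier_mat N 1 \<and> ?p * chi t h = chi t h"
    then show "h \<in> qran t N P"
      using vec[OF P, of h] chi_eq[of h N 1 "P \<star>\<^bsub>t\<^esub> h"] by (auto simp: qran_def)
  qed
  have idem: "P \<star>\<^bsub>t\<^esub> P = P \<longleftrightarrow> ?p * ?p = ?p"
    using chi_eq[OF mat(2)[OF P P] P] mat(1)[OF P P] by simp
  have e: "?e * ?p = ?p" "?p * ?e = ?p" "?a * ?e = ?a" "?e * ?a = ?a"
    using chi_idm P A by auto
  have complement: "qid N - P \<in> carrier_mat N N" "chi t (qid N - P) = ?e - ?p"
    using P by (auto simp: chi_lin(2)[of _ N N] chi_qid intro: minus_carrier_mat)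
  have kernel: "(\<lambda>h. A \<star>\<^bsub>t\<^esub> h) ` qker t N P \<subseteq> qker t N P \<longleftrightarrow> ?p * ?a * ?p = ?p * ?a"
    if idem: "?p * ?p = ?p"
  proof
    assume inv: "(\<lambda>h. A \<star>\<^bsub>t\<^esub> h) ` qker t N P \<subseteq> qker t N P"
    have "chi t (P \<star>\<^bsub>t\<^esub> A \<star>\<^bsub>t\<^esub> (qid N - P)) = 0"
    proof (rule eq_zero_if_kills_columns[OF t])
      show "P \<star>\<^bsub>t\<^esub> A \<star>\<^bsub>t\<^esub> (qid N - P) \<in> carrier_mat N N" using P A complement by auto
      fix h :: "quat mat" assume h: "h \<in> carrier_mat N 1"
      let ?g = "(qid N - P) \<star>\<^bsub>t\<^esub> h"
      have g: "?g \<in> carrier_mat N 1" "chi t ?g = (?e - ?p) * chi t h"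
        using vec[OF complement(1) h] complement by auto
      have "?p * chi t ?g = (?p * (?e - ?p)) * chi t h" unfolding g by (simp add: mult.assoc)
      then have "?g \<in> qker t N P" using g(1) idem e unfolding ker by (simp add: right_diff_distrib)
      then have "A \<star>\<^bsub>t\<^esub> ?g \<in> qker t N P" using inv by blast
      then have "?p * (?a * chi t ?g) = 0" using vec[OF A g(1)] by (simp add: ker)
      then show "chi t (P \<star>\<^bsub>t\<^esub> A \<star>\<^bsub>t\<^esub> (qid N - P)) * chi t h = 0"
        unfolding g by (simp add: mat P A complement mult.assoc)
    qed
    then have "?p * ?a * (?e - ?p) = 0" by (simp add: mat P A complement)
    moreover have "?p * ?a * (?e - ?p) = ?p * ?a - ?p * ?a * ?p"
      by (simp add: right_diff_distrib e mult.assoc)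
    ultimately show "?p * ?a * ?p = ?p * ?a" by (metis right_minus_eq)
  next
    assume inv: "?p * ?a * ?p = ?p * ?a"
    show "(\<lambda>h. A \<star>\<^bsub>t\<^esub> h) ` qker t N P \<subseteq> qker t N P"
    proof (rule image_subsetI)
      fix h assume h: "h \<in> qker t N P"
      have "?p * (?a * chi t h) = ?p * ?a * ?p * chi t h" unfolding inv by (simp only: mult.assoc)
      also have "\<dots> = 0" using h by (simp add: ker mult.assoc)
      finally show "A \<star>\<^bsub>t\<^esub> h \<in> qker t N P" using h vec[OF A] by (simp add: ker)
    qed
  qed
  have range: "(\<lambda>h. ?X \<star>\<^bsub>t\<^esub> h) ` qran t N P \<subseteq> qran t N P \<longleftrightarrow> ?p * chi t ?X * ?p = chi t ?X * ?p"
    if idem: "?p * ?p = ?p"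
  proof
    assume inv: "(\<lambda>h. ?X \<star>\<^bsub>t\<^esub> h) ` qran t N P \<subseteq> qran t N P"
    have "chi t ((qid N - P) \<star>\<^bsub>t\<^esub> ?X \<star>\<^bsub>t\<^esub> P) = 0"
    proof (rule eq_zero_if_kills_columns[OF t])
      show "(qid N - P) \<star>\<^bsub>t\<^esub> ?X \<star>\<^bsub>t\<^esub> P \<in> carrier_mat N N" using P X complement by auto
      fix h :: "quat mat" assume h: "h \<in> carrier_mat N 1"
      have g: "P \<star>\<^bsub>t\<^esub> h \<in> carrier_mat N 1" using vec[OF P h] by simp
      have "P \<star>\<^bsub>t\<^esub> h \<in> qran t N P" using h by (auto simp: qran_def)
      then have "?X \<star>\<^bsub>t\<^esub> (P \<star>\<^bsub>t\<^esub> h) \<in> qran t N P" using inv by blast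
      then have *: "?p * (chi t ?X * (?p * chi t h)) = chi t ?X * (?p * chi t h)"
        using vec[OF X(1) g] vec[OF P h] by (simp add: ran[OF idem])
      have "?e * chi t ?X = chi t ?X" by (rule chi_idm[OF X(1)])
      then have "?e * (chi t ?X * y) = chi t ?X * y" for y by (simp flip: mult.assoc)
      then show "chi t ((qid N - P) \<star>\<^bsub>t\<^esub> ?X \<star>\<^bsub>t\<^esub> P) * chi t h = 0"
        using * by (simp add: mat[OF mat(2)] mat P X(1) complement mult.assoc left_diff_distrib)
    qed
    then have "(?e - ?p) * chi t ?X * ?p = 0"
      using mat[OF mat(2)[OF complement(1) X(1)] P] mat(1)[OF complement(1) X(1)] complement(2) by simp
    then show "?p * chi t ?X * ?p = chi t ?X * ?p"
      using chi_idm(1)[OF X(1), of t] by (simp add: left_diff_distrib)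
  next
    assume inv: "?p * chi t ?X * ?p = chi t ?X * ?p"
    show "(\<lambda>h. ?X \<star>\<^bsub>t\<^esub> h) ` qran t N P \<subseteq> qran t N P"
    proof (rule image_subsetI)
      fix h assume "h \<in> qran t N P"
      then have h: "h \<in> carrier_mat N 1" "?p * chi t h = chi t h" by (auto simp: ran[OF idem])
      have "?p * (chi t ?X * chi t h) = ?p * chi t ?X * ?p * chi t h" using h by (simp add: mult.assoc)
      also have "\<dots> = chi t ?X * chi t h" unfolding inv using h by (simp add: mult.assoc)
      finally show "?X \<star>\<^bsub>t\<^esub> h \<in> qran t N P" using h vec[OF X(1)] by (simp add: ran[OF idem])
    qed
  qed
  show ?thesis
    unfolding supporting_projection_def supporting_def idem X(2)[symmetric]
    using P e kernel range by auto
qed (simp add: supporting_projection_def)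

lemma factors_chi:
  assumes t: "t \<noteq> 0" and C: "C \<in> carrier_mat n N" and A: "A \<in> carrier_mat N N" and B: "B \<in> carrier_mat N n"
    and P: "P \<in> carrier_mat N N" and reg: "regular (chi t A) x"
  shows "left_factor t n N C A B P x \<in> carrier_mat n n" "right_factor t n C A B P x \<in> carrier_mat n n"
    "chi t (left_factor t n N C A B P x) = lfactor (2 * n) (2 * N) (chi t C) (chi t A) (chi t B) (chi t P) x"
    "chi t (right_factor t n C A B P x) = rfactor (2 * n) (chi t C) (chi t A) (chi t B) (chi t P) x"
proof -
  have c: "qid N - P \<in> carrier_mat N N" "chi t (qid N - P) = idm (2 * N) - chi t P"
    using P by (auto simp: chi_lin(2)[of _ N N] chi_qid intro: minus_carrier_mat)
  have l: "(qid N - P) \<star>\<^bsub>t\<^esub> B \<in> carrier_mat N n" and r: "C \<star>\<^bsub>t\<^esub> P \<in> carrier_mat n N"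
    using c B C P by auto
  show "left_factor t n N C A B P x \<in> carrier_mat n n"
    "chi t (left_factor t n N C A B P x) = lfactor (2 * n) (2 * N) (chi t C) (chi t A) (chi t B) (chi t P) x"
    using transfer_chi[OF t qid_carrier C A l reg]
    by (simp_all add: left_factor_def lfactor_def chi_qid chi_mult[OF c(1) B] c(2))
  show "right_factor t n C A B P x \<in> carrier_mat n n"
    "chi t (right_factor t n C A B P x) = rfactor (2 * n) (chi t C) (chi t A) (chi t B) (chi t P) x"
    using transfer_chi[OF t qid_carrier r A B reg]
    by (simp_all add: right_factor_def rfactor_def chi_qid chi_mult[OF C P])
qed

text \<open>Conjugation by the conjugate-linear map that defines \<open>quaternionic\<close>: a ring automorphism, whose fixed
  points are the quaternionic matrices.\<close>

definition conj_twist :: "real \<Rightarrow> lfmat \<Rightarrow> lfmat" where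
  "conj_twist t Z = (1 / t) *\<^sub>R (J t * conjm Z * J t)"

lemma conj_twist_hom:
  assumes "t \<noteq> 0"
  shows "conj_twist t (X * Y) = conj_twist t X * conj_twist t Y"
    "conj_twist t (X + Y) = conj_twist t X + conj_twist t Y"
    "conj_twist t (X - Y) = conj_twist t X - conj_twist t Y"
    "conj_twist t (x *\<^sub>R X) = x *\<^sub>R conj_twist t X"
  using assms
  by (simp_all add: conj_twist_def conjm_mult distrib_left distrib_right left_diff_distrib right_diff_distrib
      mult.assoc J_square_mult scaleR_add_right scaleR_diff_right)

lemma conj_twist_fixed:
  assumes "t \<noteq> 0"
  shows "conj_twist t Z = Z \<longleftrightarrow> quaternionic t Z"
proof
  assume "quaternionic t Z"
  then show "conj_twist t Z = Z"
    using assms by (simp add: conj_twist_def quaternionic_def mult.assoc J_square)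
next
  assume "conj_twist t Z = Z"
  then have "Z * J t = conj_twist t Z * J t" by simp
  also have "\<dots> = J t * conjm Z"
    using assms by (simp add: conj_twist_def mult.assoc J_square)
  finally show "quaternionic t Z" by (simp add: quaternionic_def)
qed

text \<open>The automorphism \<open>conj_twist\<close> fixes the system and both factors, so it takes \<open>q\<close> to a supporting
  projection with the same factors, which must be \<open>q\<close> again.\<close>

lemma projection_quaternionic:
  assumes t: "t \<noteq> 0" and min: "cplx_minimal (2 * n) (2 * N) c a b F" and supp: "supporting (2 * N) c a b q"
    and quat: "quaternionic t c" "quaternionic t a" "quaternionic t b"
    and F1: "\<forall>\<^sub>F x in nhds 0. quaternionic t (lfactor (2 * n) (2 * N) c a b q x)"
    and F2: "\<forall>\<^sub>F x in nhds 0. quaternionic t (rfactor (2 * n) c a b q x)"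
  shows "quaternionic t q"
proof -
  let ?s = "conj_twist t"
  note hom = conj_twist_hom[OF t] and fixed = conj_twist_fixed[OF t]
  have f: "?s c = c" "?s a = a" "?s b = b" "?s (idm (2 * k)) = idm (2 * k)" for k
    using quat by (simp_all add: fixed quaternionic_intros)
  have system: "system (2 * n) (2 * N) c a b" using min by (auto simp: cplx_minimal_def realizes_def)
  have supp': "supporting (2 * N) c a b (?s q)"
    unfolding supporting_def
  proof (intro conjI)
    note q = supp[unfolded supporting_def]
    have "?s (idm (2 * N) * q) = ?s q" "?s (q * idm (2 * N)) = ?s q" "?s (q * q) = ?s q"
      "?s (q * a * q) = ?s (q * a)" "?s (q * (a - b * c) * q) = ?s ((a - b * c) * q)"
      using q by metis+
    then show "idm (2 * N) * ?s q = ?s q" "?s q * idm (2 * N) = ?s q" "?s q * ?s q = ?s q"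
      "?s q * a * ?s q = ?s q * a" "?s q * (a - b * c) * ?s q = (a - b * c) * ?s q"
      unfolding hom f by auto
  qed
  have res: "?s (res a x) = res a x" if "regular a x" for x
    using quaternionic_res[OF that quat(2)] by (simp add: fixed)
  have l: "\<forall>\<^sub>F x in nhds 0. lfactor (2 * n) (2 * N) c a b q x = lfactor (2 * n) (2 * N) c a b (?s q) x"
    using F1 system_regular[OF system]
  proof eventually_elim
    case (elim x)
    then have "?s (lfactor (2 * n) (2 * N) c a b q x) = lfactor (2 * n) (2 * N) c a b q x" by (simp add: fixed)
    moreover have "?s (lfactor (2 * n) (2 * N) c a b q x) = lfactor (2 * n) (2 * N) c a b (?s q) x"
      unfolding lfactor_def hom f res[OF elim(2)] ..
    ultimately show ?case by simp
  qed
  have r: "\<forall>\<^sub>F x in nhds 0. rfactor (2 * n) c a b q x = rfactor (2 * n) c a b (?s q) x"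
    using F2 system_regular[OF system]
  proof eventually_elim
    case (elim x)
    then have "?s (rfactor (2 * n) c a b q x) = rfactor (2 * n) c a b q x" by (simp add: fixed)
    moreover have "?s (rfactor (2 * n) c a b q x) = rfactor (2 * n) c a b (?s q) x"
      unfolding rfactor_def hom f res[OF elim(2)] ..
    ultimately show ?case by simp
  qed
  have "q = ?s q" by (rule factors_determine_projection[OF min supp supp' l r])
  then show ?thesis using fixed by metis
qed

theorem theorem3p24:
  fixes t :: real and n N :: nat
    and R :: "real \<Rightarrow> quat mat" and C A B :: "quat mat"
  assumes "t \<noteq> 0"
    and "minimal_realization t n N C A B R"
    and "R 0 = qid n"
  shows "(\<forall>P. supporting_projection t N (qid n) C A B P \<longrightarrow>
            minimal_factorization t n R (left_factor t n N C A B P) (right_factor t n C A B P) \<and>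
            left_factor t n N C A B P 0 = qid n \<and> right_factor t n C A B P 0 = qid n)
       \<and> (\<forall>R1 R2. minimal_factorization t n R R1 R2 \<and> R1 0 = qid n \<and> R2 0 = qid n \<longrightarrow>
            (\<exists>!P. supporting_projection t N (qid n) C A B P \<and>
                  R1 \<simeq> left_factor t n N C A B P \<and> R2 \<simeq> right_factor t n C A B P))"
proof -
  note t = assms(1)
  let ?c = "chi t C" and ?a = "chi t A" and ?b = "chi t B" and ?F = "\<lambda>x. chi t (R x)"
  have car: "C \<in> carrier_mat n N" "A \<in> carrier_mat N N" "B \<in> carrier_mat N n"
    and Rcar: "\<forall>\<^sub>F x in nhds 0. R x \<in> carrier_mat n n"
    and min: "cplx_minimal (2 * n) (2 * N) ?c ?a ?b ?F"
    using assms(2) by (auto simp: minimal_realization_iff[OF t])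
  have rat: "rational_fun t n R"
    using assms(2) by (auto simp: rational_fun_def minimal_realization_def)
  have size: "cplx_degree (2 * n) ?F (2 * N)" using min by (auto simp: cplx_degree_def)
  have F0: "?F 0 = idm (2 * n)" using assms(3) by (simp add: chi_qid)
  note supp_iff = supporting_projection_iff[OF t car]
  note fac = factors_chi[OF t car]
  have reg: "\<forall>\<^sub>F x in nhds 0. regular ?a x" by (rule system_regular[OF system_chi[OF car]])
  have reg0: "regular ?a 0" using eventually_nhds_x_imp_x[OF reg] .
  have at0: "left_factor t n N C A B P 0 = qid n" "right_factor t n C A B P 0 = qid n"
    if "P \<in> carrier_mat N N" for P
    using fac[OF that reg0] by (auto intro!: chi_inj[OF t _ qid_carrier] simp: chi_qid)
  have ratf: "rational_fun t n (left_factor t n N C A B P)" "rational_fun t n (right_factor t n C A B P)"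
    if P: "P \<in> carrier_mat N N" for P
  proof -
    have "realization t n N C A ((qid N - P) \<star>\<^bsub>t\<^esub> B) (left_factor t n N C A B P)"
      "realization t n N (C \<star>\<^bsub>t\<^esub> P) A B (right_factor t n C A B P)"
      using P car unfolding realization_def at0[OF P] same_near_0_def
      by (auto simp: left_factor_def right_factor_def intro!: qmat_mult_carrier[of _ N N] minus_carrier_mat)
    then show "rational_fun t n (left_factor t n N C A B P)" "rational_fun t n (right_factor t n C A B P)"
      by (auto simp: rational_fun_def)
  qed
  have same: "R' \<simeq> S \<longleftrightarrow> (\<forall>\<^sub>F x in nhds 0. chi t (R' x) = chi t (S x))"
    if "\<forall>\<^sub>F x in nhds 0. R' x \<in> carrier_mat n n" "\<forall>\<^sub>F x in nhds 0. S x \<in> carrier_mat n n" for R' S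
    unfolding same_near_0_def
    by (rule eventually_cong[OF eventually_conj[OF that]]) (use chi_inj[OF t] in auto)
  have fcar: "\<forall>\<^sub>F x in nhds 0. left_factor t n N C A B P x \<in> carrier_mat n n"
    "\<forall>\<^sub>F x in nhds 0. right_factor t n C A B P x \<in> carrier_mat n n"
    and fchi: "\<forall>\<^sub>F x in nhds 0. chi t (left_factor t n N C A B P x) = lfactor (2 * n) (2 * N) ?c ?a ?b (chi t P) x"
    "\<forall>\<^sub>F x in nhds 0. chi t (right_factor t n C A B P x) = rfactor (2 * n) ?c ?a ?b (chi t P) x"
    if "P \<in> carrier_mat N N" for P
    using reg by (eventually_elim, simp add: fac[OF that])+
  have prod_same: "R \<simeq> (\<lambda>x. R1 x \<star>\<^bsub>t\<^esub> R2 x) \<longleftrightarrow> (\<forall>\<^sub>F x in nhds 0. ?F x = chi t (R1 x) * chi t (R2 x))"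
    if c: "\<forall>\<^sub>F x in nhds 0. R1 x \<in> carrier_mat n n" "\<forall>\<^sub>F x in nhds 0. R2 x \<in> carrier_mat n n" for R1 R2
  proof -
    have "\<forall>\<^sub>F x in nhds 0. R1 x \<star>\<^bsub>t\<^esub> R2 x \<in> carrier_mat n n"
      using c by eventually_elim auto
    then have "R \<simeq> (\<lambda>x. R1 x \<star>\<^bsub>t\<^esub> R2 x) \<longleftrightarrow> (\<forall>\<^sub>F x in nhds 0. ?F x = chi t (R1 x \<star>\<^bsub>t\<^esub> R2 x))"
      by (rule same[OF Rcar])
    also have "\<dots> \<longleftrightarrow> (\<forall>\<^sub>F x in nhds 0. ?F x = chi t (R1 x) * chi t (R2 x))"
      by (rule eventually_cong[OF eventually_conj[OF c]]) (auto simp: chi_mult[of _ n n])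
    finally show ?thesis .
  qed
  have minimal: "minimal_factorization t n R (left_factor t n N C A B P) (right_factor t n C A B P)"
    if "supporting_projection t N (qid n) C A B P" for P
  proof -
    have P: "P \<in> carrier_mat N N" and supp: "supporting (2 * N) ?c ?a ?b (chi t P)"
      using that by (auto simp: supp_iff)
    obtain k1 k2 where k: "k1 + k2 = 2 * N"
      "cplx_degree (2 * n) (lfactor (2 * n) (2 * N) ?c ?a ?b (chi t P)) k1"
      "cplx_degree (2 * n) (rfactor (2 * n) ?c ?a ?b (chi t P)) k2"
      "\<forall>\<^sub>F x in nhds 0. ?F x = lfactor (2 * n) (2 * N) ?c ?a ?b (chi t P) x * rfactor (2 * n) ?c ?a ?b (chi t P) x"
      by (rule supporting_imp_minimal[OF min F0 supp])
    have sizes: "cplx_degree (2 * n) (\<lambda>x. chi t (left_factor t n N C A B P x)) k1"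
      "cplx_degree (2 * n) (\<lambda>x. chi t (right_factor t n C A B P x)) k2"
       by (rule cplx_degree_cong[OF k(2)], use fchi(1)[OF P] in \<open>auto elim: eventually_mono\<close>)
        (rule cplx_degree_cong[OF k(3)], use fchi(2)[OF P] in \<open>auto elim: eventually_mono\<close>)
    have "has_degree t n R (real (2 * N) / 2)"
      unfolding has_degree_iff[OF t rat] using size by blast
    moreover have "has_degree t n (left_factor t n N C A B P) (real k1 / 2)"
      unfolding has_degree_iff[OF t ratf(1)[OF P]]
      using sizes by blast
    moreover have "has_degree t n (right_factor t n C A B P) (real k2 / 2)"
      unfolding has_degree_iff[OF t ratf(2)[OF P]]
      using sizes by blast
    moreover have "real (2 * N) / 2 = real k1 / 2 + real k2 / 2" using k(1) by linarith
    moreover have "R \<simeq> (\<lambda>x. left_factor t n N C A B P x \<star>\<^bsub>t\<^esub> right_factor t n C A B P x)"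
      unfolding prod_same[OF fcar[OF P]] using k(4) fchi[OF P] by eventually_elim simp
    ultimately show ?thesis
      unfolding minimal_factorization_def using ratf[OF P] by blast
  qed
  have unique: "\<exists>!P. supporting_projection t N (qid n) C A B P \<and>
      R1 \<simeq> left_factor t n N C A B P \<and> R2 \<simeq> right_factor t n C A B P"
    if mf: "minimal_factorization t n R R1 R2" and R0: "R1 0 = qid n" "R2 0 = qid n" for R1 R2
  proof -
    have rat12: "rational_fun t n R1" "rational_fun t n R2" and eq: "R \<simeq> (\<lambda>x. R1 x \<star>\<^bsub>t\<^esub> R2 x)"
      using mf by (auto simp: minimal_factorization_def)
    have car1: "\<forall>\<^sub>F x in nhds 0. R1 x \<in> carrier_mat n n" and car2: "\<forall>\<^sub>F x in nhds 0. R2 x \<in> carrier_mat n n"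
      using rational_funD(1)[OF t] rat12 by auto
    obtain m k1 k2 where k: "cplx_degree (2 * n) ?F m" "cplx_degree (2 * n) (\<lambda>x. chi t (R1 x)) k1"
      "cplx_degree (2 * n) (\<lambda>x. chi t (R2 x)) k2" "real m / 2 = real k1 / 2 + real k2 / 2"
      using mf unfolding minimal_factorization_def has_degree_iff[OF t rat] has_degree_iff[OF t rat12(1)]
        has_degree_iff[OF t rat12(2)] using rat rat12 by (auto simp: has_degree_iff[OF t])
    have "m = 2 * N" by (rule cplx_degree_unique[OF k(1) size])
    with k(4) have sum: "k1 + k2 = 2 * N" by linarith
    have prod: "\<forall>\<^sub>F x in nhds 0. ?F x = chi t (R1 x) * chi t (R2 x)"
      using eq unfolding prod_same[OF car1 car2] .
    obtain q where q: "supporting (2 * N) ?c ?a ?b q"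
      "\<forall>\<^sub>F x in nhds 0. chi t (R1 x) = lfactor (2 * n) (2 * N) ?c ?a ?b q x"
      "\<forall>\<^sub>F x in nhds 0. chi t (R2 x) = rfactor (2 * n) ?c ?a ?b q x"
      by (rule minimal_imp_supporting[OF min k(2) _ k(3) _ sum prod]) (simp_all add: R0 chi_qid)
    have "quaternionic t q"
    proof (rule projection_quaternionic[OF t min q(1)])
      show "\<forall>\<^sub>F x in nhds 0. quaternionic t (lfactor (2 * n) (2 * N) ?c ?a ?b q x)"
        using q(2) by eventually_elim (metis chi_quaternionic)
      show "\<forall>\<^sub>F x in nhds 0. quaternionic t (rfactor (2 * n) ?c ?a ?b q x)"
        using q(3) by eventually_elim (metis chi_quaternionic)
    qed (rule chi_quaternionic)+
    then obtain P where P: "P \<in> carrier_mat N N" "chi t P = q"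
      by (rule quaternionic_imp_chi[OF t, of q N N]) (use q(1) in \<open>auto simp: supporting_def\<close>)
    have factors: "R1 \<simeq> left_factor t n N C A B P' \<longleftrightarrow>
        (\<forall>\<^sub>F x in nhds 0. lfactor (2 * n) (2 * N) ?c ?a ?b q x = lfactor (2 * n) (2 * N) ?c ?a ?b (chi t P') x)"
      "R2 \<simeq> right_factor t n C A B P' \<longleftrightarrow>
        (\<forall>\<^sub>F x in nhds 0. rfactor (2 * n) ?c ?a ?b q x = rfactor (2 * n) ?c ?a ?b (chi t P') x)"
      if P': "P' \<in> carrier_mat N N" for P'
      unfolding same[OF car1 fcar(1)[OF P']] same[OF car2 fcar(2)[OF P']]
      by (rule eventually_cong[OF eventually_conj[OF q(2) fchi(1)[OF P']]], force,
          rule eventually_cong[OF eventually_conj[OF q(3) fchi(2)[OF P']]], force)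
    show ?thesis
    proof (rule ex1I)
      show "supporting_projection t N (qid n) C A B P \<and>
          R1 \<simeq> left_factor t n N C A B P \<and> R2 \<simeq> right_factor t n C A B P"
        using P q(1) by (simp add: supp_iff factors)
      fix P' assume "supporting_projection t N (qid n) C A B P' \<and>
          R1 \<simeq> left_factor t n N C A B P' \<and> R2 \<simeq> right_factor t n C A B P'"
      then have P': "P' \<in> carrier_mat N N" "supporting (2 * N) ?c ?a ?b (chi t P')"
        "\<forall>\<^sub>F x in nhds 0. lfactor (2 * n) (2 * N) ?c ?a ?b q x = lfactor (2 * n) (2 * N) ?c ?a ?b (chi t P') x"
        "\<forall>\<^sub>F x in nhds 0. rfactor (2 * n) ?c ?a ?b q x = rfactor (2 * n) ?c ?a ?b (chi t P') x"
        using factors by (auto simp: supp_iff)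
      have "q = chi t P'" by (rule factors_determine_projection[OF min q(1) P'(2-4)])
      then show "P' = P" using chi_inj[OF t P'(1) P(1)] P(2) by simp
    qed
  qed
  show ?thesis
  proof (intro conjI allI impI)
    fix P assume P: "supporting_projection t N (qid n) C A B P"
    show "minimal_factorization t n R (left_factor t n N C A B P) (right_factor t n C A B P)"
      by (rule minimal[OF P])
    have "P \<in> carrier_mat N N" using P by (simp add: supporting_projection_def)
    then show "left_factor t n N C A B P 0 = qid n" "right_factor t n C A B P 0 = qid n"
      by (rule at0)+
  next
    fix R1 R2 assume "minimal_factorization t n R R1 R2 \<and> R1 0 = qid n \<and> R2 0 = qid n"
    then show "\<exists>!P. supporting_projection t N (qid n) C A B P \<and>
        R1 \<simeq> left_factor t n N C A B P \<and> R2 \<simeq> right_factor t n C A B P"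
      by (intro unique) auto
  qed
qed

end
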